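(* Assume that $\{\omega_x\}_{x\in\mathbb{Z}}$ are i.i.d. under $P$ with $P(\omega_0\in[c,1-c])=1$ for some $c>0$, and that $E_P[\rho_0]<1$, where $\rho_x=\frac{1-\omega_x}{\omega_x}$; let $\mathrm{v}_P=\frac{1-E_P[\rho_0]}{1+E_P[\rho_0]}$. Let $\mathcal{C}_0$ be the collection of continuous functions with compact support on $\mathbb{R}$. Assume that the initial configurations $\eta^N_0$ are such that there exists a bounded (measurable) function $\alpha_0:\mathbb{R}\to\mathbb{R}$ such that for all $g\in\mathcal{C}_0$, $$\lim_{N\to\infty}\frac1N\sum_{x\in\mathbb{Z}}\eta^N_0(x)\,g(x/N)=\int_{\mathbb{R}}\alpha_0(y)g(y)\,dy,\qquad \mathbb{P}\text{-a.s.}\qquad (1)$$ Then for all $g\in\mathcal{C}_0$ and all $0\le t<\infty$, $$\lim_{N\to\infty}\frac1N\sum_{x\in\mathbb{Z}}\eta^N_{Nt}(x)\,g(x/N)=\int_{\mathbb{R}}\alpha_0(y-\mathrm{v}_Pt)g(y)\,dy,\qquad \mathbb{P}\text{-a.s.}\qquad (2)$$ Moreover, if instead one only assumes that, for $P$-a.e. $\omega$, the convergence in (1) holds in $P_\omega$-probability for all $g\in\mathcal{C}_0$, then, for $P$-a.e. $\omega$, the convergence in (2) holds in $P_\omega$-probability for all $g\in\mathcal{C}_0$ and $0\le t<\infty$.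
   Context: An environment is an element $\omega=\{\omega_x\}_{x\in\mathbb{Z}}$ of $\Omega=[0,1]^{\mathbb{Z}}$. Given $\omega$, under the quenched law $P_\omega$, $\{X^{x,i}_\cdot\}_{x\in\mathbb{Z},\,i\ge 1}$ is an independent collection of nearest-neighbor Markov chains on $\mathbb{Z}$ with $P_\omega(X^{x,i}_0=x)=1$, and from a site $y$ each chain steps to $y+1$ with probability $\omega_y$ and to $y-1$ with probability $1-\omega_y$. $P$ is a probability measure on $\Omega$ with expectation $E_P$. The averaged law is $\mathbb{P}(\cdot)=\int_\Omega P_\omega(\cdot)\,P(d\omega)$. For each $N\ge1$, $\eta^N_0\in(\mathbb{Z}_+)^{\mathbb{Z}}$ (with $\mathbb{Z}_+$ the non-negative integers) is an initial configuration of particles, which may be deterministic or random (even depending on $\omega$), but such that given $\omega$ the paths of the random walks are independent of the values $\eta^N_0(x)$, $x\in\mathbb{Z}$. The symbols $P_\omega$ and $\mathbb{P}$ also denote the quenched and averaged laws of the walks together with these initial configurations. The number of particles at $x$ at time $n$ is $$\eta^N_n(x)=\sum_{y\in\mathbb{Z}}\sum_{i=1}^{\eta^N_0(y)}\mathbf{1}\{X^{y,i}_n=x\}.$$ A non-integer time $Nt$ is understood as $\lfloor Nt\rfloor$. *)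

theory Defs
  imports "HOL-Probability.Probability"
begin

type_synonym env = "int \<Rightarrow> real"

type_synonym configuration = "int \<Rightarrow> nat"

definition env_space :: "env measure" where
  "env_space = (\<Pi>\<^sub>M x\<in>UNIV. restrict_space borel {0..1})"

definition rho :: "env \<Rightarrow> int \<Rightarrow> real" where
  "rho \<omega> x = (1 - \<omega> x) / \<omega> x"

definition speed :: "env measure \<Rightarrow> real" where
  "speed P = (1 - (\<integral>\<omega>. rho \<omega> 0 \<partial>P)) / (1 + (\<integral>\<omega>. rho \<omega> 0 \<partial>P))"

definition iid_env :: "env measure \<Rightarrow> bool" where
  "iid_env P \<longleftrightarrow>
     prob_space.indep_vars P (\<lambda>_. borel) (\<lambda>x \<omega>. \<omega> x) UNIV \<and>
     (\<forall>x. distr P borel (\<lambda>\<omega>. \<omega> x) = distr P borel (\<lambda>\<omega>. \<omega> 0))"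

definition step_prob :: "env \<Rightarrow> int \<Rightarrow> int \<Rightarrow> real" where
  "step_prob \<omega> y z = (if z = y + 1 then \<omega> y else if z = y - 1 then 1 - \<omega> y else 0)"

definition path_space :: "(nat \<Rightarrow> int) measure" where
  "path_space = (\<Pi>\<^sub>M n\<in>UNIV. count_space UNIV)"

definition markov_chain_from ::
    "'a measure \<Rightarrow> (int \<Rightarrow> int \<Rightarrow> real) \<Rightarrow> int \<Rightarrow> ('a \<Rightarrow> nat \<Rightarrow> int) \<Rightarrow> bool" where
  "markov_chain_from M p x X \<longleftrightarrow>
     X \<in> measurable M path_space \<and>
     \<P>(s in M. X s 0 = x) = 1 \<and>
     (\<forall>n y z. \<P>(s in M. \<forall>k\<le>n. X s k = y k) > 0 \<longrightarrow>
        \<P>(s in M. X s (Suc n) = z \<bar> \<forall>k\<le>n. X s k = y k) = p (y n) z)"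

text \<open>
  The library's \<open>indep_var\<close> needs both random variables to have the same type; here the walks
  and the configuration have different ones.
\<close>

definition indep_rv ::
    "'a measure \<Rightarrow> 'b measure \<Rightarrow> ('a \<Rightarrow> 'b) \<Rightarrow> 'c measure \<Rightarrow> ('a \<Rightarrow> 'c) \<Rightarrow> bool" where
  "indep_rv M A f B g \<longleftrightarrow>
     f \<in> measurable M A \<and> g \<in> measurable M B \<and>
     prob_space.indep_set M {f -` a \<inter> space M | a. a \<in> sets A} {g -` b \<inter> space M | b. b \<in> sets B}"

text \<open>
  Walks \<open>X x i\<close> and initial configurations \<open>\<eta> N\<close> are random variables on a sample space whose
  measure \<open>M\<close> is the quenched law for the environment \<open>\<omega>\<close>. The labels \<open>i\<close> and \<open>N\<close> start at 1, so nothing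
  is assumed about \<open>X x 0\<close> and \<open>\<eta> 0\<close>. Measurability of the walks and of the configurations
  is part of the independence assertions.
\<close>

definition walk_labels :: "(int \<times> nat) set" where
  "walk_labels = UNIV \<times> {1..}"

definition quenched_system ::
    "env \<Rightarrow> 'a measure \<Rightarrow> (int \<Rightarrow> nat \<Rightarrow> 'a \<Rightarrow> nat \<Rightarrow> int) \<Rightarrow> (nat \<Rightarrow> 'a \<Rightarrow> configuration) \<Rightarrow> bool" where
  "quenched_system \<omega> M X \<eta> \<longleftrightarrow>
     (\<forall>x. \<forall>i\<ge>1. markov_chain_from M (step_prob \<omega>) x (X x i)) \<and>
     prob_space.indep_vars M (\<lambda>_. path_space) (\<lambda>(x, i). X x i) walk_labels \<and>
     (\<forall>N\<ge>1. indep_rv M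
        (\<Pi>\<^sub>M _\<in>walk_labels. path_space) (\<lambda>s. \<lambda>(x, i)\<in>walk_labels. X x i s)
        (\<Pi>\<^sub>M _\<in>UNIV. count_space UNIV) (\<eta> N))"

definition averaged_law :: "env measure \<Rightarrow> (env \<Rightarrow> 'a measure) \<Rightarrow> 'a measure" where
  "averaged_law P Q = P \<bind> Q"

text \<open>
  The sum over starting points has finitely many nonzero terms almost surely under each
  quenched law, since the walks are almost surely nearest-neighbour. On the exceptional null
  set the library's \<open>infsum\<close> over \<open>nat\<close> takes the value 0 whenever the sum diverges.
\<close>

definition particles ::
    "(int \<Rightarrow> nat \<Rightarrow> 'a \<Rightarrow> nat \<Rightarrow> int) \<Rightarrow> ('a \<Rightarrow> configuration) \<Rightarrow> nat \<Rightarrow> 'a \<Rightarrow> configuration" where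
  "particles X \<eta>0 n s x = (\<Sum>\<^sub>\<infinity>y. \<Sum>i=1..\<eta>0 s y. of_bool (X y i s n = x))"

definition empirical :: "nat \<Rightarrow> configuration \<Rightarrow> (real \<Rightarrow> real) \<Rightarrow> real" where
  "empirical N \<xi> g = (1 / real N) * (\<Sum>\<^sub>\<infinity>x. real (\<xi> x) * g (real_of_int x / real N))"

definition C0 :: "(real \<Rightarrow> real) set" where
  "C0 = {g. continuous_on UNIV g \<and> compact (closure {x. g x \<noteq> 0})}"

definition tendsto_in_prob :: "'a measure \<Rightarrow> (nat \<Rightarrow> 'a \<Rightarrow> real) \<Rightarrow> real \<Rightarrow> bool" where
  "tendsto_in_prob M Y l \<longleftrightarrow>
     (\<forall>\<epsilon>>0. (\<lambda>N. \<P>(s in M. \<bar>Y N s - l\<bar> > \<epsilon>)) \<longlonglongrightarrow> 0)"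

end

theory Submission
  imports Defs
begin

text \<open>
  Write \<open>V\<^sub>x = \<rho>\<^sub>x + \<rho>\<^sub>x \<rho>\<^bsub>x-1\<^esub> + \<dots>\<close> and \<open>U\<^sub>x = \<rho>\<^sub>x + \<rho>\<^sub>x \<rho>\<^bsub>x+1\<^esub> + \<dots>\<close>. The quenched expected time to cross from
  \<open>x\<close> to \<open>x + 1\<close> is \<open>1 + 2 V\<^sub>x\<close>; if \<open>h\<close> has these increments, then \<open>h(X\<^sub>n) - n\<close> is a quenched martingale,
  and \<open>1 + U\<^bsub>x+1\<^esub>\<close> controls the expected number of visits to \<open>x\<close>. Hence the quenched variance of
  \<open>h(X\<^sub>n) - n\<close> is at most a constant times the sum of \<open>(1 + V\<^bsub>x-1\<^esub>)\<^sup>2 (1 + U\<^bsub>x+1\<^esub>)\<close> over \<open>|x - X\<^sub>0| \<le> n\<close>,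
  uniformly in the starting point. As \<open>E \<rho>\<^sup>p < 1\<close> for some \<open>p > 1\<close>, \<open>V\<close> and \<open>U\<close> have bounded \<open>p\<close>-th moments;
  since \<open>V\<^bsub>x-1\<^esub>\<close> and \<open>U\<^bsub>x+1\<^esub>\<close> are independent, that sum is almost surely \<open>o(n\<^sup>2)\<close>. The same moments and the
  recursion \<open>V\<^sub>x = \<rho>\<^sub>x (1 + V\<^bsub>x-1\<^esub>)\<close> give \<open>h(x) / x \<rightarrow> 1 / v\<close> almost surely. So for almost every environment the
  weak law for the walks holds uniformly over starting points in \<open>[-R N, R N]\<close>.

  Given the initial configuration the walks are independent, so by a Chernoff bound the probability
  that more than \<open>\<epsilon> N\<close> of at most \<open>K N\<close> particles deviate from their expected position by \<open>\<delta> N\<close> is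
  exponentially small. Apart from these particles, the empirical measure at time \<open>N t\<close> is the initial
  one translated by \<open>v t\<close>.
\<close>

section \<open>The walk in a fixed environment\<close>

text \<open>The initial configuration may depend on the environment and put its particles at the
  worst sites, so the quenched bound must be uniform over starting points; hence the variance is
  bounded through \<open>green\<close>, whose maximum over the start is explicit. E \<rho> < 1 does
  not imply E \<rho>^2 < 1, so V and U may have infinite variance, and one p in (1, 2] serves
  throughout. Bounded means give partial sums of order n^s for s > 1 only: enough for the variance,
  where (1 + p) / p < 2, but not for h(x) / x, which needs truncation, orthogonality and a
  subsequence j^m. The weak law has no rate. Summability for Borel-Cantelli comes from the
  independence of the particles: a small constant deviation probability for each makes a large
  fraction of deviating particles exponentially unlikely. The number of particles is bounded by
  applying the hypothesis to the test function \<open>bump\<close>. \<open>uniform_weak_lln\<close>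
  is a property of \<omega> alone that covers all t, so its exceptional set depends neither on t nor
  on the test function.\<close>

definition walk_op :: "env \<Rightarrow> (int \<Rightarrow> real) \<Rightarrow> int \<Rightarrow> real" where
  "walk_op \<omega> f z = \<omega> z * f (z + 1) + (1 - \<omega> z) * f (z - 1)"

definition height :: "(int \<Rightarrow> real) \<Rightarrow> int \<Rightarrow> real" where
  "height d x = (if 0 \<le> x then (\<Sum>i\<in>{0..<x}. d i) else - (\<Sum>i\<in>{x..<0}. d i))"

lemma height_step: "height d (x + 1) = height d x + d x"
proof (cases "0 \<le> x")
  case True
  then have "{0..<x+1} = insert x {0..<x}" by auto
  with True show ?thesis by (simp add: height_def)
next
  case False
  then have "{x..<0} = insert x {x+1..<0}" by auto
  with False show ?thesis by (cases "x = -1") (auto simp: height_def)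
qed

text \<open>Stated through powers of \<open>walk_op\<close>, whose n-th power at y is the quenched
  expectation after n steps from y, so that no sample space is mentioned. The cutoff |z - y| <= n
  removes only unreachable sites; it keeps every estimate inside a finite window and matches
  \<open>prob_walk\<close>.\<close>

definition uniform_weak_lln :: "env \<Rightarrow> real \<Rightarrow> bool" where
  "uniform_weak_lln \<omega> v \<longleftrightarrow> (\<forall>(t::real)\<ge>0. \<forall>(\<delta>::real)>0. \<forall>(R::real)\<ge>0. \<forall>(e::real)>0. \<forall>\<^sub>F N in sequentially.
     \<forall>y. \<bar>real_of_int y\<bar> \<le> R * real N \<longrightarrow>
       (walk_op \<omega> ^^ nat \<lfloor>real N * t\<rfloor>)
         (\<lambda>z. of_bool (\<delta> * real N < \<bar>real_of_int z - real_of_int y - v * (real N * t)\<bar> \<and> \<bar>z - y\<bar> \<le> nat \<lfloor>real N * t\<rfloor>)) y \<le> e)"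

lemma of_bool_leI: "(P \<Longrightarrow> Q) \<Longrightarrow> of_bool P \<le> (of_bool Q :: 'a :: linordered_semidom)"
  by simp

text \<open>The recursions are kept abstract; in the application V and U are the two one-sided
  perpetuities. \<open>V_rec\<close> is a drift equation: it gives \<open>\<omega> x * (1 + 2 * V x)
  - (1 - \<omega> x) * (1 + 2 * V (x - 1)) = 1\<close>, so a function with increments 1 + 2 V gains
  1 per step on average.\<close>

locale elliptic_env =
  fixes \<omega> :: env and c :: real and V U :: "int \<Rightarrow> real"
  assumes c_pos: "0 < c" and ell: "c \<le> \<omega> x" "\<omega> x \<le> 1 - c"
    and V_rec: "V x = rho \<omega> x * (1 + V (x - 1))" and V_nonneg: "0 \<le> V x"
    and U_rec: "U x = rho \<omega> x * (1 + U (x + 1))" and U_nonneg: "0 \<le> U x"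
begin

lemma \<omega>_pos: "0 < \<omega> x" and \<omega>_lt: "\<omega> x < 1"
  using ell[of x] c_pos by linarith+

lemma rho_pos: "0 < rho \<omega> x"
  using \<omega>_pos[of x] \<omega>_lt[of x] by (simp add: rho_def)

lemma rho_le: "rho \<omega> x \<le> 1 / c"
  unfolding rho_def using ell[of x] \<omega>_pos[of x] c_pos by (intro frac_le) auto

lemma \<omega>_rho: "\<omega> x * rho \<omega> x = 1 - \<omega> x"
  using \<omega>_pos[of x] by (simp add: rho_def)

lemma walk_op_mono: "(\<And>z. f z \<le> g z) \<Longrightarrow> walk_op \<omega> f z \<le> walk_op \<omega> g z"
  unfolding walk_op_def using \<omega>_pos[of z] \<omega>_lt[of z]
  by (intro add_mono mult_left_mono) auto

lemma walk_op_pow_mono: "(\<And>z. f z \<le> g z) \<Longrightarrow> (walk_op \<omega> ^^ n) f z \<le> (walk_op \<omega> ^^ n) g z"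
  by (induction n arbitrary: z) (auto intro: walk_op_mono)

definition ht :: "int \<Rightarrow> real" where "ht = height (\<lambda>x. 1 + 2 * V x)"

definition var :: "int \<Rightarrow> real" where "var x = 4 * rho \<omega> x * (1 + V (x - 1))\<^sup>2"

lemma var_nonneg: "0 \<le> var x"
  using rho_pos[of x] by (simp add: var_def)

lemma ht_up: "ht (x + 1) = ht x + 1 + 2 * V x"
  unfolding ht_def by (simp add: height_step)

lemma ht_down: "ht (x - 1) = ht x - 1 - 2 * V (x - 1)"
  using ht_up[of "x - 1"] by simp

text \<open>\<open>ht\<close> makes \<open>ht X\<^sub>n - n\<close> a martingale, with conditional variance \<open>var\<close>.\<close>

lemma walk_op_ht_square:
  "walk_op \<omega> (\<lambda>x. (ht x - b)\<^sup>2) z = (ht z - b + 1)\<^sup>2 + var z"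
proof -
  define w where "w = \<omega> z"
  define W where "W = 1 + V (z - 1)"
  define H where "H = ht z - b"
  define q where "q = rho \<omega> z"
  have wq: "w * q = 1 - w" unfolding w_def q_def by (rule \<omega>_rho)
  have Vz: "V z = q * W" unfolding q_def W_def by (rule V_rec)
  \<comment> \<open>Relative to the drift 1, the increments of \<open>ht\<close> are 2 q W upwards
    and - 2 W downwards. The relation w q = 1 - w cancels their mean and reduces the second moment 4
    W^2 (w q^2 + 1 - w) to 4 q W^2, which is \<open>var z\<close>.\<close>
  have "walk_op \<omega> (\<lambda>x. (ht x - b)\<^sup>2) z = w * (H + 1 + 2 * (q * W))\<^sup>2 + (1 - w) * (H + 1 - 2 * W)\<^sup>2"
    unfolding walk_op_def ht_up ht_down w_def H_def Vz[symmetric]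
    by (simp add: W_def algebra_simps)
  also have "\<dots> = (H+1)\<^sup>2 + 4 * (H + 1) * W * (w * q - (1 - w)) + 4 * W\<^sup>2 * ((w * q) * q + (1 - w))"
    by (simp add: algebra_simps power2_eq_square)
  also have "(w * q) * q + (1 - w) = q * (w * q + w)"
    unfolding wq by (simp add: algebra_simps flip: wq)
  also have "w * q + w = 1" using wq by simp
  finally show ?thesis unfolding wq by (simp add: H_def var_def q_def W_def mult_ac)
qed

text \<open>Up to the factor \<open>\<omega> x\<close> this is the Green function: for the
  perpetuity U, \<open>green x z / \<omega> x\<close> is the expected number of visits to x from z.
  It is constant for z <= x because a walk drifting to the right must pass x; for z > x it is
  proportional to the probability of ever coming back to x.\<close>

definition green :: "int \<Rightarrow> int \<Rightarrow> real" where
  "green x z = (if z \<le> x then 1 + U (x + 1)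
     else (\<Prod>j\<in>{x+1..<z}. rho \<omega> j) * U z)"

lemma green_nonneg: "0 \<le> green x z"
  unfolding green_def using rho_pos U_nonneg by (auto intro!: mult_nonneg_nonneg prod_nonneg simp: less_imp_le)

lemma green_step: 
  assumes "x < z" shows "green x z - green x (z + 1) = (\<Prod>j\<in>{x+1..<z+1}. rho \<omega> j)"
proof -
  have "{x+1..<z+1} = insert z {x+1..<z}" using assms by auto
  then show ?thesis using assms U_rec[of z] by (simp add: green_def algebra_simps)
qed

lemma green_step_eq: "green x x - green x (x + 1) = 1"
  by (simp add: green_def)

lemma green_anti: "green x (z + 1) \<le> green x z"
proof -
  consider "x < z" | "z = x" | "z < x" by linarith
  then show ?thesis
  proof cases
    case 1
    have "0 \<le> (\<Prod>j\<in>{x+1..<z+1}. rho \<omega> j)"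
      using rho_pos by (auto intro!: prod_nonneg simp: less_imp_le)
    with green_step[OF 1] show ?thesis by simp
  qed (use green_step_eq[of x] in \<open>auto simp: green_def\<close>)
qed

text \<open>Monotonicity in z puts the maximum at the starts z <= x. Since the bound does not
  involve z, everything derived from it is uniform in the starting point.\<close>

lemma green_le: "green x z \<le> 1 + U (x + 1)"
proof (cases "z \<le> x")
  case False
  then have "x \<le> z" by simp
  then have "green x z \<le> green x x"
    by (induction z rule: int_ge_induct) (auto intro: order_trans[OF green_anti])
  then show ?thesis by (simp add: green_def)
qed (simp add: green_def)

text \<open>Right of x consecutive decrements differ by the factor \<open>rho \<omega> z\<close>,
  and \<open>\<omega> z * rho \<omega> z = 1 - \<omega> z\<close> balances them; left of x all of
  them vanish. At x the decrement to the right is 1 and the one to the left 0, which leaves the loss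
  \<open>\<omega> x\<close>.\<close>

lemma walk_op_green: "walk_op \<omega> (green x) z = green x z - (if z = x then \<omega> x else 0)"
proof -
  have eq: "walk_op \<omega> (green x) z = green x z - \<omega> z * (green x z - green x (z + 1))
      + (1 - \<omega> z) * (green x (z - 1) - green x z)"
    by (simp add: walk_op_def algebra_simps)
  consider "x + 1 < z" | "z = x + 1" | "z = x" | "z < x" by linarith
  then show ?thesis
  proof cases
    case 1
    have "{x+1..<z+1} = insert z {x+1..<z}" using 1 by auto
    then have "green x z - green x (z + 1) = rho \<omega> z * (\<Prod>j\<in>{x+1..<z}. rho \<omega> j)"
      using 1 by (simp add: green_step)
    moreover have "green x (z - 1) - green x z = (\<Prod>j\<in>{x+1..<z}. rho \<omega> j)"
      using green_step[of x "z - 1"] 1 by simp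
    ultimately show ?thesis using 1 \<omega>_rho[of z] unfolding eq
      by (simp add: mult.assoc[symmetric])
  next
    case 2
    have "{x+1..<z+1} = {z}" using 2 by auto
    then have "green x z - green x (z + 1) = rho \<omega> z"
      using green_step[of x z] 2 by simp
    then show ?thesis using 2 green_step_eq[of x] \<omega>_rho[of z] unfolding eq by simp
  next
    case 3
    then show ?thesis using green_step_eq[of x] unfolding eq by (simp add: green_def)
  next
    case 4
    then show ?thesis unfolding eq by (simp add: green_def)
  qed
qed

text \<open>Dividing by \<open>\<omega> x\<close> normalises the loss of \<open>green x\<close> at x
  to 1, so that one step of the walk from a site of W lowers \<open>pot W\<close> on average by
  exactly the variance \<open>var\<close> picked up there.\<close>

definition pot :: "int set \<Rightarrow> int \<Rightarrow> real" where
  "pot W z = (\<Sum>x\<in>W. var x / \<omega> x * green x z)"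

lemma pot_nonneg: "0 \<le> pot W z"
  unfolding pot_def using \<omega>_pos var_nonneg green_nonneg
  by (intro sum_nonneg mult_nonneg_nonneg divide_nonneg_nonneg) (auto intro: less_imp_le)

lemma walk_op_pot:
  assumes "finite W"
  shows "walk_op \<omega> (pot W) z = pot W z - (if z \<in> W then var z else 0)"
proof -
  have "walk_op \<omega> (pot W) z = (\<Sum>x\<in>W. var x / \<omega> x * walk_op \<omega> (green x) z)"
    unfolding walk_op_def pot_def
    by (simp add: sum_distrib_left sum.distrib[symmetric] distrib_left mult.left_commute)
  also have "\<dots> = (\<Sum>x\<in>W. var x / \<omega> x * green x z - (if x = z then var z else 0))"
    using \<omega>_pos by (intro sum.cong) (auto simp: walk_op_green algebra_simps less_imp_neq[symmetric])
  also have "\<dots> = pot W z - (if z \<in> W then var z else 0)"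
    using assms by (simp add: sum_subtractf pot_def)
  finally show ?thesis .
qed

lemma pot_le: "pot W z \<le> 4 / c\<^sup>2 * (\<Sum>x\<in>W. (1 + V (x - 1))\<^sup>2 * (1 + U (x + 1)))"
  unfolding pot_def sum_distrib_left
proof (rule sum_mono)
  fix x
  have "var x / \<omega> x \<le> var x / c"
    using ell(1)[of x] c_pos var_nonneg[of x] by (simp add: frac_le)
  also have "\<dots> \<le> (4 * (1 / c) * (1 + V (x - 1))\<^sup>2) / c"
    using rho_le[of x] c_pos unfolding var_def
    by (intro divide_right_mono mult_right_mono mult_left_mono) auto
  finally have "var x / \<omega> x * green x z \<le> (4 * (1 / c) * (1 + V (x - 1))\<^sup>2) / c * (1 + U (x + 1))"
    using green_le[of x z] green_nonneg[of x z] c_pos by (intro mult_mono) auto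
  then show "var x / \<omega> x * green x z \<le> 4 / c\<^sup>2 * ((1 + V (x - 1))\<^sup>2 * (1 + U (x + 1)))"
    by (simp add: power2_eq_square mult_ac)
qed

text \<open>Chebyshev's inequality by induction on the number n of remaining steps. The quantity (ht
  - b + n)^2 + pot is preserved in expectation by a step from a site of W: the square gains
  \<open>var\<close>, \<open>pot\<close> loses it. Only sites within distance n of the start are
  visited, so a finite W suffices.\<close>

lemma walk_op_pow_deviation:
  assumes "0 < e" "finite W" "{z - int n..z + int n} \<subseteq> W"
  shows "(walk_op \<omega> ^^ n) (\<lambda>x. of_bool (e \<le> \<bar>ht x - b\<bar>)) z \<le> ((ht z - b + n)\<^sup>2 + pot W z) / e\<^sup>2"
  using assms(3)
proof (induction n arbitrary: z)
  case 0
  show ?case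
  proof (cases "e \<le> \<bar>ht z - b\<bar>")
    case True
    then have "e\<^sup>2 \<le> (ht z - b)\<^sup>2"
      using power_mono[OF True, of 2] assms(1) by simp
    then have "e\<^sup>2 \<le> (ht z - b)\<^sup>2 + pot W z"
      using pot_nonneg[of W z] by simp
    then show ?thesis using assms(1) True by (simp add: field_simps)
  qed (use pot_nonneg[of W z] in simp)
next
  case (Suc n)
  let ?f = "(walk_op \<omega> ^^ n) (\<lambda>x. of_bool (e \<le> \<bar>ht x - b\<bar>))"
  let ?g = "\<lambda>z. ((ht z - (b - n))\<^sup>2 + pot W z) / e\<^sup>2"
  have fg: "?f x \<le> ?g x" if "x = z + 1 \<or> x = z - 1" for x
  proof -
    have "?f x \<le> ((ht x - b + n)\<^sup>2 + pot W x) / e\<^sup>2"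
      using Suc.prems that by (intro Suc.IH) auto
    then show ?thesis by (simp add: algebra_simps)
  qed
  have zW: "z \<in> W" using Suc.prems by auto
  have "(walk_op \<omega> ^^ Suc n) (\<lambda>x. of_bool (e \<le> \<bar>ht x - b\<bar>)) z = walk_op \<omega> ?f z"
    by simp
  also have "\<dots> \<le> walk_op \<omega> ?g z"
    unfolding walk_op_def[of \<omega> _ z] using \<omega>_pos[of z] \<omega>_lt[of z] fg
    by (intro add_mono mult_left_mono) auto
  also have "\<dots> = (walk_op \<omega> (\<lambda>x. (ht x - (b - n))\<^sup>2) z + walk_op \<omega> (pot W) z) / e\<^sup>2"
    unfolding walk_op_def using assms(1) by (simp add: field_simps)
  also have "\<dots> = ((ht z - b + Suc n)\<^sup>2 + pot W z) / e\<^sup>2"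
    unfolding walk_op_ht_square walk_op_pot[OF assms(2)] using zW by (simp add: algebra_simps)
  finally show ?case .
qed

text \<open>The two limits control all but finitely many sites; C is the maximum over the rest,
  which makes the error bound usable on a whole window at once.\<close>

lemma height_linear:
  assumes up: "(\<lambda>n. ht (int n) / n) \<longlonglongrightarrow> L" and dn: "(\<lambda>n. ht (- int n) / n) \<longlonglongrightarrow> - L"
    and "0 < (e::real)"
  shows "\<exists>C::real. \<forall>x. \<bar>ht x - L * x\<bar> \<le> e * \<bar>real_of_int x\<bar> + C"
proof -
  have "\<forall>\<^sub>F n in sequentially. \<bar>ht (int n) / n - L\<bar> < e" "\<forall>\<^sub>F n in sequentially. \<bar>ht (- int n) / n + L\<bar> < e"
    using tendstoD[OF up assms(3)] tendstoD[OF dn assms(3)] by (simp_all add: dist_real_def)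
  then have "\<forall>\<^sub>F n in sequentially. \<bar>ht (int n) / n - L\<bar> < e \<and> \<bar>ht (- int n) / n + L\<bar> < e \<and> 0 < n"
    using eventually_gt_at_top[of "0::nat"] by eventually_elim auto
  then obtain m where m: "\<And>n. m \<le> n \<Longrightarrow> \<bar>ht (int n) / n - L\<bar> < e \<and> \<bar>ht (- int n) / n + L\<bar> < e \<and> 0 < n"
    by (auto simp: eventually_sequentially)
  define C where "C = Max ((\<lambda>x. \<bar>ht x - L * x\<bar>) ` {- int m..int m})"
  have "\<bar>ht x - L * x\<bar> \<le> e * \<bar>real_of_int x\<bar> + C" for x
  proof -
    have C0: "\<bar>ht x - L * x\<bar> \<le> C" if "\<bar>x\<bar> \<le> int m" for x
      unfolding C_def using that by (intro Max_ge imageI) auto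
    have Cn: "0 \<le> C" using C0[of 0] by simp
    show ?thesis
    proof (cases "\<bar>x\<bar> \<le> int m")
      case True
      have "0 \<le> e * \<bar>real_of_int x\<bar>" using assms(3) by simp
      then show ?thesis using C0[OF True] by linarith
    next
      case False
      define n where "n = nat \<bar>x\<bar>"
      have n: "m \<le> n" "int n = \<bar>x\<bar>" using False by (auto simp: n_def)
      note * = m[OF n(1)]
      have "\<bar>ht x - L * x\<bar> \<le> e * n"
      proof (cases "0 \<le> x")
        case True
        then have x: "x = int n" using n by simp
        have "ht x - L * x = (ht (int n) / n - L) * n"
          using * by (simp add: x field_simps)
        then have "\<bar>ht x - L * x\<bar> = \<bar>ht (int n) / n - L\<bar> * n"
          by (simp add: abs_mult)
        then show ?thesis using * by (simp add: mult_right_mono)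
      next
        case False
        then have x: "x = - int n" using n by simp
        have "ht x - L * x = (ht (- int n) / n + L) * n"
          using * by (simp add: x field_simps)
        then have "\<bar>ht x - L * x\<bar> = \<bar>ht (- int n) / n + L\<bar> * n"
          by (simp add: abs_mult)
        then show ?thesis using * by (simp add: mult_right_mono)
      qed
      moreover have "real n = \<bar>real_of_int x\<bar>" using n(2) by (metis of_int_of_nat_eq of_int_abs)
      ultimately show ?thesis using Cn by simp
    qed
  qed
  then show ?thesis by blast
qed

lemma uniform_weak_law:
  fixes v :: real
  assumes A: "(\<lambda>n. (\<Sum>x\<in>{- int n..int n}. (1 + V (x - 1))\<^sup>2 * (1 + U (x + 1))) / (real n)\<^sup>2) \<longlonglongrightarrow> 0"
    and up: "(\<lambda>n. ht (int n) / n) \<longlonglongrightarrow> 1 / v" and dn: "(\<lambda>n. ht (- int n) / n) \<longlonglongrightarrow> - (1 / v)"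
    and v: "0 < v"
  shows "uniform_weak_lln \<omega> v"
  unfolding uniform_weak_lln_def
proof (intro allI impI)
  fix t \<delta> R e :: real
  assume t: "0 \<le> t" and \<delta>: "0 < \<delta>" and R: "0 \<le> R" and e: "0 < e"
  \<comment> \<open>A displacement of \<delta> N in space is \<delta> N / v = 2 D N on the scale of
    \<open>ht\<close>.\<close>
  define D where "D = \<delta> / (2 * v)"
  define k where "k = nat \<lceil>R + t + 1\<rceil>"
  have k: "R + t + 1 \<le> real k" unfolding k_def by linarith
  then have k0: "1 \<le> real k" using R t by linarith
  have D: "0 < D" using \<delta> v by (simp add: D_def)
  \<comment> \<open>On the window |x| <= k N the linearisation error of \<open>ht\<close> is at most
    D N / 4 + C; it is paid at both ends of the path.\<close>
  define e1 where "e1 = D / (4 * real k)"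
  have e1: "0 < e1" using D k0 by (simp add: e1_def)
  from height_linear[OF up dn e1] obtain C where C: "\<And>x. \<bar>ht x - 1 / v * x\<bar> \<le> e1 * \<bar>real_of_int x\<bar> + C" by blast
  define S where "S n = (\<Sum>x\<in>{- int n..int n}. (1 + V (x - 1))\<^sup>2 * (1 + U (x + 1)))" for n
  \<comment> \<open>Chosen so that the final Chebyshev quotient is exactly e.\<close>
  define e2 where "e2 = e * (D / 2)\<^sup>2 * c\<^sup>2 / (4 * (real k)\<^sup>2)"
  have e2: "0 < e2" using e D c_pos k0 by (simp add: e2_def)
  have kt: "filterlim (\<lambda>N. k * N) sequentially sequentially"
    using k0 by (intro filterlim_subseq strict_monoI) auto
  have "(\<lambda>N. S (k * N) / (real (k * N))\<^sup>2) \<longlonglongrightarrow> 0"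
    using filterlim_compose[OF A kt] by (simp add: S_def)
  then have ev1: "\<forall>\<^sub>F N in sequentially. S (k * N) / (real (k * N))\<^sup>2 < e2"
    using e2 by (rule order_tendstoD)
  have ev2: "\<forall>\<^sub>F N in sequentially. (2 * C + 1) / D + 1 \<le> real N / 2"
    using filterlim_real_sequentially[unfolded filterlim_at_top, rule_format, of "2 * ((2 * C + 1) / D + 1)"]
    by eventually_elim simp
  have ev3: "\<forall>\<^sub>F N in sequentially. 1 / v / D \<le> real N / 4"
    using filterlim_real_sequentially[unfolded filterlim_at_top, rule_format, of "4 * (1 / v / D)"]
    by eventually_elim simp
  show "\<forall>\<^sub>F N in sequentially. \<forall>y. \<bar>real_of_int y\<bar> \<le> R * real N \<longrightarrow>
       (walk_op \<omega> ^^ nat \<lfloor>real N * t\<rfloor>)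
         (\<lambda>z. of_bool (\<delta> * real N < \<bar>real_of_int z - real_of_int y - v * (real N * t)\<bar> \<and>
           \<bar>z - y\<bar> \<le> nat \<lfloor>real N * t\<rfloor>)) y \<le> e"
    using ev1 ev2 ev3 eventually_gt_at_top[of "0::nat"]
  proof eventually_elim
    case (elim N)
    define n where "n = nat \<lfloor>real N * t\<rfloor>"
    have n: "real n \<le> N * t" "N * t \<le> n + 1" using t by (auto simp: n_def, linarith)
    show ?case unfolding n_def[symmetric]
    proof (intro allI impI)
      fix y :: int assume y: "\<bar>real_of_int y\<bar> \<le> R * N"
      have N: "0 < N" by fact
      have RtN: "R * N + N * t \<le> real k * N"
        using mult_right_mono[OF k, of "real N"] by (simp add: algebra_simps)
      define W where "W = {- int (k * N)..int (k * N)}"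
      have sub: "{y - int n..y + int n} \<subseteq> W"
      proof
        fix x assume "x \<in> {y - int n..y + int n}"
        then have "\<bar>real_of_int x\<bar> \<le> \<bar>real_of_int y\<bar> + real n" by auto
        also have "\<dots> \<le> real k * N" using y n RtN by linarith
        finally have "real_of_int \<bar>x\<bar> \<le> real_of_int (int (k * N))" by simp
        then have "\<bar>x\<bar> \<le> int (k * N)" by (simp only: of_int_le_iff)
        then show "x \<in> W" by (auto simp: W_def)
      qed
      let ?B = "\<lambda>z::int. \<delta> * real N < \<bar>real_of_int z - real_of_int y - v * (real N * t)\<bar> \<and> \<bar>z - y\<bar> \<le> int n"
      have le: "of_bool (?B z) \<le> (of_bool (D / 2 * N \<le> \<bar>ht z - (ht y + n)\<bar>) :: real)" for z
      proof (rule of_bool_leI)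
        assume True: "?B z"
        have zW: "\<bar>real_of_int z\<bar> \<le> real k * N"
        proof -
          have "z \<in> {y - int n..y + int n}" using True by auto
          then have "z \<in> W" using sub by blast
          then have "\<bar>z\<bar> \<le> int (k * N)" by (auto simp: W_def)
          then have "real_of_int \<bar>z\<bar> \<le> real_of_int (int (k * N))" by (simp only: of_int_le_iff)
          then show ?thesis by simp
        qed
        have yW: "\<bar>real_of_int y\<bar> \<le> real k * N" using y RtN t N by (smt (verit) mult_nonneg_nonneg of_nat_0_le_iff)
        have h1: "\<bar>ht z - 1 / v * z\<bar> \<le> e1 * (real k * N) + C"
          using C[of z] zW e1 mult_left_mono[OF zW, of e1] by linarith
        have h2: "\<bar>ht y - 1 / v * y\<bar> \<le> e1 * (real k * N) + C"
          using C[of y] yW e1 mult_left_mono[OF yW, of e1] by linarith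
        have e1N: "e1 * (real k * N) = D / 4 * N" using k0 by (simp add: e1_def)
        have "2 * D * N = 1 / v * (\<delta> * N)" using v by (simp add: D_def)
        also have "\<dots> \<le> 1 / v * \<bar>z - y - v * (N * t)\<bar>"
          using True v by (intro mult_left_mono) auto
        also have "\<dots> = \<bar>1 / v * z - 1 / v * y - N * t\<bar>"
        proof -
          have "1 / v * z - 1 / v * y - N * t = 1 / v * (z - y - v * (N * t))"
            using v by (simp add: field_simps)
          then show ?thesis using v by (simp add: abs_mult)
        qed
        finally have h3: "2 * D * N \<le> \<bar>1 / v * z - 1 / v * y - N * t\<bar>" .
        \<comment> \<open>The term 2 C pays for the two linearisations and 1 for replacing N t by
          its floor n.\<close>
        have "2 * C + 1 \<le> D * (N / 2)"
          using elim(2) D by (simp add: field_simps)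
        moreover have "\<bar>1 / v * z - 1 / v * y - N * t\<bar>
          \<le> \<bar>ht z - (ht y + n)\<bar> + \<bar>ht z - 1 / v * z\<bar> + \<bar>ht y - 1 / v * y\<bar> + 1"
          using n by linarith
        moreover have "0 \<le> D * N" using D by simp
        ultimately show "D / 2 * N \<le> \<bar>ht z - (ht y + n)\<bar>"
          using h1 h2 h3 unfolding e1N by linarith
      qed
      have "(walk_op \<omega> ^^ n) (\<lambda>z. of_bool (?B z)) y
          \<le> (walk_op \<omega> ^^ n) (\<lambda>z. of_bool (D / 2 * N \<le> \<bar>ht z - (ht y + n)\<bar>)) y"
        by (rule walk_op_pow_mono) (rule le)
      also have "\<dots> \<le> ((ht y - (ht y + n) + n)\<^sup>2 + pot W y) / (D / 2 * N)\<^sup>2"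
        using D N sub by (intro walk_op_pow_deviation) (auto simp: W_def)
      also have "\<dots> = pot W y / (D / 2 * N)\<^sup>2" by simp
      also have "\<dots> \<le> (4 / c\<^sup>2 * S (k * N)) / (D / 2 * N)\<^sup>2"
        unfolding S_def W_def by (intro divide_right_mono pot_le) auto
      also have "\<dots> \<le> (4 / c\<^sup>2 * (e2 * (real (k * N))\<^sup>2)) / (D / 2 * N)\<^sup>2"
      proof -
        have "0 < (real (k * N))\<^sup>2" using N k0 by simp
        then have "S (k * N) \<le> e2 * (real (k * N))\<^sup>2"
          using elim(1) by (simp add: field_simps)
        then show ?thesis by (intro divide_right_mono mult_left_mono) auto
      qed
      also have "\<dots> = e"
      proof -
        have "4 / c\<^sup>2 * (e * d\<^sup>2 * c\<^sup>2 / (4 * k\<^sup>2) * (k * M)\<^sup>2) / (d * M)\<^sup>2 = e"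
          if "d \<noteq> 0" "k \<noteq> 0" "M \<noteq> 0" for d k M :: real
          using that c_pos by (simp add: field_simps)
        from this[of "D / 2" k N] show ?thesis unfolding e2_def using D N k0 by simp
      qed
      finally show "(walk_op \<omega> ^^ n) (\<lambda>z. of_bool (?B z)) y \<le> e" .
    qed
  qed
qed

end

section \<open>The environment\<close>

lemma (in prob_space) indep_var_nn_integral:
  fixes F G :: "'a \<Rightarrow> ennreal"
  assumes "indep_var borel F borel G"
  shows "(\<integral>\<^sup>+x. F x * G x \<partial>M) = (\<integral>\<^sup>+x. F x \<partial>M) * (\<integral>\<^sup>+x. G x \<partial>M)"
proof -
  have "case_bool borel borel = (\<lambda>_::bool. borel :: ennreal measure)"
    by (rule ext) (simp split: bool.split)
  then have "indep_vars (\<lambda>_. borel) (case_bool F G) UNIV"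
    using assms unfolding indep_var_def by simp
  from indep_vars_nn_integral[OF _ this] show ?thesis
    by (simp add: UNIV_bool mult.commute)
qed

lemma (in prob_space) AE_summable_of_nn_integral_le:
  fixes Y :: "nat \<Rightarrow> 'a \<Rightarrow> real"
  assumes [measurable]: "\<And>j. Y j \<in> borel_measurable M" and nn: "\<And>j x. 0 \<le> Y j x"
    and le: "\<And>j. (\<integral>\<^sup>+x. ennreal (Y j x) \<partial>M) \<le> ennreal (e j)" and e: "\<And>j. 0 \<le> e j" "summable e"
  shows "AE x in M. summable (\<lambda>j. Y j x)"
proof -
  have "(\<integral>\<^sup>+x. (\<Sum>j. ennreal (Y j x)) \<partial>M) = (\<Sum>j. \<integral>\<^sup>+x. ennreal (Y j x) \<partial>M)"
    by (rule nn_integral_suminf) simp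
  also have "\<dots> \<le> (\<Sum>j. ennreal (e j))"
    by (intro suminf_le le) auto
  also have "\<dots> = ennreal (suminf e)"
    using e by (intro suminf_ennreal2)
  finally have "(\<integral>\<^sup>+x. (\<Sum>j. ennreal (Y j x)) \<partial>M) \<noteq> \<infinity>"
    by (auto simp: top_unique)
  then have "AE x in M. (\<Sum>j. ennreal (Y j x)) \<noteq> \<infinity>"
    by (intro nn_integral_PInf_AE) auto
  then show ?thesis
    by eventually_elim (intro summable_suminf_not_top nn, simp)
qed

text \<open>Weights (1 + j)^(- s) make the sum of the means finite, so the weighted series converges
  almost surely; for j <= n each weight is at least (1 + n)^(- s). Summability of the weights is
  what forces s > 1.\<close>

lemma (in prob_space) AE_sum_le_powr:
  fixes Y :: "nat \<Rightarrow> 'a \<Rightarrow> real"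
  assumes [measurable]: "\<And>j. Y j \<in> borel_measurable M" and nn: "\<And>j x. 0 \<le> Y j x"
    and le: "\<And>j. (\<integral>\<^sup>+x. ennreal (Y j x) \<partial>M) \<le> ennreal C" and C: "0 \<le> C" and s: "1 < s"
  shows "AE x in M. \<exists>K\<ge>0. \<forall>n. (\<Sum>j\<le>n. Y j x) \<le> K * (1 + real n) powr s"
proof -
  have sm: "summable (\<lambda>j. C * (1 + real j) powr (- s))"
  proof -
    have "summable (\<lambda>j. real (Suc j) powr (- s))"
      using s by (subst summable_Suc_iff) (simp add: summable_real_powr_iff)
    from summable_mult[OF this, of C] show ?thesis by simp
  qed
  have "AE x in M. summable (\<lambda>j. Y j x * (1 + real j) powr (- s))"
  proof (rule AE_summable_of_nn_integral_le[OF _ _ _ _ sm])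
    fix j
    have "(\<integral>\<^sup>+x. ennreal (Y j x * (1 + real j) powr (- s)) \<partial>M)
      = (\<integral>\<^sup>+x. ennreal (Y j x) \<partial>M) * ennreal ((1 + real j) powr (- s))"
      using nn by (simp add: ennreal_mult nn_integral_multc)
    also have "\<dots> \<le> ennreal C * ennreal ((1 + real j) powr (- s))"
      by (intro mult_right_mono le) auto
    finally show "(\<integral>\<^sup>+x. ennreal (Y j x * (1 + real j) powr (- s)) \<partial>M) \<le> ennreal (C * (1 + real j) powr (- s))"
      using C by (simp add: ennreal_mult)
  qed (use nn C in auto)
  then show ?thesis
  proof eventually_elim
    case (elim x)
    let ?Z = "\<lambda>j. Y j x * (1 + real j) powr (- s)"
    have Z: "0 \<le> ?Z j" for j using nn by simp
    show ?case
    proof (intro exI[of _ "suminf ?Z"] conjI allI)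
      show "0 \<le> suminf ?Z" using elim Z by (intro suminf_nonneg)
      fix n
      have "(\<Sum>j\<le>n. Y j x) \<le> (\<Sum>j\<le>n. ?Z j * (1 + real n) powr s)"
      proof (rule sum_mono)
        fix j assume j: "j \<in> {..n}"
        have "Y j x = ?Z j * (1 + real j) powr s"
          by (simp add: powr_minus)
        also have "\<dots> \<le> ?Z j * (1 + real n) powr s"
          using j s Z by (intro mult_left_mono powr_mono2) auto
        finally show "Y j x \<le> ?Z j * (1 + real n) powr s" .
      qed
      also have "\<dots> = (\<Sum>j\<le>n. ?Z j) * (1 + real n) powr s"
        by (simp add: sum_distrib_right)
      also have "\<dots> \<le> suminf ?Z * (1 + real n) powr s"
        using elim Z by (intro mult_right_mono sum_le_suminf) auto
      finally show "(\<Sum>j\<le>n. Y j x) \<le> suminf ?Z * (1 + real n) powr s" .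
    qed
  qed
qed

text \<open>Each term satisfies y^k <= S^(k - 1) y, with S the whole sum. Applied with k = 2 / p to
  pass from p-th moments to the squares in the variance.\<close>

lemma sum_powr_le:
  fixes y :: "'b \<Rightarrow> real"
  assumes "finite A" "\<And>x. x \<in> A \<Longrightarrow> 0 \<le> y x" "1 \<le> k"
  shows "(\<Sum>x\<in>A. y x powr k) \<le> (\<Sum>x\<in>A. y x) powr k"
proof -
  let ?S = "\<Sum>x\<in>A. y x"
  have S: "0 \<le> ?S" using assms by (intro sum_nonneg)
  have split: "z powr k = z powr (k - 1) * z" if "0 \<le> z" for z
    using that powr_mult_base[of z "k - 1"] by (cases "z = 0") (auto simp: mult.commute)
  have "(\<Sum>x\<in>A. y x powr k) \<le> (\<Sum>x\<in>A. ?S powr (k - 1) * y x)"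
  proof (rule sum_mono)
    fix x assume x: "x \<in> A"
    have "y x \<le> ?S" using assms x by (intro member_le_sum) auto
    then show "y x powr k \<le> ?S powr (k - 1) * y x"
      unfolding split[OF assms(2)[OF x]] using assms x
      by (intro mult_right_mono powr_mono2) auto
  qed
  also have "\<dots> = ?S powr k" using split[OF S] by (simp add: sum_distrib_left)
  finally show ?thesis .
qed

text \<open>The factor of a^p can be brought close to 1, which keeps the moment recursion of
  \<open>approx_moment\<close> a contraction. For a >= 3 / \<theta> one has 1 + a <= (1 + \<theta> /
  3) a, and (1 + \<theta> / 3)^2 <= 1 + \<theta> since \<theta> <= 3; smaller a go into the additive
  constant.\<close>

lemma one_plus_powr_le:
  fixes a :: real
  assumes "0 \<le> a" "1 \<le> p" "p \<le> 2" "0 < \<theta>" "\<theta> \<le> 3"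
  shows "(1 + a) powr p \<le> (1 + \<theta>) * a powr p + (1 + 3 / \<theta>) powr p"
proof (cases "3 / \<theta> \<le> a")
  case True
  then have a: "0 < a" using assms by (meson divide_pos_pos less_le_trans zero_less_numeral)
  have "1 + a \<le> (1 + \<theta> / 3) * a" using True assms by (simp add: field_simps)
  then have "(1 + a) powr p \<le> ((1 + \<theta> / 3) * a) powr p"
    using assms by (intro powr_mono2) auto
  also have "\<dots> = (1 + \<theta> / 3) powr p * a powr p"
    using assms by (simp add: powr_mult)
  also have "\<dots> \<le> (1 + \<theta> / 3) powr 2 * a powr p"
    using assms by (intro mult_right_mono powr_mono) auto
  also have "(1 + \<theta> / 3) powr 2 = (1 + \<theta> / 3)\<^sup>2" using assms by (simp add: powr_numeral)
  also have "\<dots> \<le> 1 + \<theta>"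
  proof -
    have "\<theta> * \<theta> \<le> \<theta> * 3" using assms by (intro mult_left_mono) auto
    then show ?thesis by (simp add: power2_eq_square field_simps)
  qed
  finally have "(1 + a) powr p \<le> (1 + \<theta>) * a powr p"
    by (simp add: mult_right_mono)
  then show ?thesis using powr_ge_zero[of "1 + 3 / \<theta>" p] by linarith
next
  case False
  then have "(1 + a) powr p \<le> (1 + 3 / \<theta>) powr p"
    using assms by (intro powr_mono2) auto
  moreover have "0 \<le> (1 + \<theta>) * a powr p" using assms by simp
  ultimately show ?thesis by linarith
qed

section \<open>Perpetuities and the half-lines on which they depend\<close>

primrec perp_approx :: "int \<Rightarrow> (int \<Rightarrow> real) \<Rightarrow> nat \<Rightarrow> int \<Rightarrow> real" where
  "perp_approx d \<rho> 0 x = 0"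
| "perp_approx d \<rho> (Suc n) x = \<rho> x * (1 + perp_approx d \<rho> n (x - d))"

text \<open>
  The perpetuity \<open>\<rho>\<^sub>x + \<rho>\<^sub>x \<rho>\<^bsub>x-d\<^esub> + \<rho>\<^sub>x \<rho>\<^bsub>x-d\<^esub> \<rho>\<^bsub>x-2d\<^esub> + \<dots>\<close>.
\<close>

definition perp :: "int \<Rightarrow> (int \<Rightarrow> real) \<Rightarrow> int \<Rightarrow> real" where
  "perp d \<rho> x = lim (\<lambda>n. perp_approx d \<rho> n x)"

text \<open>The half-line read by the perpetuity at x: for d = 1 the sites up to x, for d = -1 those
  from x on. Disjoint half-lines are what later yields independence.\<close>

definition behind :: "int \<Rightarrow> int \<Rightarrow> int set" where
  "behind d x = {y. 0 \<le> d * (x - y)}"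

lemma behind_diff:
  assumes "y \<in> behind d x" shows "y - d \<in> behind d x"
proof -
  have "d * (x - (y - d)) = d * (x - y) + d * d" by (simp add: algebra_simps)
  with assms show ?thesis by (simp add: behind_def)
qed

lemma self_behind: "x \<in> behind d x"
  by (simp add: behind_def)

text \<open>\<open>restrict\<close> puts an arbitrary value outside the half-line, and the recursion
  never looks there. This exhibits the perpetuity as a function on the product space over
  \<open>behind d x\<close>, the form in which independence is applied.\<close>

lemma perp_approx_restrict:
  "y \<in> behind d x \<Longrightarrow> perp_approx d (restrict \<rho> (behind d x)) n y = perp_approx d \<rho> n y"
  by (induction n arbitrary: y) (auto simp: behind_diff)

lemma perp_restrict: "y \<in> behind d x \<Longrightarrow> perp d (restrict \<rho> (behind d x)) y = perp d \<rho> y"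
  by (simp add: perp_def perp_approx_restrict)

lemma measurable_perp_approx:
  "y \<in> behind d x \<Longrightarrow> (\<lambda>\<rho>. perp_approx d \<rho> n y) \<in> borel_measurable (PiM (behind d x) (\<lambda>_. borel))"
proof (induction n arbitrary: y)
  case (Suc n)
  note [measurable] = Suc.IH[OF behind_diff[OF Suc.prems]]
  have [measurable]: "(\<lambda>\<rho>. \<rho> y) \<in> borel_measurable (PiM (behind d x) (\<lambda>_. borel))"
    using Suc.prems by (rule measurable_component_singleton)
  show ?case by simp
qed simp

lemma measurable_perp:
  "y \<in> behind d x \<Longrightarrow> (\<lambda>\<rho>. perp d \<rho> y) \<in> borel_measurable (PiM (behind d x) (\<lambda>_. borel))"
  unfolding perp_def using measurable_perp_approx[of y d x]
  by (intro borel_measurable_lim_metric)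

lemma perp_approx_nonneg: "(\<And>x. 0 \<le> \<rho> x) \<Longrightarrow> 0 \<le> perp_approx d \<rho> n x"
  by (induction n arbitrary: x) auto

lemma perp_approx_mono: 
  assumes "\<And>x. 0 \<le> \<rho> x" shows "perp_approx d \<rho> n x \<le> perp_approx d \<rho> (Suc n) x"
proof (induction n arbitrary: x)
  case 0
  then show ?case using assms by simp
next
  case (Suc n)
  have "\<rho> x * (1 + perp_approx d \<rho> n (x - d)) \<le> \<rho> x * (1 + perp_approx d \<rho> (Suc n) (x - d))"
    by (intro mult_left_mono add_left_mono Suc.IH assms)
  then show ?case by simp
qed

text \<open>The bounds on R hold at every point and not just almost surely, which saves null sets in
  all estimates; the instance is a clipped \<rho>.\<close>

locale bounded_iid = prob_space +
  fixes R :: "int \<Rightarrow> 'a \<Rightarrow> real" and B r :: real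
  assumes indep: "indep_vars (\<lambda>_. borel) R UNIV"
    and ident: "distr M borel (R x) = distr M borel (R 0)"
    and R_nonneg: "0 \<le> R x w" and R_le: "R x w \<le> B"
    and mean: "expectation (R 0) = r" and r_less: "r < 1"
begin

lemma R_measurable [measurable]: "R x \<in> borel_measurable M"
  using indep by (auto simp: indep_vars_def)

lemma B_nonneg: "0 \<le> B"
  using R_nonneg R_le order_trans by blast

lemma nn_integral_R_eq:
  assumes [measurable]: "f \<in> borel_measurable borel"
  shows "(\<integral>\<^sup>+w. f (R x w) \<partial>M) = (\<integral>\<^sup>+w. f (R 0 w) \<partial>M)"
proof -
  have "(\<integral>\<^sup>+w. f (R x w) \<partial>M) = (\<integral>\<^sup>+y. f y \<partial>distr M borel (R x))"
    by (subst nn_integral_distr) auto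
  also have "\<dots> = (\<integral>\<^sup>+w. f (R 0 w) \<partial>M)"
    unfolding ident[of x] by (subst nn_integral_distr) auto
  finally show ?thesis .
qed

lemma R_integrable: "integrable M (R x)"
  using R_nonneg R_le by (intro integrable_const_bound[of _ B]) auto

lemma expectation_R: "expectation (R x) = r"
proof -
  have "expectation (R x) = (\<integral>y. y \<partial>distr M borel (R x))"
    by (subst integral_distr) auto
  also have "\<dots> = expectation (R 0)"
    unfolding ident[of x] by (subst integral_distr) auto
  finally show ?thesis using mean by simp
qed

lemma r_nonneg: "0 \<le> r"
  unfolding mean[symmetric] by (intro Bochner_Integration.integral_nonneg R_nonneg)

lemma restrict_measurable [measurable]:
  "(\<lambda>w. restrict (\<lambda>x. R x w) I) \<in> measurable M (PiM I (\<lambda>_. borel))"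
  by (intro measurable_restrict) auto

lemma indep_restrict:
  assumes "I \<inter> J = {}" "f \<in> measurable (PiM I (\<lambda>_. borel)) N1" "g \<in> measurable (PiM J (\<lambda>_. borel)) N2"
  shows "indep_var N1 (\<lambda>w. f (restrict (\<lambda>x. R x w) I)) N2 (\<lambda>w. g (restrict (\<lambda>x. R x w) J))"
  using indep_var_compose[OF indep_var_restrict[OF indep assms(1)] assms(2,3)]
  by (simp add: comp_def)

text \<open>Dominated convergence as p decreases to 1: E R^p tends to E R = r < 1, so some p
  slightly above 1 keeps the moment below 1.\<close>

lemma exists_moment: "\<exists>p. 1 < p \<and> p \<le> 2 \<and> expectation (\<lambda>w. R 0 w powr p) < 1"
proof -
  let ?p = "\<lambda>n. 1 + 1 / real (Suc n)"
  have "(\<lambda>n. expectation (\<lambda>w. R 0 w powr ?p n)) \<longlonglongrightarrow> expectation (R 0)"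
  proof (rule integral_dominated_convergence)
    show "AE w in M. (\<lambda>n. R 0 w powr ?p n) \<longlonglongrightarrow> R 0 w"
    proof (rule AE_I2)
      fix w
      have "?p \<longlonglongrightarrow> 1 + 0"
        by (intro tendsto_intros LIMSEQ_Suc[OF lim_1_over_n])
      then have "(\<lambda>n. R 0 w powr ?p n) \<longlonglongrightarrow> R 0 w powr (1 + 0)"
        using R_nonneg by (intro tendsto_powr') auto
      then show "(\<lambda>n. R 0 w powr ?p n) \<longlonglongrightarrow> R 0 w" using R_nonneg by simp
    qed
    show "AE w in M. norm (R 0 w powr ?p n) \<le> (1 + B) powr 2" for n
    proof (rule AE_I2)
      fix w
      have "R 0 w powr ?p n \<le> (1 + B) powr ?p n"
        using R_nonneg[of 0 w] R_le[of 0 w] by (intro powr_mono2) auto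
      also have "\<dots> \<le> (1 + B) powr 2" using B_nonneg by (intro powr_mono) auto
      finally show "norm (R 0 w powr ?p n) \<le> (1 + B) powr 2" by simp
    qed
  qed auto
  then have "\<forall>\<^sub>F n in sequentially. expectation (\<lambda>w. R 0 w powr ?p n) < 1"
    using mean r_less by (intro order_tendstoD) auto
  then obtain n where "expectation (\<lambda>w. R 0 w powr ?p n) < 1"
    by (auto simp: eventually_sequentially)
  then show ?thesis by (intro exI[of _ "?p n"]) (auto simp: field_simps)
qed

definition V :: "int \<Rightarrow> int \<Rightarrow> 'a \<Rightarrow> real" where
  "V d x w = perp d (\<lambda>x. R x w) x"

lemma V_restrict: "V d x w = perp d (restrict (\<lambda>x. R x w) (behind d x)) x"
  by (simp add: V_def perp_restrict self_behind)

lemma V_measurable [measurable]: "V d x \<in> borel_measurable M"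
  unfolding V_restrict[abs_def] using measurable_compose[OF restrict_measurable measurable_perp[OF self_behind]] .

abbreviation approx :: "int \<Rightarrow> nat \<Rightarrow> int \<Rightarrow> 'a \<Rightarrow> real" where
  "approx d n x w \<equiv> perp_approx d (\<lambda>x. R x w) n x"

lemma approx_measurable [measurable]: "approx d n x \<in> borel_measurable M"
proof -
  have "approx d n x = (\<lambda>w. perp_approx d (restrict (\<lambda>x. R x w) (behind d x)) n x)"
    by (simp add: perp_approx_restrict self_behind)
  then show ?thesis
    using measurable_compose[OF restrict_measurable measurable_perp_approx[OF self_behind]] by simp
qed

lemma approx_nonneg: "0 \<le> approx d n x w"
  using R_nonneg by (rule perp_approx_nonneg)

text \<open>R at x is independent of the approximation at x - d, so with q = E R^p and
  \<open>one_plus_powr_le\<close> the moments obey m_(n+1) <= (1 + \<theta>) q m_n + K. The factor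
  is below 1, hence one bound serves all n, x and d.\<close>

lemma approx_moment:
  assumes p: "1 < p" "p \<le> 2" "expectation (\<lambda>w. R 0 w powr p) < 1"
  shows "\<exists>C\<ge>0. \<forall>d n x. d \<noteq> 0 \<longrightarrow> (\<integral>\<^sup>+w. ennreal ((1 + approx d n x w) powr p) \<partial>M) \<le> ennreal C"
proof -
  define q where "q = expectation (\<lambda>w. R 0 w powr p)"
  have q: "0 \<le> q" "q < 1" using p(3) by (auto simp: q_def)
  \<comment> \<open>With this choice (1 + \<theta>) q <= q + (1 - q) / 2 < 1.\<close>
  define \<theta> where "\<theta> = (1 - q) / 2"
  have \<theta>: "0 < \<theta>" "\<theta> \<le> 3" using q by (auto simp: \<theta>_def)
  have "q * \<theta> \<le> \<theta>" using q \<theta> by (simp add: mult_left_le_one_le)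
  moreover have "\<theta> < 1 - q" using q by (simp add: \<theta>_def)
  ultimately have tq: "(1 + \<theta>) * q < 1" by (simp add: algebra_simps)
  define K where "K = (1 + 3 / \<theta>) powr p"
  \<comment> \<open>The 1 covers n = 0, where the integral is 1; the quotient is the fixed point of
    the affine recursion.\<close>
  define C where "C = max 1 (K / (1 - (1 + \<theta>) * q))"
  have C: "1 \<le> C" "K / (1 - (1 + \<theta>) * q) \<le> C" by (auto simp: C_def)
  have CK: "(1 + \<theta>) * (q * C) + K \<le> C" using C(2) tq by (simp add: field_simps)
  have Rq: "(\<integral>\<^sup>+w. ennreal (R x w powr p) \<partial>M) = ennreal q" for x
  proof -
    have "norm (R 0 w powr p) \<le> B powr p" for w
      using R_nonneg R_le p by (auto intro!: powr_mono2)
    then have "integrable M (\<lambda>w. R 0 w powr p)"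
      by (intro integrable_const_bound[of _ "B powr p"]) auto
    then have "(\<integral>\<^sup>+w. ennreal (R 0 w powr p) \<partial>M) = ennreal q"
      unfolding q_def by (intro nn_integral_eq_integral) auto
    then show ?thesis using nn_integral_R_eq[of "\<lambda>y. ennreal (y powr p)" x] by simp
  qed
  have "(\<integral>\<^sup>+w. ennreal ((1 + approx d n x w) powr p) \<partial>M) \<le> ennreal C" if d: "d \<noteq> 0" for d n x
  proof (induction n arbitrary: x)
    case 0
    show ?case using C by (simp add: emeasure_space_1)
  next
    case (Suc n)
    have eq: "(\<integral>\<^sup>+w. ennreal (R x w powr p) * ennreal ((1 + approx d n (x - d) w) powr p) \<partial>M)
      = (\<integral>\<^sup>+w. ennreal (R x w powr p) \<partial>M) * (\<integral>\<^sup>+w. ennreal ((1 + approx d n (x - d) w) powr p) \<partial>M)"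
    proof (rule indep_var_nn_integral)
      have disj: "{x} \<inter> behind d (x - d) = {}"
        using d by (auto simp: behind_def not_le zero_less_mult_iff linorder_neq_iff)
      note [measurable] = measurable_perp_approx[OF self_behind[of "x - d" d]]
      have "indep_var borel (\<lambda>w. ennreal ((restrict (\<lambda>x. R x w) {x}) x powr p))
         borel (\<lambda>w. ennreal ((1 + perp_approx d (restrict (\<lambda>x. R x w) (behind d (x - d))) n (x - d)) powr p))"
        by (rule indep_restrict[OF disj, where f="\<lambda>\<rho>. ennreal (\<rho> x powr p)"]) measurable
      then show "indep_var borel (\<lambda>w. ennreal (R x w powr p))
         borel (\<lambda>w. ennreal ((1 + approx d n (x - d) w) powr p))"
        by (simp add: perp_approx_restrict self_behind)
    qed
    have "(\<integral>\<^sup>+w. ennreal ((1 + approx d (Suc n) x w) powr p) \<partial>M)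
        \<le> (\<integral>\<^sup>+w. ennreal (1 + \<theta>) * (ennreal (R x w powr p) * ennreal ((1 + approx d n (x - d) w) powr p)) + ennreal K \<partial>M)"
    proof (rule nn_integral_mono)
      fix w
      have a: "0 \<le> approx d n (x - d) w" by (rule approx_nonneg)
      have "(1 + approx d (Suc n) x w) powr p \<le> (1 + \<theta>) * (R x w * (1 + approx d n (x - d) w)) powr p + K"
        unfolding K_def perp_approx.simps using R_nonneg a p \<theta> by (intro one_plus_powr_le) auto
      also have "\<dots> = (1 + \<theta>) * (R x w powr p * (1 + approx d n (x - d) w) powr p) + K"
        using R_nonneg a by (simp add: powr_mult)
      finally show "ennreal ((1 + approx d (Suc n) x w) powr p)
         \<le> ennreal (1 + \<theta>) * (ennreal (R x w powr p) * ennreal ((1 + approx d n (x - d) w) powr p)) + ennreal K"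
        using \<theta> by (simp add: K_def flip: ennreal_mult ennreal_plus)
    qed
    also have "\<dots> = ennreal (1 + \<theta>) * (ennreal q * (\<integral>\<^sup>+w. ennreal ((1 + approx d n (x - d) w) powr p) \<partial>M)) + ennreal K"
      by (simp add: nn_integral_add nn_integral_cmult eq Rq emeasure_space_1)
    also have "\<dots> \<le> ennreal (1 + \<theta>) * (ennreal q * ennreal C) + ennreal K"
      by (intro add_mono mult_left_mono Suc.IH) auto
    also have "\<dots> = ennreal ((1 + \<theta>) * (q * C) + K)"
      using \<theta> q C by (simp add: K_def ennreal_mult)
    also have "\<dots> \<le> ennreal C" using CK by (rule ennreal_leI)
    finally show ?case .
  qed
  then show ?thesis using C(1) by (intro exI[of _ C]) auto
qed

text \<open>The uniform bound does double duty. By monotone convergence it bounds the mean of the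
  supremum of the p-th powers; the finiteness of that supremum then bounds the increasing
  approximations almost surely, so that the \<open>lim\<close> in \<open>perp\<close> is a genuine
  limit.\<close>

lemma V_moment:
  assumes p: "1 < p" "p \<le> 2" "expectation (\<lambda>w. R 0 w powr p) < 1"
  shows "\<exists>C\<ge>0. \<forall>d x. d \<noteq> 0 \<longrightarrow> (\<integral>\<^sup>+w. ennreal ((1 + V d x w) powr p) \<partial>M) \<le> ennreal C \<and>
    (AE w in M. (\<lambda>n. approx d n x w) \<longlonglongrightarrow> V d x w)"
proof -
  from approx_moment[OF p] obtain C where C: "0 \<le> C"
    "\<And>d n x. d \<noteq> 0 \<Longrightarrow> (\<integral>\<^sup>+w. ennreal ((1 + approx d n x w) powr p) \<partial>M) \<le> ennreal C" by blast
  have "(\<integral>\<^sup>+w. ennreal ((1 + V d x w) powr p) \<partial>M) \<le> ennreal C \<and>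
    (AE w in M. (\<lambda>n. approx d n x w) \<longlonglongrightarrow> V d x w)" if d: "d \<noteq> 0" for d x
  proof
    let ?g = "\<lambda>n w. ennreal ((1 + approx d n x w) powr p)"
    have inc: "incseq (\<lambda>n. approx d n x w)" for w
      using R_nonneg by (intro incseq_SucI perp_approx_mono)
    have "incseq ?g"
      using p approx_nonneg
      by (intro incseq_SucI le_funI ennreal_leI powr_mono2 add_mono incseq_SucD[OF inc]) (auto simp: add_nonneg_nonneg)
    then have "(\<integral>\<^sup>+w. (SUP n. ?g n w) \<partial>M) = (SUP n. integral\<^sup>N M (?g n))"
      by (intro nn_integral_monotone_convergence_SUP) auto
    also have "\<dots> \<le> ennreal C" using C(2)[OF d] by (intro SUP_least) auto
    finally have sup: "(\<integral>\<^sup>+w. (SUP n. ?g n w) \<partial>M) \<le> ennreal C" .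
    then have "(\<integral>\<^sup>+w. (SUP n. ?g n w) \<partial>M) \<noteq> \<infinity>" by (auto simp: top_unique)
    then have "AE w in M. (SUP n. ?g n w) \<noteq> \<infinity>"
      by (intro nn_integral_PInf_AE) auto
    then show conv: "AE w in M. (\<lambda>n. approx d n x w) \<longlonglongrightarrow> V d x w"
    proof eventually_elim
      case (elim w)
      then obtain K where K: "0 \<le> K" "(SUP n. ?g n w) = ennreal K"
        by (cases "SUP n. ?g n w") auto
      have "approx d n x w \<le> K" for n
      proof -
        have "?g n w \<le> ennreal K" unfolding K(2)[symmetric] by (rule SUP_upper) simp
        then have "(1 + approx d n x w) powr p \<le> K" using K(1) by simp
        moreover have "(1 + approx d n x w) powr 1 \<le> (1 + approx d n x w) powr p"
          using approx_nonneg p by (intro powr_mono) auto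
        ultimately show ?thesis using approx_nonneg[where d=d and n=n and x=x and w=w] by simp
      qed
      then obtain L where "(\<lambda>n. approx d n x w) \<longlonglongrightarrow> L"
        using incseq_convergent[OF inc, of w K] by blast
      then show ?case by (simp add: V_def perp_def limI)
    qed
    have "(\<integral>\<^sup>+w. ennreal ((1 + V d x w) powr p) \<partial>M) \<le> (\<integral>\<^sup>+w. (SUP n. ?g n w) \<partial>M)"
    proof (rule nn_integral_mono_AE, use conv in eventually_elim)
      case (elim w)
      have "0 \<le> V d x w" by (rule LIMSEQ_le_const[OF elim]) (auto intro: approx_nonneg)
      then have "(\<lambda>n. ?g n w) \<longlonglongrightarrow> ennreal ((1 + V d x w) powr p)"
        using elim by (intro tendsto_ennrealI tendsto_powr tendsto_intros) auto
      then show ?case by (rule LIMSEQ_le_const2) (intro exI allI impI SUP_upper UNIV_I)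
    qed
    then show "(\<integral>\<^sup>+w. ennreal ((1 + V d x w) powr p) \<partial>M) \<le> ennreal C"
      using sup by (rule order_trans)
  qed
  then show ?thesis using C(1) by blast
qed

end

section \<open>Two-sided sums and limits along sparse subsequences\<close>

lemma sum_int_le:
  fixes f :: "int \<Rightarrow> real"
  assumes "\<And>x. 0 \<le> f x"
  shows "(\<Sum>x\<in>{- int n..int n}. f x) \<le> (\<Sum>j\<le>n. f (int j) + f (- int j))"
proof (induction n)
  case (Suc n)
  have "{- int (Suc n)..int (Suc n)} = insert (int (Suc n)) (insert (- int (Suc n)) {- int n..int n})"
    by auto
  then show ?case using Suc by (simp add: algebra_simps)
qed (use assms[of 0] in simp)

lemma powr_div_powr_tendsto_0:
  fixes e m K :: real
  assumes "e < m"
  shows "(\<lambda>n. K * (2 + real n) powr e / real n powr m) \<longlonglongrightarrow> 0"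
proof -
  have "(\<lambda>n. 1 + 2 * (1 / real n)) \<longlonglongrightarrow> 1 + 2 * 0"
    by (intro tendsto_intros lim_1_over_n)
  then have "(\<lambda>n. (1 + 2 * (1 / real n)) powr e) \<longlonglongrightarrow> 1 powr e"
    by (intro tendsto_powr) auto
  moreover have "(\<lambda>n. real n powr (e - m)) \<longlonglongrightarrow> 0"
    using assms by (intro tendsto_neg_powr filterlim_real_sequentially) auto
  ultimately have "(\<lambda>n. K * ((1 + 2 * (1 / real n)) powr e * real n powr (e - m))) \<longlonglongrightarrow> K * (1 powr e * 0)"
    by (intro tendsto_mult tendsto_const)
  moreover have "\<forall>\<^sub>F n in sequentially. K * ((1 + 2 * (1 / real n)) powr e * real n powr (e - m))
     = K * (2 + real n) powr e / real n powr m"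
    using eventually_gt_at_top[of "0::nat"]
  proof eventually_elim
    case (elim n)
    have "(1 + 2 * (1 / real n)) powr e * real n powr e = ((1 + 2 * (1 / real n)) * real n) powr e"
      using elim by (simp add: powr_mult)
    also have "(1 + 2 * (1 / real n)) * real n = 2 + real n"
      using elim by (simp add: field_simps)
    finally show ?case using elim by (simp add: powr_diff)
  qed
  ultimately have "(\<lambda>n. K * (2 + real n) powr e / real n powr m) \<longlonglongrightarrow> K * (1 powr e * 0)"
    by (rule Lim_transform_eventually)
  then show ?thesis by simp
qed

text \<open>Between consecutive points j^m and (j + 1)^m a monotone f is squeezed by its values
  there, and the ratio ((j + 1) / j)^m tends to 1. Averages along a polynomially sparse subsequence
  therefore determine the full limit.\<close>

lemma tendsto_div_of_subseq_power:
  fixes f :: "nat \<Rightarrow> real"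
  assumes mono: "incseq f" and nn: "\<And>n. 0 \<le> f n" and m: "0 < m"
    and lim: "(\<lambda>j. f (Suc j ^ m) / real (Suc j ^ m)) \<longlonglongrightarrow> L"
  shows "(\<lambda>n. f n / real n) \<longlonglongrightarrow> L"
proof -
  define g where "g j = f (j ^ m) / real (j ^ m)" for j
  have g: "g \<longlonglongrightarrow> L" by (rule LIMSEQ_imp_Suc) (use lim in \<open>simp add: g_def\<close>)
  define k where "k n = nat \<lfloor>root m (real n)\<rfloor>" for n
  have k_le: "k n ^ m \<le> n" for n
  proof -
    have "0 \<le> root m (real n)" using m by simp
    then have "real (k n) \<le> root m (real n)" unfolding k_def by linarith
    then have "real (k n) ^ m \<le> root m (real n) ^ m" by (intro power_mono) auto
    also have "\<dots> = real n" using m by simp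
    finally show ?thesis by (simp flip: of_nat_power)
  qed
  have k_gt: "n < Suc (k n) ^ m" for n
  proof -
    have "root m (real n) < real (Suc (k n))"
      unfolding k_def by linarith
    then have "root m (real n) ^ m < real (Suc (k n)) ^ m" using m by (intro power_strict_mono) auto
    then have "real n < real (Suc (k n) ^ m)" using m by (simp only: of_nat_power real_root_pow_pos2 of_nat_0_le_iff)
    then show ?thesis by (simp only: of_nat_less_iff)
  qed
  have k_lim: "filterlim k sequentially sequentially"
    unfolding filterlim_at_top
  proof
    fix J :: nat
    show "\<forall>\<^sub>F n in sequentially. J \<le> k n"
      using eventually_ge_at_top[of "J ^ m"]
    proof eventually_elim
      case (elim n)
      then have "J ^ m < Suc (k n) ^ m" using k_gt by (rule le_less_trans)
      then have "J < Suc (k n)" by (rule power_less_imp_less_base) simp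
      then show ?case by simp
    qed
  qed
  have r1: "(\<lambda>j. (1 - 1 / real (Suc j)) ^ m) \<longlonglongrightarrow> (1 - 0) ^ m"
    by (intro tendsto_intros LIMSEQ_Suc[OF lim_1_over_n])
  have r2: "(\<lambda>j. (1 + 1 / real j) ^ m) \<longlonglongrightarrow> (1 + 0) ^ m"
    by (intro tendsto_intros lim_1_over_n)
  have lo: "(\<lambda>j. g j * (1 - 1 / real (Suc j)) ^ m) \<longlonglongrightarrow> L"
    using tendsto_mult[OF g r1] by simp
  have up: "(\<lambda>j. g (Suc j) * (1 + 1 / real j) ^ m) \<longlonglongrightarrow> L"
    using tendsto_mult[OF LIMSEQ_Suc[OF g] r2] by simp
  have k_pos: "\<forall>\<^sub>F n in sequentially. 1 \<le> k n"
    using k_lim unfolding filterlim_at_top by blast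
  show ?thesis
  proof (rule tendsto_sandwich)
    show "(\<lambda>n. g (k n) * (1 - 1 / real (Suc (k n))) ^ m) \<longlonglongrightarrow> L"
      using filterlim_compose[OF lo k_lim] .
    show "(\<lambda>n. g (Suc (k n)) * (1 + 1 / real (k n)) ^ m) \<longlonglongrightarrow> L"
      using filterlim_compose[OF up k_lim] .
    show "\<forall>\<^sub>F n in sequentially. g (k n) * (1 - 1 / real (Suc (k n))) ^ m \<le> f n / real n"
      using k_pos
    proof eventually_elim
      case (elim n)
      have n: "0 < n" using elim k_le[of n] by (metis less_le_trans not_one_le_zero power_eq_0_iff not_gr0 le_zero_eq)
      have "g (k n) * (1 - 1 / real (Suc (k n))) ^ m = f (k n ^ m) / real (k n) ^ m * (real (k n) / real (Suc (k n))) ^ m"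
        by (simp add: g_def field_simps)
      also have "\<dots> = f (k n ^ m) / real (Suc (k n) ^ m)"
        using elim by (simp add: power_divide)
      also have "\<dots> \<le> f n / real n"
        using n nn k_gt[of n] incseqD[OF mono k_le[of n]]
        by (intro frac_le) (auto simp del: of_nat_power of_nat_Suc power_Suc)
      finally show ?case .
    qed
    show "\<forall>\<^sub>F n in sequentially. f n / real n \<le> g (Suc (k n)) * (1 + 1 / real (k n)) ^ m"
      using k_pos
    proof eventually_elim
      case (elim n)
      have kp: "0 < k n ^ m" using elim by simp
      have "f n / real n \<le> f (Suc (k n) ^ m) / real (k n ^ m)"
        using nn kp k_le[of n] incseqD[OF mono less_imp_le[OF k_gt[of n]]]
        by (intro frac_le) (auto simp del: of_nat_power of_nat_Suc power_Suc)
      also have "\<dots> = f (Suc (k n) ^ m) / real (Suc (k n)) ^ m * (real (Suc (k n)) / real (k n)) ^ m"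
        using elim by (simp add: power_divide)
      also have "real (Suc (k n)) / real (k n) = 1 + 1 / real (k n)"
        using elim by (simp add: field_simps)
      finally show ?case by (simp add: g_def)
    qed
  qed
qed

locale bounded_iid_moment = bounded_iid +
  fixes p C :: real
  assumes p: "1 < p" "p \<le> 2" and C_nonneg: "0 \<le> C"
    and moment: "d \<noteq> 0 \<Longrightarrow> (\<integral>\<^sup>+w. ennreal ((1 + V d x w) powr p) \<partial>M) \<le> ennreal C"
    and conv: "d \<noteq> 0 \<Longrightarrow> AE w in M. (\<lambda>n. approx d n x w) \<longlonglongrightarrow> V d x w"
begin

lemma V_AE:
  "AE w in M. \<forall>d x. d \<noteq> 0 \<longrightarrow> V d x w = R x w * (1 + V d (x - d) w) \<and> 0 \<le> V d x w"
proof -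
  have "AE w in M. \<forall>d x. d \<noteq> 0 \<longrightarrow> (\<lambda>n. approx d n x w) \<longlonglongrightarrow> V d x w"
    unfolding AE_all_countable using conv by (auto intro: AE_impI)
  then show ?thesis
  proof eventually_elim
    case (elim w)
    show ?case
    proof (intro allI impI conjI)
      fix d x :: int assume d: "d \<noteq> 0"
      have "(\<lambda>n. approx d (Suc n) x w) \<longlonglongrightarrow> V d x w"
        using elim d by (intro LIMSEQ_Suc) auto
      moreover have "(\<lambda>n. approx d (Suc n) x w) \<longlonglongrightarrow> R x w * (1 + V d (x - d) w)"
        unfolding perp_approx.simps using elim d by (intro tendsto_intros) auto
      ultimately show "V d x w = R x w * (1 + V d (x - d) w)" by (rule LIMSEQ_unique)
      show "0 \<le> V d x w"
        by (rule LIMSEQ_le_const[OF elim[rule_format, OF d]]) (auto intro: approx_nonneg)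
    qed
  qed
qed

lemma V_nonneg_AE: "AE w in M. \<forall>d x. d \<noteq> 0 \<longrightarrow> 0 \<le> V d x w"
  using V_AE by eventually_elim blast

text \<open>A single term is at most the sum of the p-th powers, which is O(n^((1 + p) / 2)); the
  p-th root has exponent (1 + p) / (2 p) < 1. So V is sublinear, which disposes of boundary terms
  and of the truncation below.\<close>

lemma V_growth: "AE w in M. \<exists>K\<ge>0. \<forall>x. 1 + V 1 x w \<le> K * (1 + \<bar>real_of_int x\<bar>) powr ((1 + p) / (2 * p))"
proof -
  let ?Y = "\<lambda>n w. (1 + V 1 (int n) w) powr p + (1 + V 1 (- int n) w) powr p"
  have "AE w in M. \<exists>K\<ge>0. \<forall>n. (\<Sum>j\<le>n. ?Y j w) \<le> K * (1 + real n) powr ((1 + p) / 2)"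
  proof (rule AE_sum_le_powr)
    fix j
    have "(\<integral>\<^sup>+w. ennreal (?Y j w) \<partial>M) = (\<integral>\<^sup>+w. ennreal ((1 + V 1 (int j) w) powr p) \<partial>M)
        + (\<integral>\<^sup>+w. ennreal ((1 + V 1 (- int j) w) powr p) \<partial>M)"
      by (simp add: nn_integral_add)
    also have "\<dots> \<le> ennreal C + ennreal C" by (intro add_mono moment) auto
    also have "\<dots> = ennreal (C + C)" using C_nonneg by (simp flip: ennreal_plus)
    finally show "(\<integral>\<^sup>+w. ennreal (?Y j w) \<partial>M) \<le> ennreal (C + C)" .
  qed (use p C_nonneg in auto)
  with V_nonneg_AE show ?thesis
  proof eventually_elim
    case (elim w)
    from elim(2) obtain K where K: "0 \<le> K" "\<And>n. (\<Sum>j\<le>n. ?Y j w) \<le> K * (1 + real n) powr ((1 + p) / 2)"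
      by blast
    have V0: "0 \<le> V 1 x w" for x using elim(1) by simp
    show ?case
    proof (intro exI[of _ "K powr (1 / p)"] conjI allI)
      fix x :: int
      define n where "n = nat \<bar>x\<bar>"
      have n: "1 + real n = 1 + \<bar>real_of_int x\<bar>" by (simp add: n_def)
      have "(1 + V 1 x w) powr p \<le> ?Y n w"
        by (cases "0 \<le> x") (auto simp: n_def)
      also have "\<dots> \<le> (\<Sum>j\<le>n. ?Y j w)"
        by (rule member_le_sum) auto
      also note K(2)[of n]
      finally have "((1 + V 1 x w) powr p) powr (1 / p) \<le> (K * (1 + real n) powr ((1 + p) / 2)) powr (1 / p)"
        using p by (intro powr_mono2) auto
      then show "1 + V 1 x w \<le> K powr (1 / p) * (1 + \<bar>real_of_int x\<bar>) powr ((1 + p) / (2 * p))"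
        using p V0[of x] by (simp add: powr_powr powr_mult n)
    qed simp
  qed
qed

text \<open>V at x - 1 and U at x + 1 read disjoint half-lines, so y = ((1 + V) (1 + U))^p has mean
  at most C^2. The summand is at most y^(2 / p), and the sum of these is at most (sum y)^(2 / p), of
  order (n^((1 + p) / 2))^(2 / p) = n^((1 + p) / p). As p > 1 the exponent is below 2.\<close>

lemma weighted_sum_small:
  "AE w in M. (\<lambda>n. (\<Sum>x\<in>{- int n..int n}. (1 + V 1 (x - 1) w)\<^sup>2 * (1 + V (- 1) (x + 1) w)) / (real n)\<^sup>2) \<longlonglongrightarrow> 0"
proof -
  let ?y = "\<lambda>x w. (1 + V 1 (x - 1) w) powr p * (1 + V (- 1) (x + 1) w) powr p"
  let ?Y = "\<lambda>n w. ?y (int n) w + ?y (- int n) w"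
  have y: "(\<integral>\<^sup>+w. ennreal (?y x w) \<partial>M) \<le> ennreal (C * C)" for x
  proof -
    have "indep_var borel (\<lambda>w. ennreal ((1 + perp 1 (restrict (\<lambda>x. R x w) (behind 1 (x - 1))) (x - 1)) powr p))
       borel (\<lambda>w. ennreal ((1 + perp (- 1) (restrict (\<lambda>x. R x w) (behind (- 1) (x + 1))) (x + 1)) powr p))"
    proof (rule indep_restrict)
      note [measurable] = measurable_perp[OF self_behind]
      show "(\<lambda>\<rho>. ennreal ((1 + perp 1 \<rho> (x - 1)) powr p)) \<in> borel_measurable (Pi\<^sub>M (behind 1 (x - 1)) (\<lambda>_. borel))"
        "(\<lambda>\<rho>. ennreal ((1 + perp (- 1) \<rho> (x + 1)) powr p)) \<in> borel_measurable (Pi\<^sub>M (behind (- 1) (x + 1)) (\<lambda>_. borel))"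
        by measurable
    qed (auto simp: behind_def)
    then have "indep_var borel (\<lambda>w. ennreal ((1 + V 1 (x - 1) w) powr p))
       borel (\<lambda>w. ennreal ((1 + V (- 1) (x + 1) w) powr p))"
      by (simp add: V_restrict)
    from indep_var_nn_integral[OF this]
    have "(\<integral>\<^sup>+w. ennreal (?y x w) \<partial>M) = (\<integral>\<^sup>+w. ennreal ((1 + V 1 (x - 1) w) powr p) \<partial>M)
        * (\<integral>\<^sup>+w. ennreal ((1 + V (- 1) (x + 1) w) powr p) \<partial>M)"
      by (simp add: ennreal_mult)
    also have "\<dots> \<le> ennreal C * ennreal C" by (intro mult_mono moment) auto
    finally show ?thesis using C_nonneg by (simp add: ennreal_mult)
  qed
  have "AE w in M. \<exists>K\<ge>0. \<forall>n. (\<Sum>j\<le>n. ?Y j w) \<le> K * (1 + real n) powr ((1 + p) / 2)"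
  proof (rule AE_sum_le_powr)
    fix j
    have "(\<integral>\<^sup>+w. ennreal (?Y j w) \<partial>M) = (\<integral>\<^sup>+w. ennreal (?y (int j) w) \<partial>M) + (\<integral>\<^sup>+w. ennreal (?y (- int j) w) \<partial>M)"
      by (simp add: nn_integral_add)
    also have "\<dots> \<le> ennreal (C * C) + ennreal (C * C)" by (intro add_mono y)
    also have "\<dots> = ennreal (C * C + C * C)" using C_nonneg by (simp flip: ennreal_plus)
    finally show "(\<integral>\<^sup>+w. ennreal (?Y j w) \<partial>M) \<le> ennreal (C * C + C * C)" .
  qed (use p C_nonneg in auto)
  with V_nonneg_AE show ?thesis
  proof eventually_elim
    case (elim w)
    from elim(2) obtain K where K: "0 \<le> K" "\<And>n. (\<Sum>j\<le>n. ?Y j w) \<le> K * (1 + real n) powr ((1 + p) / 2)"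
      by blast
    have V0: "0 \<le> V 1 x w" "0 \<le> V (- 1) x w" for x using elim(1) by simp_all
    let ?a = "\<lambda>x. (1 + V 1 (x - 1) w)\<^sup>2 * (1 + V (- 1) (x + 1) w)"
    have a: "?a x \<le> ?y x w powr (2 / p)" for x
    proof -
      have "?y x w powr (2 / p) = (1 + V 1 (x - 1) w)\<^sup>2 * (1 + V (- 1) (x + 1) w)\<^sup>2"
        using p V0[of "x - 1"] V0[of "x + 1"] by (simp add: powr_mult powr_powr powr_numeral)
      moreover have "1 + V (- 1) (x + 1) w \<le> (1 + V (- 1) (x + 1) w)\<^sup>2"
        using V0[of "x + 1"] by (intro self_le_power) auto
      ultimately show ?thesis by (simp add: mult_left_mono)
    qed
    have le: "(\<Sum>x\<in>{- int n..int n}. ?a x) / (real n)\<^sup>2 \<le> K powr (2 / p) * (2 + real n) powr ((1 + p) / p) / real n powr 2" for n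
    proof (cases "n = 0")
      case False
      have "(\<Sum>x\<in>{- int n..int n}. ?a x) \<le> (\<Sum>x\<in>{- int n..int n}. ?y x w powr (2 / p))"
        by (intro sum_mono a)
      also have "\<dots> \<le> (\<Sum>x\<in>{- int n..int n}. ?y x w) powr (2 / p)"
        using p by (intro sum_powr_le) auto
      also have "\<dots> \<le> (K * (1 + real n) powr ((1 + p) / 2)) powr (2 / p)"
        using p order_trans[OF sum_int_le K(2)[of n]] by (intro powr_mono2 sum_nonneg) auto
      also have "\<dots> = K powr (2 / p) * (1 + real n) powr ((1 + p) / 2 * (2 / p))"
        using K(1) by (simp add: powr_powr powr_mult)
      also have "\<dots> = K powr (2 / p) * (1 + real n) powr ((1 + p) / p)"
        using p by (intro arg_cong2[where f=times] arg_cong2[where f="(powr)"]) (auto simp: field_simps)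
      also have "\<dots> \<le> K powr (2 / p) * (2 + real n) powr ((1 + p) / p)"
        using p by (intro mult_left_mono powr_mono2) auto
      finally show ?thesis using False by (simp add: powr_numeral divide_right_mono)
    qed simp
    show ?case
    proof (rule tendsto_sandwich[OF _ _ tendsto_const powr_div_powr_tendsto_0])
      show "(1 + p) / p < 2" using p by (simp add: field_simps)
      show "\<forall>\<^sub>F n in sequentially. 0 \<le> (\<Sum>x\<in>{- int n..int n}. ?a x) / (real n)\<^sup>2"
        using V0 by (intro always_eventually allI divide_nonneg_nonneg sum_nonneg mult_nonneg_nonneg) auto
      show "\<forall>\<^sub>F n in sequentially. (\<Sum>x\<in>{- int n..int n}. ?a x) / (real n)\<^sup>2
         \<le> K powr (2 / p) * (2 + real n) powr ((1 + p) / p) / real n powr 2"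
        using le by (intro always_eventually allI)
    qed
  qed
qed

end

section \<open>Law of large numbers for the perpetuity\<close>

context bounded_iid_moment begin

text \<open>Truncation supplies the second moment that 1 + V may lack. The \<open>max 0\<close>
  makes the bounds hold everywhere, since V is known to be nonnegative only almost surely.\<close>

definition truncated :: "real \<Rightarrow> int \<Rightarrow> 'a \<Rightarrow> real" where
  "truncated L x w = min (max 0 (1 + V 1 x w)) L"

text \<open>The martingale part of the sum of V in \<open>sum_V_shift\<close>, with 1 + V capped at
  L.\<close>

definition D :: "int \<Rightarrow> nat \<Rightarrow> real \<Rightarrow> 'a \<Rightarrow> real" where
  "D a n L w = (\<Sum>x\<in>{a..<a + int n}. (R x w - r) * truncated L (x - 1) w)"

lemma D_measurable [measurable]: "D a n L \<in> borel_measurable M"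
  unfolding D_def[abs_def] truncated_def[abs_def] by measurable

lemma truncated_measurable [measurable]: "truncated L x \<in> borel_measurable M"
  unfolding truncated_def[abs_def] by measurable

lemma truncated_bounds: "0 \<le> L \<Longrightarrow> 0 \<le> truncated L x w" "truncated L x w \<le> L"
  by (auto simp: truncated_def)

lemma abs_R_diff_le: "\<bar>R x w - r\<bar> \<le> 1 + B"
  using R_nonneg[of x w] R_le[of x w] r_nonneg r_less by linarith

lemma D_Suc: "D a (Suc n) L w = D a n L w + (R (a + int n) w - r) * truncated L (a + int n - 1) w"
proof -
  have "{a..<a + int (Suc n)} = insert (a + int n) {a..<a + int n}" by auto
  then show ?thesis by (simp add: D_def)
qed

lemma abs_D_le: "0 \<le> L \<Longrightarrow> \<bar>D a n L w\<bar> \<le> real n * ((1 + B) * L)"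
proof (induction n)
  case (Suc n)
  have "\<bar>(R (a + int n) w - r) * truncated L (a + int n - 1) w\<bar> \<le> (1 + B) * L"
    unfolding abs_mult using Suc.prems abs_R_diff_le truncated_bounds B_nonneg
    by (intro mult_mono) auto
  then show ?case using Suc unfolding D_Suc by (simp add: distrib_right)
qed (simp add: D_def)

text \<open>Interpolation between the cap and the p-th moment: T^2 = T^(2 - p) T^p, where the first
  factor is at most L^(2 - p) and the second at most (1 + V)^p.\<close>

lemma truncated_square_le:
  assumes L: "0 \<le> L" shows "expectation (\<lambda>w. (truncated L x w)\<^sup>2) \<le> L powr (2 - p) * C"
proof -
  have "(truncated L x w)\<^sup>2 \<le> L powr (2 - p) * (1 + V 1 x w) powr p" for w
  proof (cases "0 < truncated L x w")
    case True
    then have V: "0 < 1 + V 1 x w" "truncated L x w \<le> 1 + V 1 x w" by (auto simp: truncated_def)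
    have "(truncated L x w)\<^sup>2 = truncated L x w powr (2 - p) * truncated L x w powr p"
      using True by (simp add: powr_numeral flip: powr_add)
    also have "\<dots> \<le> L powr (2 - p) * (1 + V 1 x w) powr p"
      using p L V True truncated_bounds(2)[of L x w] by (intro mult_mono powr_mono2) auto
    finally show ?thesis .
  next
    case False
    then have "truncated L x w = 0" using truncated_bounds(1)[OF L, of x w] by simp
    then show ?thesis by simp
  qed
  then have "(\<integral>\<^sup>+w. ennreal ((truncated L x w)\<^sup>2) \<partial>M) \<le> (\<integral>\<^sup>+w. ennreal (L powr (2 - p)) * ennreal ((1 + V 1 x w) powr p) \<partial>M)"
    by (intro nn_integral_mono) (simp flip: ennreal_mult)
  also have "\<dots> = ennreal (L powr (2 - p)) * (\<integral>\<^sup>+w. ennreal ((1 + V 1 x w) powr p) \<partial>M)"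
    by (rule nn_integral_cmult) simp
  also have "\<dots> \<le> ennreal (L powr (2 - p)) * ennreal C"
    by (intro mult_left_mono moment) auto
  finally have "(\<integral>\<^sup>+w. ennreal ((truncated L x w)\<^sup>2) \<partial>M) \<le> ennreal (L powr (2 - p) * C)"
    using C_nonneg by (simp add: ennreal_mult)
  then have "enn2real (\<integral>\<^sup>+w. ennreal ((truncated L x w)\<^sup>2) \<partial>M) \<le> L powr (2 - p) * C"
    using C_nonneg by (intro enn2real_leI) auto
  then show ?thesis by (subst integral_eq_nn_integral) auto
qed

text \<open>The summands of \<open>D\<close> are orthogonal, since \<open>R x\<close> is independent of the environment behind \<open>x\<close>.\<close>

lemma D_square_le:
  assumes L: "0 \<le> L"
  shows "expectation (\<lambda>w. (D a n L w)\<^sup>2) \<le> real n * ((1 + B)\<^sup>2 * (L powr (2 - p) * C))"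
proof (induction n)
  case 0
  show ?case by (simp add: D_def)
next
  case (Suc n)
  define z where "z = a + int n"
  let ?F = "\<lambda>w. D a n L w * truncated L (z - 1) w"
  let ?b = "real n * ((1 + B) * L)"
  have bD: "\<bar>D a n L w\<bar> \<le> ?b" for w by (rule abs_D_le[OF L])
  have bT: "\<bar>truncated L x w\<bar> \<le> L" for x w using truncated_bounds[of L x w] L by simp
  have bF: "\<bar>?F w\<bar> \<le> ?b * L" for w
    unfolding abs_mult using bD bT L B_nonneg by (intro mult_mono) auto
  have iD: "integrable M (\<lambda>w. (D a n L w)\<^sup>2)"
    using bD by (intro integrable_const_bound[of _ "?b\<^sup>2"]) (auto simp: abs_le_square_iff[symmetric] intro: order_trans[OF _ abs_ge_self])
  have iF: "integrable M ?F"
    using bF by (intro integrable_const_bound[of _ "?b * L"]) auto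
  have iT: "integrable M (\<lambda>w. (truncated L x w)\<^sup>2)" for x
    using bT L by (intro integrable_const_bound[of _ "L\<^sup>2"]) (auto simp: abs_le_square_iff[symmetric])
  have ind: "indep_var borel ?F borel (\<lambda>w. R z w - r)"
  proof -
    \<comment> \<open>\<open>f\<close> expresses the factor from the past through the coordinates
      behind z - 1, which do not include z.\<close>
    define f where "f \<rho> = (\<Sum>x\<in>{a..<z}. (\<rho> x - r) * min (max 0 (1 + perp 1 \<rho> (x - 1))) L)
       * min (max 0 (1 + perp 1 \<rho> (z - 1))) L" for \<rho> :: "int \<Rightarrow> real"
    have beh: "x \<in> behind 1 (z - 1)" if "x < z" for x
      using that by (simp add: behind_def)
    note [measurable] = measurable_perp[OF beh] measurable_component_singleton[OF beh]
    have "f \<in> borel_measurable (Pi\<^sub>M (behind 1 (z - 1)) (\<lambda>_. borel))"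
      unfolding f_def[abs_def]
      by (intro borel_measurable_times borel_measurable_sum borel_measurable_min borel_measurable_max
        borel_measurable_diff borel_measurable_add borel_measurable_const) auto
    then have "indep_var borel (\<lambda>w. f (restrict (\<lambda>x. R x w) (behind 1 (z - 1)))) borel (\<lambda>w. restrict (\<lambda>x. R x w) {z} z - r)"
      by (rule indep_restrict[where g="\<lambda>\<rho>. \<rho> z - r", rotated]) (auto simp: behind_def)
    moreover have "f (restrict (\<lambda>x. R x w) (behind 1 (z - 1))) = ?F w" for w
    proof -
      have "x \<in> behind 1 (z - 1)" "x - 1 \<in> behind 1 (z - 1)" if "x < z" for x
        using that by (auto simp: behind_def)
      then show ?thesis
        unfolding f_def D_def truncated_def V_def z_def[symmetric]
        by (auto intro!: arg_cong2[where f=times] sum.cong simp: perp_restrict self_behind)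
    qed
    ultimately show ?thesis by simp
  qed
  have iR: "integrable M (\<lambda>w. R z w - r)" using R_integrable by simp
  have "expectation (\<lambda>w. ?F w * (R z w - r)) = expectation ?F * expectation (\<lambda>w. R z w - r)"
    by (rule indep_var_lebesgue_integral[OF ind iF iR])
  also have "expectation (\<lambda>w. R z w - r) = 0"
    using R_integrable expectation_R by (simp add: prob_space)
  finally have cross: "expectation (\<lambda>w. ?F w * (R z w - r)) = 0" by simp
  have ic: "integrable M (\<lambda>w. ?F w * (R z w - r))"
    by (rule indep_var_integrable[OF ind iF iR])
  have i2: "integrable M (\<lambda>w. (1 + B)\<^sup>2 * (truncated L (z - 1) w)\<^sup>2)" using iT by simp
  have "expectation (\<lambda>w. (D a (Suc n) L w)\<^sup>2)
      \<le> expectation (\<lambda>w. (D a n L w)\<^sup>2 + 2 * (?F w * (R z w - r)) + (1 + B)\<^sup>2 * (truncated L (z - 1) w)\<^sup>2)"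
  proof (rule integral_mono')
    show "integrable M (\<lambda>w. (D a n L w)\<^sup>2 + 2 * (?F w * (R z w - r)) + (1 + B)\<^sup>2 * (truncated L (z - 1) w)\<^sup>2)"
      using iD ic i2 by simp
    fix w
    have "\<bar>R z w - r\<bar>\<^sup>2 \<le> (1 + B)\<^sup>2" using abs_R_diff_le by (intro power_mono) auto
    then have "(R z w - r)\<^sup>2 * (truncated L (z - 1) w)\<^sup>2 \<le> (1 + B)\<^sup>2 * (truncated L (z - 1) w)\<^sup>2"
      by (intro mult_right_mono) auto
    then show le: "(D a (Suc n) L w)\<^sup>2 \<le> (D a n L w)\<^sup>2 + 2 * (?F w * (R z w - r)) + (1 + B)\<^sup>2 * (truncated L (z - 1) w)\<^sup>2"
    proof -
      have "(D a (Suc n) L w)\<^sup>2 = (D a n L w)\<^sup>2 + 2 * (?F w * (R z w - r)) + (R z w - r)\<^sup>2 * (truncated L (z - 1) w)\<^sup>2"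
        unfolding D_Suc z_def[symmetric] by (simp add: power2_eq_square algebra_simps)
      then show ?thesis
        using \<open>(R z w - r)\<^sup>2 * (truncated L (z - 1) w)\<^sup>2 \<le> (1 + B)\<^sup>2 * (truncated L (z - 1) w)\<^sup>2\<close> by simp
    qed
    show "0 \<le> (D a n L w)\<^sup>2 + 2 * (?F w * (R z w - r)) + (1 + B)\<^sup>2 * (truncated L (z - 1) w)\<^sup>2"
      using le zero_le_power2 order_trans by blast
  qed
  also have "\<dots> = expectation (\<lambda>w. (D a n L w)\<^sup>2) + (1 + B)\<^sup>2 * expectation (\<lambda>w. (truncated L (z - 1) w)\<^sup>2)"
    using iD ic i2 cross by simp
  also have "\<dots> \<le> real n * ((1 + B)\<^sup>2 * (L powr (2 - p) * C)) + (1 + B)\<^sup>2 * (L powr (2 - p) * C)"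
    using Suc truncated_square_le[OF L] by (intro add_mono mult_left_mono) auto
  finally show ?case by (simp add: distrib_right)
qed

text \<open>With the cap L = n the second moment of D / n is of order n n^(2 - p) / n^2 = n^(1 - p).
  Along n = j^m with m (p - 1) >= 2 this is summable. The left end may vary with j, since windows
  left of the origin start at - n.\<close>

lemma D_subseq:
  assumes m: "2 \<le> real m * (p - 1)"
  shows "AE w in M. (\<lambda>j. D (a j) (Suc j ^ m) (real (Suc j ^ m)) w / real (Suc j ^ m)) \<longlonglongrightarrow> 0"
proof -
  let ?n = "\<lambda>j. Suc j ^ m"
  let ?Y = "\<lambda>j w. (D (a j) (?n j) (real (?n j)) w / real (?n j))\<^sup>2"
  let ?e = "\<lambda>j. (1 + B)\<^sup>2 * C * (real (Suc j)) powr (- 2)"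
  have "AE w in M. summable (\<lambda>j. ?Y j w)"
  proof (rule AE_summable_of_nn_integral_le)
    fix j
    define n where "n = ?n j"
    have n: "0 < n" "0 \<le> real n" by (simp_all add: n_def)
    have "norm (?Y j w) \<le> ((1 + B) * real n)\<^sup>2" for w
    proof -
      have "\<bar>D (a j) n (real n) w / real n\<bar> \<le> (1 + B) * real n"
        using abs_D_le[OF n(2), of "a j" n w] n(1) by (simp add: pos_divide_le_eq mult_ac)
      then show ?thesis
        unfolding n_def[symmetric] real_norm_def abs_power2
        using B_nonneg by (subst power2_le_iff_abs_le) auto
    qed
    then have int: "integrable M (?Y j)"
      by (intro integrable_const_bound) auto
    have "expectation (?Y j) = expectation (\<lambda>w. (D (a j) n (real n) w)\<^sup>2) / (real n)\<^sup>2"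
      by (simp add: power_divide n_def)
    also have "\<dots> \<le> (real n * ((1 + B)\<^sup>2 * (real n powr (2 - p) * C))) / (real n)\<^sup>2"
      by (intro divide_right_mono D_square_le) auto
    also have "\<dots> = (1 + B)\<^sup>2 * C * real n powr (1 - p)"
    proof -
      have "real n powr (2 - p) = real n * real n powr (1 - p)"
        using n powr_mult_base[of "real n" "1 - p"] by simp
      then show ?thesis using n by (simp add: power2_eq_square)
    qed
    also have "real n = real (Suc j) powr real m"
      unfolding n_def of_nat_power by (subst powr_realpow) auto
    also have "(real (Suc j) powr real m) powr (1 - p) = real (Suc j) powr (- (real m * (p - 1)))"
      by (simp add: powr_powr algebra_simps)
    also have "(1 + B)\<^sup>2 * C * \<dots> \<le> ?e j"
      using m C_nonneg by (intro mult_left_mono powr_mono) auto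
    finally have "expectation (?Y j) \<le> ?e j" .
    then show "(\<integral>\<^sup>+w. ennreal (?Y j w) \<partial>M) \<le> ennreal (?e j)"
      by (subst nn_integral_eq_integral[OF int]) (auto intro: ennreal_leI)
  next
    have "summable (\<lambda>j. real (Suc j) powr (- 2))"
      by (subst summable_Suc_iff) (simp add: summable_real_powr_iff)
    then show "summable ?e" by (rule summable_mult)
  qed (use C_nonneg in auto)
  then show ?thesis
  proof eventually_elim
    case (elim w)
    then have "(\<lambda>j. ?Y j w) \<longlonglongrightarrow> 0" by (rule summable_LIMSEQ_zero)
    then show ?case by (subst (asm) power_tendsto_0_iff) auto
  qed
qed

text \<open>Sum the recursion for V over the window and split R = r + (R - r). Shifting the index in
  the term with factor r costs only two boundary values, so one can solve for the sum of V. This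
  takes the place of the ergodic theorem.\<close>

lemma sum_V_shift:
  assumes "\<And>x. V 1 x w = R x w * (1 + V 1 (x - 1) w)"
  shows "(1 - r) * (\<Sum>x\<in>{a..<a + int n}. V 1 x w) = r * n
    + (\<Sum>x\<in>{a..<a + int n}. (R x w - r) * (1 + V 1 (x - 1) w)) + r * (V 1 (a - 1) w - V 1 (a + int n - 1) w)"
proof (induction n)
  case (Suc n)
  have "{a..<a + int (Suc n)} = insert (a + int n) {a..<a + int n}" by auto
  then show ?case using Suc assms[of "a + int n"] by (simp add: algebra_simps)
qed simp

text \<open>\<open>step\<close> says that the windows grow by one site at a time, on the right or on
  the left, so that their sums increase and can be interpolated between the times j^m. The cases
  needed are a n = 0 and a n = - n, the two half-lines.\<close>

lemma sum_V_limit: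
  assumes step: "\<And>n. a (Suc n) = a n \<and> a (Suc n) + int (Suc n) \<ge> a n + int n \<or>
      a (Suc n) = a n - 1" and bnd: "\<And>n. - int n \<le> a n \<and> a n \<le> 0"
  shows "AE w in M. (\<lambda>n. (\<Sum>x\<in>{a n..<a n + int n}. V 1 x w) / real n) \<longlonglongrightarrow> r / (1 - r)"
proof -
  define m where "m = nat \<lceil>2 / (p - 1)\<rceil>"
  have "2 / (p - 1) \<le> real m" unfolding m_def by linarith
  then have m: "2 \<le> real m * (p - 1)" using p by (simp add: field_simps)
  then have m0: "0 < m" by (cases "m = 0") auto
  define \<kappa> where "\<kappa> = (1 + p) / (2 * p)"
  have \<kappa>: "0 < \<kappa>" "\<kappa> < 1" using p by (auto simp: \<kappa>_def field_simps)
  show ?thesis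
    using D_subseq[OF m, of "\<lambda>j. a (Suc j ^ m)"] V_growth V_AE
  proof eventually_elim
    case (elim w)
    have Vrec: "V 1 x w = R x w * (1 + V 1 (x - 1) w)" and V0: "0 \<le> V 1 x w" for x
      using elim(3)[rule_format, OF one_neq_zero, of x] by blast+
    from elim(2) obtain K where K: "0 \<le> K" "\<And>x. 1 + V 1 x w \<le> K * (1 + \<bar>real_of_int x\<bar>) powr \<kappa>"
      unfolding \<kappa>_def by blast
    define g where "g n = K * (2 + real n) powr \<kappa> / real n powr 1" for n
    have g: "g \<longlonglongrightarrow> 0" unfolding g_def[abs_def] using \<kappa> by (intro powr_div_powr_tendsto_0)
    \<comment> \<open>V is o(n) on all sites within distance n + 1, which includes the boundary
      sites of the shifted sum.\<close>
    have Vg: "1 + V 1 x w \<le> g n * real n" if "\<bar>x\<bar> \<le> int n + 1" "0 < n" for x n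
    proof -
      have "\<bar>real_of_int x\<bar> \<le> real n + 1" using that by linarith
      then have "K * (1 + \<bar>real_of_int x\<bar>) powr \<kappa> \<le> K * (2 + real n) powr \<kappa>"
        using K \<kappa> by (intro mult_left_mono powr_mono2) auto
      then show ?thesis using that K(2)[of x] by (simp add: g_def)
    qed
    define S where "S n = (\<Sum>x\<in>{a n..<a n + int n}. V 1 x w)" for n
    define n where "n j = Suc j ^ m" for j
    have n_lim: "filterlim n sequentially sequentially"
    proof -
      have "strict_mono n" unfolding n_def using m0 by (intro strict_monoI power_strict_mono) auto
      then show ?thesis by (rule filterlim_subseq)
    qed
    have n0: "0 < n j" for j by (simp add: n_def)
    have gn: "(\<lambda>j. g (n j)) \<longlonglongrightarrow> 0" using filterlim_compose[OF g n_lim] .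
    have Vn: "(\<lambda>j. V 1 (b j) w / real (n j)) \<longlonglongrightarrow> 0" if b: "\<And>j. \<bar>b j\<bar> \<le> int (n j) + 1" for b
    proof (rule tendsto_sandwich[OF _ _ tendsto_const gn])
      show "\<forall>\<^sub>F j in sequentially. 0 \<le> V 1 (b j) w / real (n j)" using V0 by simp
      have "V 1 (b j) w / real (n j) \<le> g (n j)" for j
        using Vg[OF b n0, of j] n0[of j] by (simp add: field_simps)
      then show "\<forall>\<^sub>F j in sequentially. V 1 (b j) w / real (n j) \<le> g (n j)" by simp
    qed
    have "(\<lambda>j. (r + D (a (n j)) (n j) (real (n j)) w / real (n j)
       + r * (V 1 (a (n j) - 1) w / real (n j) - V 1 (a (n j) + int (n j) - 1) w / real (n j))) / (1 - r))
      \<longlonglongrightarrow> (r + 0 + r * (0 - 0)) / (1 - r)"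
    proof (intro tendsto_intros Vn)
      show "(\<lambda>j. D (a (n j)) (n j) (real (n j)) w / real (n j)) \<longlonglongrightarrow> 0"
        using elim(1) by (simp add: n_def)
      show "\<bar>a (n j) - 1\<bar> \<le> int (n j) + 1" "\<bar>a (n j) + int (n j) - 1\<bar> \<le> int (n j) + 1" for j
        using bnd[of "n j"] n0[of j] by auto
    qed (use r_less in auto)
    moreover have "\<forall>\<^sub>F j in sequentially. (r + D (a (n j)) (n j) (real (n j)) w / real (n j)
       + r * (V 1 (a (n j) - 1) w / real (n j) - V 1 (a (n j) + int (n j) - 1) w / real (n j))) / (1 - r)
       = S (n j) / real (n j)"
      using order_tendstoD(2)[OF gn, of 1, OF zero_less_one]
    proof eventually_elim
      case (elim j)
      let ?n = "n j"
      \<comment> \<open>Once g is below 1, every 1 + V that occurs is at most n, so the cap at n is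
        inactive and \<open>D\<close> is the exact martingale sum.\<close>
      have "D (a ?n) ?n (real ?n) w = (\<Sum>x\<in>{a ?n..<a ?n + int ?n}. (R x w - r) * (1 + V 1 (x - 1) w))"
        unfolding D_def
      proof (rule sum.cong)
        fix x assume "x \<in> {a ?n..<a ?n + int ?n}"
        then have "\<bar>x - 1\<bar> \<le> int ?n + 1" using bnd[of ?n] by auto
        then have "1 + V 1 (x - 1) w \<le> g ?n * real ?n" using n0 by (rule Vg)
        also have "\<dots> \<le> 1 * real ?n" using elim by (intro mult_right_mono) auto
        finally show "(R x w - r) * truncated (real ?n) (x - 1) w = (R x w - r) * (1 + V 1 (x - 1) w)"
          using V0[of "x - 1"] by (simp add: truncated_def)
      qed simp
      then have "(1 - r) * S ?n = r * ?n + D (a ?n) ?n (real ?n) w + r * (V 1 (a ?n - 1) w - V 1 (a ?n + int ?n - 1) w)"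
        unfolding S_def using sum_V_shift[OF Vrec, of "a ?n" ?n] by simp
      then have "S ?n = (r * ?n + D (a ?n) ?n (real ?n) w + r * (V 1 (a ?n - 1) w - V 1 (a ?n + int ?n - 1) w)) / (1 - r)"
        using r_less by (simp add: eq_divide_eq mult.commute)
      moreover have "(r + d / N + r * (x / N - y / N)) / (1 - r) = (r * N + d + r * (x - y)) / (1 - r) / N"
        if "0 < N" for d N x y :: real
        using that r_less by (simp add: field_simps)
      ultimately show ?case using n0[of j] by simp
    qed
    ultimately have "(\<lambda>j. S (n j) / real (n j)) \<longlonglongrightarrow> (r + 0 + r * (0 - 0)) / (1 - r)"
      by (rule Lim_transform_eventually)
    then have "(\<lambda>j. S (Suc j ^ m) / real (Suc j ^ m)) \<longlonglongrightarrow> r / (1 - r)"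
      by (simp add: n_def)
    moreover have "incseq S"
    proof (rule incseq_SucI)
      fix n
      show "S n \<le> S (Suc n)"
        unfolding S_def using V0 step[of n] by (intro sum_mono2) auto
    qed
    ultimately have "(\<lambda>n. S n / real n) \<longlonglongrightarrow> r / (1 - r)"
      using V0 m0 by (intro tendsto_div_of_subseq_power[of S]) (auto simp: S_def intro: sum_nonneg)
    then show ?case by (simp add: S_def)
  qed
qed

end

section \<open>Almost sure properties of the environment\<close>

context bounded_iid begin

theorem environment_AE:
  "AE w in M. \<exists>V U. (\<forall>x. V x = R x w * (1 + V (x - 1)) \<and> 0 \<le> V x) \<and>
     (\<forall>x. U x = R x w * (1 + U (x + 1)) \<and> 0 \<le> U x) \<and>
     (\<lambda>n. (\<Sum>x\<in>{- int n..int n}. (1 + V (x - 1))\<^sup>2 * (1 + U (x + 1))) / (real n)\<^sup>2) \<longlonglongrightarrow> 0 \<and>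
     (\<lambda>n. height (\<lambda>x. 1 + 2 * V x) (int n) / real n) \<longlonglongrightarrow> (1 + r) / (1 - r) \<and>
     (\<lambda>n. height (\<lambda>x. 1 + 2 * V x) (- int n) / real n) \<longlonglongrightarrow> - ((1 + r) / (1 - r))"
proof -
  obtain p where p: "1 < p" "p \<le> 2" "expectation (\<lambda>w. R 0 w powr p) < 1"
    using exists_moment by blast
  obtain C where C: "0 \<le> C" "\<And>d x. d \<noteq> 0 \<Longrightarrow> (\<integral>\<^sup>+w. ennreal ((1 + V d x w) powr p) \<partial>M) \<le> ennreal C"
    "\<And>d x. d \<noteq> 0 \<Longrightarrow> AE w in M. (\<lambda>n. approx d n x w) \<longlonglongrightarrow> V d x w"
    using V_moment[OF p] by blast
  interpret bounded_iid_moment M R B r p C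
    using p C by unfold_locales auto
  have "AE w in M. (\<lambda>n. (\<Sum>x\<in>{0..<0 + int n}. V 1 x w) / real n) \<longlonglongrightarrow> r / (1 - r)"
    by (rule sum_V_limit) auto
  moreover have "AE w in M. (\<lambda>n. (\<Sum>x\<in>{- int n..<- int n + int n}. V 1 x w) / real n) \<longlonglongrightarrow> r / (1 - r)"
    by (rule sum_V_limit) auto
  ultimately show ?thesis
    using V_AE weighted_sum_small
  proof eventually_elim
    case (elim w)
    have lim: "(\<lambda>n. 1 + 2 * (f n / real n)) \<longlonglongrightarrow> (1 + r) / (1 - r)"
      if "(\<lambda>n. f n / real n) \<longlonglongrightarrow> r / (1 - r)" for f
    proof -
      have "(\<lambda>n. 1 + 2 * (f n / real n)) \<longlonglongrightarrow> 1 + 2 * (r / (1 - r))"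
        using that by (intro tendsto_add tendsto_mult tendsto_const)
      \<comment> \<open>The mean crossing time of one edge, which is the reciprocal of the
        speed.\<close>
      also have "1 + 2 * (r / (1 - r)) = (1 + r) / (1 - r)"
        using r_less by (simp add: field_simps)
      finally show ?thesis .
    qed
    have ev: "\<forall>\<^sub>F n in sequentially. 0 < n" by (rule eventually_gt_at_top)
    have "\<forall>\<^sub>F n in sequentially. 1 + 2 * ((\<Sum>x\<in>{0..<0 + int n}. V 1 x w) / real n) = height (\<lambda>x. 1 + 2 * V 1 x w) (int n) / real n"
      using ev by eventually_elim (simp add: height_def sum.distrib add_divide_distrib sum_distrib_left)
    then have up: "(\<lambda>n. height (\<lambda>x. 1 + 2 * V 1 x w) (int n) / real n) \<longlonglongrightarrow> (1 + r) / (1 - r)"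
      by (rule Lim_transform_eventually[OF lim[OF elim(1)]])
    have "\<forall>\<^sub>F n in sequentially. - (1 + 2 * ((\<Sum>x\<in>{- int n..<- int n + int n}. V 1 x w) / real n)) = height (\<lambda>x. 1 + 2 * V 1 x w) (- int n) / real n"
      using ev by eventually_elim (simp add: height_def sum.distrib add_divide_distrib diff_divide_distrib sum_distrib_left)
    then have dn: "(\<lambda>n. height (\<lambda>x. 1 + 2 * V 1 x w) (- int n) / real n) \<longlonglongrightarrow> - ((1 + r) / (1 - r))"
      by (rule Lim_transform_eventually[OF tendsto_minus[OF lim[OF elim(2)]]])
    have V: "\<forall>x. V 1 x w = R x w * (1 + V 1 (x - 1) w) \<and> 0 \<le> V 1 x w"
      using elim(3)[rule_format, OF one_neq_zero] by blast
    have U: "\<forall>x. V (- 1) x w = R x w * (1 + V (- 1) (x + 1) w) \<and> 0 \<le> V (- 1) x w"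
    proof -
      have "(- 1 :: int) \<noteq> 0" by simp
      from elim(3)[rule_format, OF this, unfolded diff_minus_eq_add] show ?thesis by blast
    qed
    show ?case
      by (rule exI[of _ "\<lambda>x. V 1 x w"], rule exI[of _ "\<lambda>x. V (- 1) x w"])
         (intro conjI V U up dn elim(4))
  qed
qed

end

section \<open>Laws of the walks\<close>

lemma iid_env_uniform_weak_lln:
  assumes "prob_space P" and sets_P: "sets P = sets env_space" and iid: "iid_env P"
    and c: "c > 0" and ell: "\<P>(\<omega> in P. \<omega> 0 \<in> {c..1 - c}) = 1"
    and mean: "(\<integral>\<omega>. rho \<omega> 0 \<partial>P) < 1"
  shows "AE \<omega> in P. uniform_weak_lln \<omega> (speed P)"
proof -
  interpret prob_space P by fact
  \<comment> \<open>Clipping makes the bounds of \<open>bounded_iid\<close> hold at every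
    environment; on the almost sure ellipticity event nothing is clipped.\<close>
  define f where "f = (\<lambda>y::real. max 0 (min (1 / c) ((1 - y) / y)))"
  define R where "R x \<omega> = f (\<omega> x)" for x :: int and \<omega> :: env
  have f [measurable]: "f \<in> borel_measurable borel" unfolding f_def by measurable
  have indep: "indep_vars (\<lambda>_. borel) (\<lambda>x \<omega>. \<omega> x) (UNIV :: int set)"
    and ident: "distr P borel (\<lambda>\<omega>. \<omega> x) = distr P borel (\<lambda>\<omega>. \<omega> 0)" for x
    using iid by (auto simp: iid_env_def)
  have comp [measurable]: "(\<lambda>\<omega>. \<omega> x) \<in> borel_measurable P" for x :: int
    using indep by (auto simp: indep_vars_def)
  have "AE \<omega> in P. \<omega> 0 \<in> {c..1 - c}"
    using ell by (subst (asm) prob_Collect_eq_1) auto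
  then have "AE y in distr P borel (\<lambda>\<omega>. \<omega> x). y \<in> {c..1 - c}" for x
    unfolding ident[of x] by (subst AE_distr_iff) auto
  then have "AE \<omega> in P. \<omega> x \<in> {c..1 - c}" for x
    by (subst (asm) AE_distr_iff) auto
  then have AE_ell: "AE \<omega> in P. \<forall>x. \<omega> x \<in> {c..1 - c}"
    by (simp add: AE_all_countable)
  have R_rho: "R x \<omega> = rho \<omega> x" if "\<forall>x. \<omega> x \<in> {c..1 - c}" for x \<omega>
  proof -
    have x: "c \<le> \<omega> x" "\<omega> x \<le> 1 - c" using that by auto
    then have "0 \<le> rho \<omega> x" "rho \<omega> x \<le> 1 / c"
      using c by (auto simp: rho_def intro!: frac_le)
    then show ?thesis by (simp add: R_def f_def rho_def)
  qed
  have rho_meas [measurable]: "(\<lambda>\<omega>. rho \<omega> x) \<in> borel_measurable P" for x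
    unfolding rho_def by measurable
  have meanR: "expectation (R 0) = (\<integral>\<omega>. rho \<omega> 0 \<partial>P)"
    using AE_ell unfolding R_def
    by (intro integral_cong_AE) (auto elim!: eventually_mono simp: R_rho[unfolded R_def])
  define r where "r = expectation (R 0)"
  have r: "r < 1" using mean meanR by (simp add: r_def)
  interpret bounded_iid P R "1 / c" r
  proof
    show "indep_vars (\<lambda>_. borel) R UNIV"
      unfolding R_def[abs_def] by (rule indep_vars_compose2[OF indep]) simp
    show "distr P borel (R x) = distr P borel (R 0)" for x
    proof -
      have "distr P borel (R x) = distr (distr P borel (\<lambda>\<omega>. \<omega> x)) borel f" for x
        unfolding R_def[abs_def] by (subst distr_distr) (auto simp: comp_def)
      then show ?thesis using ident[of x] by simp
    qed
    show "0 \<le> R x w" for x w by (simp add: R_def f_def)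
    show "R x w \<le> 1 / c" for x w using c by (auto simp: R_def f_def)
  qed (use r in \<open>auto simp: r_def\<close>)
  have v: "1 / speed P = (1 + r) / (1 - r)" "0 < speed P"
    using r r_nonneg meanR by (auto simp: speed_def r_def)
  show ?thesis
    using environment_AE AE_ell
  proof eventually_elim
    case (elim \<omega>)
    from elim(1) obtain V U where VU: "\<forall>x. V x = R x \<omega> * (1 + V (x - 1)) \<and> 0 \<le> V x"
      "\<forall>x. U x = R x \<omega> * (1 + U (x + 1)) \<and> 0 \<le> U x"
      "(\<lambda>n. (\<Sum>x\<in>{- int n..int n}. (1 + V (x - 1))\<^sup>2 * (1 + U (x + 1))) / (real n)\<^sup>2) \<longlonglongrightarrow> 0"
      "(\<lambda>n. height (\<lambda>x. 1 + 2 * V x) (int n) / real n) \<longlonglongrightarrow> (1 + r) / (1 - r)"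
      "(\<lambda>n. height (\<lambda>x. 1 + 2 * V x) (- int n) / real n) \<longlonglongrightarrow> - ((1 + r) / (1 - r))"
      by (elim exE conjE)
    interpret elliptic_env \<omega> c V U
    proof
      show "0 < c" by fact
      show "c \<le> \<omega> x" "\<omega> x \<le> 1 - c" for x using spec[OF elim(2), of x] by auto
      show "V x = rho \<omega> x * (1 + V (x - 1))" "0 \<le> V x" for x
        using spec[OF VU(1), of x] unfolding R_rho[OF elim(2)] by (rule conjunct1, rule conjunct2)
      show "U x = rho \<omega> x * (1 + U (x + 1))" "0 \<le> U x" for x
        using spec[OF VU(2), of x] unfolding R_rho[OF elim(2)] by (rule conjunct1, rule conjunct2)
    qed
    have "(\<lambda>n. ht (int n) / real n) \<longlonglongrightarrow> 1 / speed P"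
      "(\<lambda>n. ht (- int n) / real n) \<longlonglongrightarrow> - (1 / speed P)"
      using VU(4,5) by (simp_all only: ht_def v(1))
    then show ?case
      by (intro uniform_weak_law[OF VU(3) _ _ v(2)])
  qed
qed

text \<open>\<open>markov_chain_from\<close> conditions on complete histories of positive
  probability. Histories up to time n are lists, hence countably many, and summing over those that
  end in z gives the one-step equation for the marginal.\<close>

lemma (in prob_space) markov_chain_step:
  assumes mc: "markov_chain_from M p x X"
  shows "prob {s\<in>space M. X s n = z \<and> X s (Suc n) = w} = prob {s\<in>space M. X s n = z} * p z w"
proof -
  have X [measurable]: "X \<in> measurable M path_space" using mc by (simp add: markov_chain_from_def)
  have Xn [measurable]: "(\<lambda>s. X s k) \<in> measurable M (count_space UNIV)" for k
    using measurable_compose[OF X[unfolded path_space_def] measurable_component_singleton[of k UNIV "\<lambda>_. count_space UNIV"]] by simp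
  define I where "I = {ys :: int list. length ys = Suc n \<and> ys ! n = z}"
  define E where "E ys = {s\<in>space M. \<forall>k\<le>n. X s k = ys ! k}" for ys
  define F where "F ys = {s\<in>space M. (\<forall>k\<le>n. X s k = ys ! k) \<and> X s (Suc n) = w}" for ys
  have sets: "E ys \<in> sets M" "F ys \<in> sets M" for ys unfolding E_def F_def by measurable
  have disj: "disjoint_family_on E I" "disjoint_family_on F I"
    unfolding disjoint_family_on_def E_def F_def I_def
    by (auto intro!: nth_equalityI simp: less_Suc_eq_le)
  have UE: "(\<Union>ys\<in>I. E ys) = {s\<in>space M. X s n = z}"
  proof (intro equalityI subsetI)
    fix s assume "s \<in> {s\<in>space M. X s n = z}"
    then show "s \<in> (\<Union>ys\<in>I. E ys)"
      by (intro UN_I[of "map (X s) [0..<Suc n]"]) (auto simp: I_def E_def simp del: upt_Suc)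
  qed (auto simp: I_def E_def)
  have UF: "(\<Union>ys\<in>I. F ys) = {s\<in>space M. X s n = z \<and> X s (Suc n) = w}"
  proof (intro equalityI subsetI)
    fix s assume "s \<in> {s\<in>space M. X s n = z \<and> X s (Suc n) = w}"
    then show "s \<in> (\<Union>ys\<in>I. F ys)"
      by (intro UN_I[of "map (X s) [0..<Suc n]"]) (auto simp: I_def F_def simp del: upt_Suc)
  qed (auto simp: I_def F_def)
  have FE: "prob (F ys) = prob (E ys) * p z w" if "ys \<in> I" for ys
  proof (cases "prob (E ys) > 0")
    case True
    have "\<P>(s in M. X s (Suc n) = w \<bar> \<forall>k\<le>n. X s k = ys ! k) = p (ys ! n) w"
      using mc True unfolding markov_chain_from_def E_def by blast
    moreover have "{s\<in>space M. X s (Suc n) = w \<and> (\<forall>k\<le>n. X s k = ys ! k)} = F ys"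
      by (auto simp: F_def)
    ultimately show ?thesis using True that by (simp add: cond_prob_def E_def I_def field_simps)
  next
    case False
    then have "prob (E ys) = 0" using measure_nonneg[of M "E ys"] by linarith
    moreover have "prob (F ys) \<le> prob (E ys)" using sets by (intro finite_measure_mono) (auto simp: E_def F_def)
    ultimately show ?thesis using measure_nonneg[of M "F ys"] by simp
  qed
  show ?thesis
  proof (cases "\<exists>ys\<in>I. prob (E ys) > 0")
    case False
    then have "prob (E ys) = 0" if "ys \<in> I" for ys
    proof -
      have "\<not> 0 < prob (E ys)" using False that by blast
      then show ?thesis using measure_nonneg[of M "E ys"] by linarith
    qed
    then have "emeasure M (\<Union>ys\<in>I. E ys) = 0" "emeasure M (\<Union>ys\<in>I. F ys) = 0"
      using sets disj FE
      by (subst emeasure_UN_countable; auto simp: emeasure_eq_measure nn_integral_0_iff_AE AE_count_space)+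
    then show ?thesis by (simp add: UE UF emeasure_eq_measure)
  next
    case True
    then obtain ys where ys: "ys \<in> I" "prob (E ys) > 0" by blast
    \<comment> \<open>The sign of \<open>p z w\<close> is read off from a history of positive
      probability; in the case without one both sides vanished.\<close>
    have "0 \<le> prob (E ys) * p z w" using FE[OF ys(1)] measure_nonneg[of M "F ys"] by simp
    then have p0: "0 \<le> p z w" using ys(2) by (simp add: zero_le_mult_iff)
    have "emeasure M (\<Union>ys\<in>I. F ys) = (\<integral>\<^sup>+ys. emeasure M (F ys) \<partial>count_space I)"
      using sets disj by (intro emeasure_UN_countable) auto
    also have "\<dots> = (\<integral>\<^sup>+ys. emeasure M (E ys) * ennreal (p z w) \<partial>count_space I)"
      using p0 by (intro nn_integral_cong) (auto simp: emeasure_eq_measure FE ennreal_mult)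
    also have "\<dots> = (\<integral>\<^sup>+ys. emeasure M (E ys) \<partial>count_space I) * ennreal (p z w)"
      by (rule nn_integral_multc) simp
    also have "(\<integral>\<^sup>+ys. emeasure M (E ys) \<partial>count_space I) = emeasure M (\<Union>ys\<in>I. E ys)"
      using sets disj by (intro emeasure_UN_countable[symmetric]) auto
    finally show ?thesis
      unfolding UE UF using p0 by (simp add: emeasure_eq_measure flip: ennreal_mult)
  qed
qed

section \<open>One walk under the quenched law\<close>

context prob_space
begin

context
  fixes \<omega> :: env and x :: int and X :: "'a \<Rightarrow> nat \<Rightarrow> int"
  assumes mc: "markov_chain_from M (step_prob \<omega>) x X" and \<omega>: "\<And>z. 0 \<le> \<omega> z \<and> \<omega> z \<le> 1"
begin

lemma walk_measurable [measurable]: "(\<lambda>s. X s k) \<in> measurable M (count_space UNIV)"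
proof -
  have "X \<in> measurable M (\<Pi>\<^sub>M n\<in>UNIV. count_space UNIV)"
    using mc by (simp add: markov_chain_from_def path_space_def)
  from measurable_compose[OF this measurable_component_singleton[of k]] show ?thesis by simp
qed

lemma walk_start: "AE s in M. X s 0 = x"
  using mc by (subst (asm) markov_chain_from_def, subst (asm) prob_Collect_eq_1) auto

lemma walk_neighbour: "AE s in M. \<forall>n. X s (Suc n) = X s n + 1 \<or> X s (Suc n) = X s n - 1"
proof -
  have "AE s in M. \<not> (X s n = z \<and> X s (Suc n) = w)" if "w \<noteq> z + 1" "w \<noteq> z - 1" for n z w
  proof (rule AE_I)
    show "{s\<in>space M. \<not> \<not> (X s n = z \<and> X s (Suc n) = w)} \<subseteq> {s\<in>space M. X s n = z \<and> X s (Suc n) = w}" by auto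
    show "emeasure M {s\<in>space M. X s n = z \<and> X s (Suc n) = w} = 0"
      using that by (simp add: emeasure_eq_measure markov_chain_step[OF mc] step_prob_def)
  qed measurable
  then have "AE s in M. \<forall>n z w. w \<noteq> z + 1 \<longrightarrow> w \<noteq> z - 1 \<longrightarrow> \<not> (X s n = z \<and> X s (Suc n) = w)"
    by (intro AE_all_countable[THEN iffD2] allI AE_impI)
  then show ?thesis by eventually_elim blast
qed

lemma walk_range: "AE s in M. \<forall>n. \<bar>X s n - x\<bar> \<le> int n"
  using walk_start walk_neighbour
proof eventually_elim
  case (elim s)
  show ?case
  proof
    fix n show "\<bar>X s n - x\<bar> \<le> int n"
    proof (induction n)
      case (Suc n)
      then show ?case using elim(2)[rule_format, of n] by auto
    qed (use elim(1) in simp)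
  qed
qed

lemma prob_walk_eq_0:
  assumes "int n < \<bar>z - x\<bar>" shows "prob {s\<in>space M. X s n = z} = 0"
proof -
  have "AE s in M. \<not> X s n = z" using walk_range by eventually_elim (use assms in \<open>auto dest: spec[of _ n]\<close>)
  then show ?thesis by (subst prob_eq_0) auto
qed

lemma prob_walk_Suc:
  "prob {s\<in>space M. X s (Suc n) = w} = prob {s\<in>space M. X s n = w - 1} * \<omega> (w - 1)
     + prob {s\<in>space M. X s n = w + 1} * (1 - \<omega> (w + 1))"
proof -
  have "prob {s\<in>space M. X s (Suc n) = w} = prob ({s\<in>space M. X s n = w - 1 \<and> X s (Suc n) = w}
      \<union> {s\<in>space M. X s n = w + 1 \<and> X s (Suc n) = w})"
    by (rule finite_measure_eq_AE) (use walk_neighbour in \<open>auto elim!: eventually_mono dest: spec[of _ n]\<close>)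
  also have "\<dots> = prob {s\<in>space M. X s n = w - 1 \<and> X s (Suc n) = w}
      + prob {s\<in>space M. X s n = w + 1 \<and> X s (Suc n) = w}"
    by (rule finite_measure_Union) auto
  finally show ?thesis by (simp add: markov_chain_step[OF mc] step_prob_def)
qed

text \<open>Duality: the forward equation \<open>prob_walk_Suc\<close> for the law becomes one
  application of \<open>walk_op\<close> to f, so f must be arbitrary in the induction. The window of
  n + 1 steps is trimmed to shifted copies of the window of n steps, because the remaining sites
  carry no mass.\<close>

lemma sum_prob_walk:
  "(\<Sum>z\<in>{x - int n..x + int n}. prob {s\<in>space M. X s n = z} * f z) = (walk_op \<omega> ^^ n) f x"
proof (induction n arbitrary: f)
  case 0
  have "prob {s\<in>space M. X s 0 = x} = 1" using mc by (simp add: markov_chain_from_def)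
  then show ?case by simp
next
  case (Suc n)
  let ?q = "\<lambda>n z. prob {s\<in>space M. X s n = z}"
  let ?W = "{x - int n..x + int n}"
  have "(\<Sum>w\<in>{x - int (Suc n)..x + int (Suc n)}. ?q (Suc n) w * f w)
    = (\<Sum>w\<in>{x - int (Suc n)..x + int (Suc n)}. ?q n (w - 1) * \<omega> (w - 1) * f w)
    + (\<Sum>w\<in>{x - int (Suc n)..x + int (Suc n)}. ?q n (w + 1) * (1 - \<omega> (w + 1)) * f w)"
    by (simp add: prob_walk_Suc distrib_right sum.distrib)
  also have "(\<Sum>w\<in>{x - int (Suc n)..x + int (Suc n)}. ?q n (w - 1) * \<omega> (w - 1) * f w)
    = (\<Sum>w\<in>(\<lambda>z. z + 1) ` ?W. ?q n (w - 1) * \<omega> (w - 1) * f w)"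
    using prob_walk_eq_0[of n "_ - 1"] by (intro sum.mono_neutral_right) auto
  also have "\<dots> = (\<Sum>z\<in>?W. ?q n z * \<omega> z * f (z + 1))"
    by (subst sum.reindex) (auto simp: inj_on_def)
  also have "(\<Sum>w\<in>{x - int (Suc n)..x + int (Suc n)}. ?q n (w + 1) * (1 - \<omega> (w + 1)) * f w)
    = (\<Sum>w\<in>(\<lambda>z. z - 1) ` ?W. ?q n (w + 1) * (1 - \<omega> (w + 1)) * f w)"
    using prob_walk_eq_0[of n "_ + 1"] by (intro sum.mono_neutral_right) auto
  also have "\<dots> = (\<Sum>z\<in>?W. ?q n z * (1 - \<omega> z) * f (z - 1))"
    by (subst sum.reindex) (auto simp: inj_on_def)
  also have "(\<Sum>z\<in>?W. ?q n z * \<omega> z * f (z + 1)) + (\<Sum>z\<in>?W. ?q n z * (1 - \<omega> z) * f (z - 1))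
    = (\<Sum>z\<in>?W. ?q n z * walk_op \<omega> f z)"
    by (simp add: walk_op_def distrib_left mult.assoc flip: sum.distrib)
  also have "\<dots> = (walk_op \<omega> ^^ Suc n) f x"
    by (simp add: Suc.IH funpow_swap1)
  finally show ?case .
qed

lemma prob_walk:
  "prob {s\<in>space M. A (X s n)} = (walk_op \<omega> ^^ n) (\<lambda>z. of_bool (A z \<and> \<bar>z - x\<bar> \<le> int n)) x"
proof -
  let ?W = "{x - int n..x + int n}"
  let ?I = "{z\<in>?W. A z}"
  have "prob {s\<in>space M. A (X s n)} = prob (\<Union>z\<in>?I. {s\<in>space M. X s n = z})"
    by (rule finite_measure_eq_AE) (use walk_range in \<open>auto elim!: eventually_mono dest: spec[of _ n] simp: abs_le_iff\<close>)
  also have "\<dots> = (\<Sum>z\<in>?I. prob {s\<in>space M. X s n = z})"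
    by (rule finite_measure_finite_Union) (auto simp: disjoint_family_on_def intro: finite_subset[of _ ?W])
  also have "\<dots> = (\<Sum>z\<in>?W. prob {s\<in>space M. X s n = z} * of_bool (A z \<and> \<bar>z - x\<bar> \<le> int n))"
    by (rule sum.mono_neutral_cong_left) auto
  finally show ?thesis by (simp add: sum_prob_walk)
qed

end
end

section \<open>Particles\<close>

text \<open>Chernoff bound: \<open>E (exp 1\<^sub>B) \<le> 1 + 2 q \<le> exp (2 q)\<close> for an event \<open>B\<close> of probability at most \<open>q\<close>.\<close>

lemma (in prob_space) prob_count_ge_le:
  assumes I: "finite I" and indep: "indep_vars N Z I"
    and A [measurable]: "\<And>i. i \<in> I \<Longrightarrow> Measurable.pred (N i) (A i)"
    and q: "\<And>i. i \<in> I \<Longrightarrow> prob {s\<in>space M. A i (Z i s)} \<le> q" and q0: "0 \<le> q"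
  shows "prob {s\<in>space M. a \<le> (\<Sum>i\<in>I. of_bool (A i (Z i s)))} \<le> exp (2 * q * real (card I) - a)"
proof -
  have Z [measurable]: "i \<in> I \<Longrightarrow> Z i \<in> measurable M (N i)" for i
    using indep by (auto simp: indep_vars_def)
  have AZ [measurable]: "Measurable.pred M (\<lambda>s. A i (Z i s))" if "i \<in> I" for i
    using measurable_compose[OF Z[OF that] A[OF that]] .
  let ?e = "\<lambda>i s. exp (of_bool (A i (Z i s))) :: real"
  have int: "integrable M (?e i)" if "i \<in> I" for i
    using AZ[OF that] by (intro integrable_const_bound[of _ "exp 1"]) auto
  have ind: "indep_vars (\<lambda>_. borel) ?e I"
  proof (rule indep_vars_compose2[OF indep])
    fix i assume "i \<in> I"
    note [measurable] = A[OF this]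
    show "(\<lambda>z. exp (of_bool (A i z)) :: real) \<in> borel_measurable (N i)" by measurable
  qed
  have E: "expectation (?e i) \<le> exp (2 * q)" if i: "i \<in> I" for i
  proof -
    note [measurable] = AZ[OF i]
    have "?e i s \<le> 1 + 2 * indicator {s\<in>space M. A i (Z i s)} s" if "s \<in> space M" for s
      using that exp_le by (auto simp: indicator_def)
    then have "expectation (?e i) \<le> expectation (\<lambda>s. 1 + 2 * indicator {s\<in>space M. A i (Z i s)} s)"
      using int[OF i] by (intro integral_mono integrable_const_bound[of _ 3]) (auto simp: indicator_def exp_le)
    also have "\<dots> = 1 + 2 * prob {s\<in>space M. A i (Z i s)}"
    proof -
      have "integrable M (indicator {s\<in>space M. A i (Z i s)} :: 'a \<Rightarrow> real)"
        by (rule integrable_real_indicator) (auto simp: less_top[symmetric])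
      then show ?thesis by (simp add: prob_space)
    qed
    also have "\<dots> \<le> 1 + 2 * q" using q[OF i] by simp
    also have "\<dots> \<le> exp (2 * q)" by (rule exp_ge_add_one_self)
    finally show ?thesis .
  qed
  have int_prod: "integrable M (\<lambda>s. \<Prod>i\<in>I. ?e i s)"
    using I ind int by (rule indep_vars_integrable)
  have "{s\<in>space M. a \<le> (\<Sum>i\<in>I. of_bool (A i (Z i s)))} = {s\<in>space M. exp a \<le> (\<Prod>i\<in>I. ?e i s)}"
    using I by (simp flip: exp_sum)
  also have "prob \<dots> \<le> expectation (\<lambda>s. \<Prod>i\<in>I. ?e i s) / exp a"
    using int_prod by (intro integral_Markov_inequality_measure[of _ _ "space M"]) (auto intro!: AE_I2 prod_nonneg)
  also have "expectation (\<lambda>s. \<Prod>i\<in>I. ?e i s) = (\<Prod>i\<in>I. expectation (?e i))"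
    using I ind int by (rule indep_vars_lebesgue_integral)
  also have "\<dots> \<le> (\<Prod>i\<in>I. exp (2 * q))"
    using E by (intro prod_mono) (auto intro!: Bochner_Integration.integral_nonneg)
  also have "\<dots> = exp (2 * q * real (card I))"
    by (simp add: exp_of_nat_mult[symmetric] mult.commute)
  finally show ?thesis by (simp add: exp_diff divide_right_mono)
qed

text \<open>Conditioning on g without conditional probabilities: the events for g are disjoint and
  have total probability at most 1, and by independence each contributes its probability times at
  most b.\<close>

lemma (in prob_space) indep_rv_prob_Union_le:
  assumes ind: "indep_rv M A f B g" and F: "finite F"
    and G: "\<And>\<xi>. \<xi> \<in> F \<Longrightarrow> G \<xi> \<in> sets B" and disj: "disjoint_family_on G F"
    and H: "\<And>\<xi>. \<xi> \<in> F \<Longrightarrow> H \<xi> \<in> sets A" and b: "\<And>\<xi>. \<xi> \<in> F \<Longrightarrow> prob {s\<in>space M. f s \<in> H \<xi>} \<le> b" and b0: "0 \<le> b"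
  shows "{s\<in>space M. \<exists>\<xi>\<in>F. g s \<in> G \<xi> \<and> f s \<in> H \<xi>} \<in> events"
    and "prob {s\<in>space M. \<exists>\<xi>\<in>F. g s \<in> G \<xi> \<and> f s \<in> H \<xi>} \<le> b"
proof -
  have f: "f \<in> measurable M A" and g: "g \<in> measurable M B"
    and ind': "indep_set {f -` a \<inter> space M | a. a \<in> sets A} {g -` b \<inter> space M | b. b \<in> sets B}"
    using ind by (auto simp: indep_rv_def)
  let ?G = "\<lambda>\<xi>. {s\<in>space M. g s \<in> G \<xi>}" and ?H = "\<lambda>\<xi>. {s\<in>space M. f s \<in> H \<xi>}"
  have sets: "?G \<xi> \<in> sets M" "?H \<xi> \<in> sets M" if "\<xi> \<in> F" for \<xi>
    using measurable_sets[OF g G[OF that]] measurable_sets[OF f H[OF that]]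
    by (simp_all add: vimage_def Int_def conj_commute)
  have prod: "prob (?G \<xi> \<inter> ?H \<xi>) = prob (?G \<xi>) * prob (?H \<xi>)" if "\<xi> \<in> F" for \<xi>
  proof -
    have "?H \<xi> \<in> {f -` a \<inter> space M | a. a \<in> sets A}" "?G \<xi> \<in> {g -` b \<inter> space M | b. b \<in> sets B}"
      using G[OF that] H[OF that] by auto
    from indep_setD[OF ind' this] show ?thesis by (simp add: Int_commute)
  qed
  have disj': "disjoint_family_on ?G F" "disjoint_family_on (\<lambda>\<xi>. ?G \<xi> \<inter> ?H \<xi>) F"
    using disj unfolding disjoint_family_on_def by blast+
  have eq: "{s\<in>space M. \<exists>\<xi>\<in>F. g s \<in> G \<xi> \<and> f s \<in> H \<xi>} = (\<Union>\<xi>\<in>F. ?G \<xi> \<inter> ?H \<xi>)" by auto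
  show "{s\<in>space M. \<exists>\<xi>\<in>F. g s \<in> G \<xi> \<and> f s \<in> H \<xi>} \<in> events"
    unfolding eq using F sets by (intro sets.finite_UN sets.Int)
  have "prob {s\<in>space M. \<exists>\<xi>\<in>F. g s \<in> G \<xi> \<and> f s \<in> H \<xi>} = prob (\<Union>\<xi>\<in>F. ?G \<xi> \<inter> ?H \<xi>)"
    by (simp only: eq)
  also have "\<dots> = (\<Sum>\<xi>\<in>F. prob (?G \<xi> \<inter> ?H \<xi>))"
    using F sets disj' by (intro finite_measure_finite_Union) auto
  also have "\<dots> \<le> (\<Sum>\<xi>\<in>F. prob (?G \<xi>) * b)"
    using prod b by (intro sum_mono) (simp add: mult_left_mono)
  also have "\<dots> = prob (\<Union>\<xi>\<in>F. ?G \<xi>) * b"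
    unfolding sum_distrib_right[symmetric] using F sets disj'
    by (subst finite_measure_finite_Union) auto
  also have "\<dots> \<le> 1 * b" using b0 by (intro mult_right_mono) auto
  finally show "prob {s\<in>space M. \<exists>\<xi>\<in>F. g s \<in> G \<xi> \<and> f s \<in> H \<xi>} \<le> b" by simp
qed

section \<open>The particle system under one quenched law\<close>

locale quenched = prob_space M for M :: "'a measure" +
  fixes \<omega> :: env and X :: "int \<Rightarrow> nat \<Rightarrow> 'a \<Rightarrow> nat \<Rightarrow> int" and \<eta> :: "nat \<Rightarrow> 'a \<Rightarrow> configuration"
  assumes system: "quenched_system \<omega> M X \<eta>" and \<omega>: "\<And>z. 0 \<le> \<omega> z \<and> \<omega> z \<le> 1"
begin

lemma mc: "1 \<le> i \<Longrightarrow> markov_chain_from M (step_prob \<omega>) y (X y i)"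
  using system by (simp add: quenched_system_def)

lemma X_measurable [measurable (raw)]: "1 \<le> i \<Longrightarrow> (\<lambda>s. X y i s n) \<in> measurable M (count_space UNIV)"
  using walk_measurable[OF mc \<omega>] .

lemma \<eta>_measurable [measurable (raw)]: "1 \<le> N \<Longrightarrow> (\<lambda>s. \<eta> N s y) \<in> measurable M (count_space UNIV)"
proof -
  assume "1 \<le> N"
  then have "\<eta> N \<in> measurable M (\<Pi>\<^sub>M _\<in>UNIV. count_space UNIV)"
    using system by (auto simp: quenched_system_def indep_rv_def)
  from measurable_compose[OF this measurable_component_singleton[of y]] show ?thesis by simp
qed

lemma AE_range: "AE s in M. \<forall>y. \<forall>i\<ge>1. \<forall>n. \<bar>X y i s n - y\<bar> \<le> int n"
  using walk_range[OF mc \<omega>] by (intro AE_all_countable[THEN iffD2] allI AE_impI) (auto simp: AE_all_countable)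

definition count_bad :: "nat \<Rightarrow> nat \<Rightarrow> int set \<Rightarrow> (int \<Rightarrow> int \<Rightarrow> bool) \<Rightarrow> 'a \<Rightarrow> nat" where
  "count_bad N n W A s = (\<Sum>y\<in>W. \<Sum>i=1..\<eta> N s y. of_bool (A y (X y i s n)))"

text \<open>Conditioning on the finitely many possible initial configurations in \<open>W\<close> with at most \<open>L\<close> particles.\<close>

lemma prob_count_bad:
  assumes N: "1 \<le> N" and W: "finite W" and q0: "0 \<le> q"
    and q: "\<And>y. y \<in> W \<Longrightarrow> (walk_op \<omega> ^^ n) (\<lambda>z. of_bool (A y z \<and> \<bar>z - y\<bar> \<le> int n)) y \<le> q"
  shows "prob {s\<in>space M. (\<Sum>y\<in>W. real (\<eta> N s y)) \<le> L \<and> a \<le> real (count_bad N n W A s)} \<le> exp (2 * q * L - a)"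
proof (cases "0 \<le> L")
  case False
  moreover have "0 \<le> (\<Sum>y\<in>W. real (\<eta> N s y))" for s by (simp add: sum_nonneg)
  ultimately have "\<not> (\<Sum>y\<in>W. real (\<eta> N s y)) \<le> L" for s by (meson order_trans)
  then show ?thesis by simp
next
  case L: True
  \<comment> \<open>Mass at most L forces every coordinate to be at most the floor of L, so the
    restrictions to W form a finite set. \<open>G \<xi>\<close> fixes the configuration on W only,
    and \<open>H \<xi>\<close> speaks of the walks only.\<close>
  define F where "F = {\<xi> \<in> PiE W (\<lambda>_. {..nat \<lfloor>L\<rfloor>}). (\<Sum>y\<in>W. real (\<xi> y)) \<le> L}"
  define G where "G \<xi> = {h \<in> space (\<Pi>\<^sub>M _\<in>UNIV. count_space UNIV). \<forall>y\<in>W. h y = \<xi> y}" for \<xi> :: "int \<Rightarrow> nat"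
  define H where "H \<xi> = {\<phi> \<in> space (\<Pi>\<^sub>M _\<in>walk_labels. path_space).
     a \<le> (\<Sum>j\<in>Sigma W (\<lambda>y. {1..\<xi> y}). of_bool (A (fst j) (\<phi> j n)))}" for \<xi> :: "int \<Rightarrow> nat"
  let ?f = "\<lambda>s. \<lambda>(x, i)\<in>walk_labels. X x i s"
  have ind: "indep_rv M (\<Pi>\<^sub>M _\<in>walk_labels. path_space) ?f (\<Pi>\<^sub>M _\<in>UNIV. count_space UNIV) (\<eta> N)"
    using system N by (simp add: quenched_system_def)
  have indX: "indep_vars (\<lambda>_. path_space) (\<lambda>(x, i). X x i) walk_labels"
    using system by (simp add: quenched_system_def)
  have finF: "finite F" unfolding F_def using W by (auto intro!: finite_PiE)
  have path_comp: "(\<lambda>\<phi>. \<phi> n) \<in> measurable path_space (count_space UNIV)"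
    unfolding path_space_def by (rule measurable_component_singleton) simp
  have Gs: "G \<xi> \<in> sets (\<Pi>\<^sub>M _\<in>UNIV. count_space UNIV)" for \<xi>
    unfolding G_def using W by measurable
  have disj: "disjoint_family_on G F"
    unfolding disjoint_family_on_def F_def G_def by (auto simp: PiE_eq_iff) (metis PiE_ext)
  have H: "H \<xi> \<in> sets (\<Pi>\<^sub>M _\<in>walk_labels. path_space) \<and> prob {s\<in>space M. ?f s \<in> H \<xi>} \<le> exp (2 * q * L - a)"
    if \<xi>: "\<xi> \<in> F" for \<xi>
  proof
    let ?I = "Sigma W (\<lambda>y. {1..\<xi> y})"
    have I: "finite ?I" "?I \<subseteq> walk_labels" using W by (auto simp: walk_labels_def)
    have meas: "(\<lambda>\<phi>. \<phi> j n) \<in> measurable (\<Pi>\<^sub>M _\<in>walk_labels. path_space) (count_space UNIV)" if "j \<in> ?I" for j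
      using measurable_compose[OF measurable_component_singleton[of j walk_labels "\<lambda>_. path_space"] path_comp] that I(2) by auto
    show "H \<xi> \<in> sets (\<Pi>\<^sub>M _\<in>walk_labels. path_space)"
    proof -
      have "(\<lambda>\<phi>. \<Sum>j\<in>?I. of_bool (A (fst j) (\<phi> j n)) :: real) \<in> borel_measurable (\<Pi>\<^sub>M _\<in>walk_labels. path_space)"
      proof (rule borel_measurable_sum)
        fix j assume "j \<in> ?I"
        from measurable_compose[OF meas[OF this], of "\<lambda>z. of_bool (A (fst j) z)" borel]
        show "(\<lambda>\<phi>. of_bool (A (fst j) (\<phi> j n)) :: real) \<in> borel_measurable (\<Pi>\<^sub>M _\<in>walk_labels. path_space)" by simp
      qed
      then show ?thesis unfolding H_def by measurable
    qed
    have "prob {s\<in>space M. ?f s \<in> H \<xi>}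
       \<le> prob {s\<in>space M. a \<le> (\<Sum>j\<in>?I. of_bool (A (fst j) ((case j of (x, i) \<Rightarrow> X x i) s n)))}"
    proof (rule finite_measure_mono)
      show "{s\<in>space M. ?f s \<in> H \<xi>} \<subseteq> {s\<in>space M. a \<le> (\<Sum>j\<in>?I. of_bool (A (fst j) ((case j of (x, i) \<Rightarrow> X x i) s n)))}"
      proof safe
        fix s assume "?f s \<in> H \<xi>"
        then have "a \<le> (\<Sum>j\<in>?I. of_bool (A (fst j) (?f s j n)))" by (simp add: H_def)
        also have "\<dots> = (\<Sum>j\<in>?I. of_bool (A (fst j) ((case j of (x, i) \<Rightarrow> X x i) s n)))"
          using I(2) by (intro sum.cong) (auto split: prod.splits)
        finally show "a \<le> (\<Sum>j\<in>?I. of_bool (A (fst j) ((case j of (x, i) \<Rightarrow> X x i) s n)))" .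
      qed
      have "(\<lambda>s. \<Sum>j\<in>?I. of_bool (A (fst j) ((case j of (x, i) \<Rightarrow> X x i) s n)) :: real) \<in> borel_measurable M"
        by (rule borel_measurable_sum) (auto intro!: measurable_compose[OF X_measurable])
      then show "{s\<in>space M. a \<le> (\<Sum>j\<in>?I. of_bool (A (fst j) ((case j of (x, i) \<Rightarrow> X x i) s n)))} \<in> sets M"
        by measurable
    qed
    also have "\<dots> \<le> exp (2 * q * real (card ?I) - a)"
    proof (rule prob_count_ge_le[where A="\<lambda>j \<phi>. A (fst j) (\<phi> n)", OF I(1) indep_vars_subset[OF indX I(2)] _ _ q0])
      fix j assume j: "j \<in> ?I"
      show "Measurable.pred path_space (\<lambda>\<phi>. A (fst j) (\<phi> n))"
        using measurable_compose[OF path_comp, of "A (fst j)" "count_space UNIV"] by simp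
      show "prob {s\<in>space M. A (fst j) ((case j of (x, i) \<Rightarrow> X x i) s n)} \<le> q"
        using j q prob_walk[OF mc[of "snd j" "fst j"] \<omega>, where n=n and A="A (fst j)"] by auto
    qed
    \<comment> \<open>The number of walks involved is the mass of \<xi>, so the bound becomes the
      same for all \<xi> in \<open>F\<close>.\<close>
    also have "\<dots> \<le> exp (2 * q * L - a)"
      using \<xi> q0 W by (auto simp: F_def card_SigmaI mult_left_mono)
    finally show "prob {s\<in>space M. ?f s \<in> H \<xi>} \<le> exp (2 * q * L - a)" .
  qed
  note union = indep_rv_prob_Union_le[OF ind finF Gs disj conjunct1[OF H] conjunct2[OF H] exp_ge_zero]
  have "{s\<in>space M. (\<Sum>y\<in>W. real (\<eta> N s y)) \<le> L \<and> a \<le> real (count_bad N n W A s)}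
      \<subseteq> {s\<in>space M. \<exists>\<xi>\<in>F. \<eta> N s \<in> G \<xi> \<and> ?f s \<in> H \<xi>}"
  proof safe
    fix s assume s: "s \<in> space M" and le: "(\<Sum>y\<in>W. real (\<eta> N s y)) \<le> L" and ge: "a \<le> real (count_bad N n W A s)"
    let ?\<xi> = "restrict (\<eta> N s) W"
    have "real (\<eta> N s y) \<le> L" if "y \<in> W" for y
      using member_le_sum[OF that, of "\<lambda>y. real (\<eta> N s y)"] W le by simp
    then have "\<eta> N s y \<le> nat \<lfloor>L\<rfloor>" if "y \<in> W" for y
      using that by (simp add: le_nat_floor)
    then have F: "?\<xi> \<in> F" using le by (auto simp: F_def)
    have "real (count_bad N n W A s) = (\<Sum>j\<in>Sigma W (\<lambda>y. {1..?\<xi> y}). of_bool (A (fst j) (?f s j n)))"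
    proof -
      have "real (count_bad N n W A s) = (\<Sum>y\<in>W. \<Sum>i=1..\<eta> N s y. of_bool (A y (X y i s n)))"
        unfolding count_bad_def of_nat_sum of_nat_of_bool ..
      also have "\<dots> = (\<Sum>y\<in>W. \<Sum>i\<in>{1..?\<xi> y}. of_bool (A (fst (y, i)) (?f s (y, i) n)))"
        by (intro sum.cong) (auto simp: walk_labels_def)
      also have "\<dots> = (\<Sum>(y, i)\<in>Sigma W (\<lambda>y. {1..?\<xi> y}). of_bool (A (fst (y, i)) (?f s (y, i) n)))"
        using W by (intro sum.Sigma) auto
      also have "\<dots> = (\<Sum>j\<in>Sigma W (\<lambda>y. {1..?\<xi> y}). of_bool (A (fst j) (?f s j n)))"
        by (rule sum.cong[OF refl]) (simp add: case_prod_beta)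
      finally show ?thesis .
    qed
    moreover have "?f s \<in> space (\<Pi>\<^sub>M _\<in>walk_labels. path_space)"
    proof -
      have "?f \<in> measurable M (\<Pi>\<^sub>M _\<in>walk_labels. path_space)"
        using ind by (simp only: indep_rv_def)
      then show ?thesis using s by (rule measurable_space)
    qed
    ultimately have "?f s \<in> H ?\<xi>" using ge by (simp add: H_def)
    moreover have "\<eta> N s \<in> G ?\<xi>" by (auto simp: G_def space_PiM)
    ultimately show "\<exists>\<xi>\<in>F. \<eta> N s \<in> G \<xi> \<and> ?f s \<in> H \<xi>" using F by blast
  qed
  from finite_measure_mono[OF this union(1)] union(2) show ?thesis by (rule order_trans)
qed

end

section \<open>Test functions and finite forms of the empirical sums\<close>

lemma C0_E:
  assumes "g \<in> C0"
  obtains R G where "\<And>x. R < \<bar>x\<bar> \<Longrightarrow> g x = 0" "0 \<le> G" "\<And>x. \<bar>g x\<bar> \<le> G"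
    "uniformly_continuous_on UNIV g" "continuous_on UNIV g"
proof -
  have cont: "continuous_on UNIV g" and cmp: "compact (closure {x. g x \<noteq> 0})"
    using assms by (auto simp: C0_def)
  from compact_imp_bounded[OF cmp] obtain R where R: "\<And>x. x \<in> closure {x. g x \<noteq> 0} \<Longrightarrow> \<bar>x\<bar> \<le> R"
    by (auto simp: bounded_iff)
  define R' where "R' = max 0 R"
  have supp: "g x = 0" if "R' < \<bar>x\<bar>" for x
    using R[OF closure_subset[THEN subsetD], of x] that by (auto simp: R'_def)
  \<comment> \<open>The margin 1 ensures that two points at distance below 1 either both lie in the
    interval or both lie outside the support.\<close>
  let ?I = "{- (R' + 1)..R' + 1}"
  have contI: "continuous_on ?I g" using cont by (rule continuous_on_subset) simp
  have "bounded (g ` ?I)"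
    using compact_continuous_image[OF contI] by (intro compact_imp_bounded) simp
  then obtain G where "\<forall>x\<in>?I. \<bar>g x\<bar> \<le> G" by (auto simp: bounded_iff)
  then have G: "\<bar>g x\<bar> \<le> G" if "x \<in> ?I" for x using that by blast
  have "\<bar>g 0\<bar> \<le> G" by (rule G) (simp add: R'_def le_max_iff_disj)
  then have G0: "0 \<le> G" by linarith
  have G': "\<bar>g x\<bar> \<le> G" for x
    using G[of x] supp[of x] G0 by (cases "x \<in> ?I") auto
  have "uniformly_continuous_on ?I g"
    using contI by (rule compact_uniformly_continuous) simp
  then have uc: "\<exists>d>0. \<forall>x\<in>?I. \<forall>x'\<in>?I. dist x' x < d \<longrightarrow> dist (g x') (g x) < e" if "0 < e" for e
    using that unfolding uniformly_continuous_on_def by blast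
  have "uniformly_continuous_on UNIV g"
    unfolding uniformly_continuous_on_def
  proof (intro allI impI)
    fix e :: real assume e: "0 < e"
    from uc[OF e] obtain d where d: "0 < d" "\<And>x x'. x \<in> ?I \<Longrightarrow> x' \<in> ?I \<Longrightarrow> dist x' x < d \<Longrightarrow> dist (g x') (g x) < e"
      by blast
    have "dist (g x') (g x) < e" if "dist x' x < min d 1" for x x'
    proof (cases "x \<in> ?I \<and> x' \<in> ?I")
      case True
      then show ?thesis using d that by simp
    next
      case False
      then have "R' < \<bar>x\<bar>" "R' < \<bar>x'\<bar>" using that by (auto simp: dist_real_def)
      then show ?thesis using supp e by simp
    qed
    then show "\<exists>d>0. \<forall>x\<in>UNIV. \<forall>x'\<in>UNIV. dist x' x < d \<longrightarrow> dist (g x') (g x) < e"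
      using d(1) by (intro exI[of _ "min d 1"]) auto
  qed
  then show ?thesis
    using that[of R' G] supp G0 G' cont by (simp add: R'_def)
qed

lemma C0_I:
  assumes "continuous_on UNIV g" "\<And>x. R < \<bar>x\<bar> \<Longrightarrow> g x = (0::real)"
  shows "g \<in> C0"
proof -
  have "{x. g x \<noteq> 0} \<subseteq> {-R..R}" using assms(2) by (force simp: not_less abs_le_iff)
  then have "closure {x. g x \<noteq> 0} \<subseteq> {-R..R}" by (rule closure_minimal) simp
  then have "compact (closure {x. g x \<noteq> 0})"
    using compact_Int_closed[OF compact_Icc closed_closure, of "-R" R "{x. g x \<noteq> 0}"] by (simp add: Int_absorb1)
  then show ?thesis using assms(1) by (simp add: C0_def)
qed

lemma empirical_eq_sum:
  assumes "finite W" "\<And>x. x \<notin> W \<Longrightarrow> g (real_of_int x / real N) = 0"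
  shows "empirical N \<xi> g = (1 / real N) * (\<Sum>x\<in>W. real (\<xi> x) * g (real_of_int x / real N))"
proof -
  have "(\<Sum>\<^sub>\<infinity>x. real (\<xi> x) * g (real_of_int x / real N)) = (\<Sum>\<^sub>\<infinity>x\<in>W. real (\<xi> x) * g (real_of_int x / real N))"
    by (rule infsum_cong_neutral) (use assms(2) in auto)
  then show ?thesis using assms(1) by (simp add: empirical_def)
qed

context quenched
begin

lemma empirical_measurable:
  assumes "1 \<le> N" "g \<in> C0" shows "(\<lambda>s. empirical N (\<eta> N s) g) \<in> borel_measurable M"
proof -
  from assms(2) obtain R where R: "\<And>x. R < \<bar>x\<bar> \<Longrightarrow> g x = 0" by (rule C0_E) blast
  define m where "m = nat \<lceil>R * N\<rceil>"
  have "empirical N (\<eta> N s) g = (1 / real N) * (\<Sum>x\<in>{- int m..int m}. real (\<eta> N s x) * g (real_of_int x / real N))" for s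
  proof (rule empirical_eq_sum)
    fix x assume "x \<notin> {- int m..int m}"
    then have "int m < \<bar>x\<bar>" by auto
    then have "R * N < \<bar>real_of_int x\<bar>" unfolding m_def by linarith
    then show "g (real_of_int x / real N) = 0" using assms(1) by (intro R) (simp add: field_simps)
  qed simp
  then show ?thesis using assms(1) by simp
qed

lemma sum_particles_measurable:
  fixes f :: "int \<Rightarrow> real"
  assumes N: "1 \<le> N" shows "(\<lambda>s. \<Sum>i=1..\<eta> N s y. f (X y i s n)) \<in> borel_measurable M"
proof (rule measurable_compose_countable[OF _ \<eta>_measurable[OF N]])
  fix j
  show "(\<lambda>s. \<Sum>i=1..j. f (X y i s n)) \<in> borel_measurable M"
  proof (rule borel_measurable_sum)
    fix i assume "i \<in> {1..j}"
    then show "(\<lambda>s. f (X y i s n)) \<in> borel_measurable M"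
      by (intro measurable_compose[OF X_measurable, where g=f]) auto
  qed
qed

text \<open>\<open>supp\<close> leaves a margin of n around the support of g, so with at most n
  steps only starts in [-m, m] contribute. Both infinite sums become finite and can be
  interchanged.\<close>

lemma empirical_particles:
  assumes N: "1 \<le> N" and range: "\<And>y i. 1 \<le> i \<Longrightarrow> \<bar>X y i s n - y\<bar> \<le> int n"
    and supp: "\<And>x. int m < \<bar>x\<bar> + int n \<Longrightarrow> g (real_of_int x / real N) = 0"
  shows "empirical N (particles X (\<eta> N) n s) g
    = (1 / real N) * (\<Sum>y\<in>{- int m..int m}. \<Sum>i=1..\<eta> N s y. g (real_of_int (X y i s n) / real N))"
proof -
  let ?W = "{- int m..int m}"
  let ?g = "\<lambda>x. g (real_of_int x / real N)"
  have part: "real (particles X (\<eta> N) n s x) * ?g x = (\<Sum>y\<in>?W. \<Sum>i=1..\<eta> N s y. of_bool (X y i s n = x) * ?g x)" for x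
  proof (cases "?g x = 0")
    case False
    then have x: "\<bar>x\<bar> + int n \<le> int m" using supp[of x] by (meson not_le)
    have "(\<Sum>\<^sub>\<infinity>y. \<Sum>i=1..\<eta> N s y. of_bool (X y i s n = x)) = (\<Sum>\<^sub>\<infinity>y\<in>?W. \<Sum>i=1..\<eta> N s y. (of_bool (X y i s n = x) :: nat))"
    proof (rule infsum_cong_neutral)
      fix y assume "y \<in> UNIV - ?W"
      then have "int m < \<bar>y\<bar>" by auto
      then have "X y i s n \<noteq> x" if "1 \<le> i" for i using range[OF that, of y] x by auto
      then show "(\<Sum>i=1..\<eta> N s y. (of_bool (X y i s n = x) :: nat)) = 0" by (intro sum.neutral) auto
    qed auto
    then have "particles X (\<eta> N) n s x = (\<Sum>y\<in>?W. \<Sum>i=1..\<eta> N s y. of_bool (X y i s n = x))"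
      unfolding particles_def by simp
    then show ?thesis by (simp only: of_nat_sum of_nat_of_bool sum_distrib_right)
  qed simp
  have "empirical N (particles X (\<eta> N) n s) g = (1 / real N) * (\<Sum>x\<in>?W. real (particles X (\<eta> N) n s x) * ?g x)"
    using supp by (intro empirical_eq_sum) auto
  also have "(\<Sum>x\<in>?W. real (particles X (\<eta> N) n s x) * ?g x)
      = (\<Sum>y\<in>?W. \<Sum>i=1..\<eta> N s y. \<Sum>x\<in>?W. of_bool (X y i s n = x) * ?g x)"
    unfolding part by (subst sum.swap, intro sum.cong refl, subst sum.swap, rule refl)
  also have "\<dots> = (\<Sum>y\<in>?W. \<Sum>i=1..\<eta> N s y. ?g (X y i s n))"
  proof (intro sum.cong refl)
    fix y i
    have "(\<Sum>x\<in>?W. of_bool (X y i s n = x) * ?g x) = (\<Sum>x\<in>?W. if X y i s n = x then ?g x else 0)"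
      by (intro sum.cong) auto
    also have "\<dots> = ?g (X y i s n)"
      using supp[of "X y i s n"] by (auto simp: sum.delta)
    finally show "(\<Sum>x\<in>?W. of_bool (X y i s n = x) * ?g x) = ?g (X y i s n)" .
  qed
  finally show ?thesis .
qed

end

section \<open>The hydrodynamic limit for a fixed environment, time and test function\<close>

locale hydrodynamic = quenched +
  fixes v t R G :: real and g :: "real \<Rightarrow> real" and k :: nat
  assumes weak: "uniform_weak_lln \<omega> v" and t: "0 \<le> t"
    and supp: "\<And>x. R < \<bar>x\<bar> \<Longrightarrow> g x = 0"
    and G: "0 \<le> G" and g_le: "\<And>x. \<bar>g x\<bar> \<le> G"
    and ucont: "uniformly_continuous_on UNIV g" and cont: "continuous_on UNIV g"
    and k: "R + t + \<bar>v\<bar> * t + 1 \<le> real k"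
begin

definition steps :: "nat \<Rightarrow> nat" where "steps N = nat \<lfloor>real N * t\<rfloor>"
text \<open>The bound on k covers the support R, the at most t N steps of a particle and the shift
  |v| t. So the window contains every start from which the support can be reached, and the support
  of \<open>shifted\<close> on the scale N.\<close>

definition window :: "nat \<Rightarrow> int set" where "window N = {- int (k * N)..int (k * N)}"
definition shifted :: "real \<Rightarrow> real" where "shifted x = g (x + v * t)"
text \<open>A function of \<open>C0\<close> that is 1 on [-k, k]. The hypothesis applied to it
  bounds the number of particles in the window by a constant times N, through
  \<open>mass_le\<close>.\<close>

definition bump :: "real \<Rightarrow> real" where "bump x = max 0 (min 1 (real k + 1 - \<bar>x\<bar>))"
definition mass :: "nat \<Rightarrow> 'a \<Rightarrow> real" where "mass N s = (\<Sum>y\<in>window N. real (\<eta> N s y))"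
text \<open>A finite, hence measurable, form of the particle sum; the two agree on the almost sure
  event that no walk moves farther than its time.\<close>

definition emp :: "nat \<Rightarrow> 'a \<Rightarrow> real" where
  "emp N s = (1 / real N) * (\<Sum>y\<in>window N. \<Sum>i=1..\<eta> N s y. g (real_of_int (X y i s (steps N)) / real N))"

lemma steps_le: "real (steps N) \<le> real N * t"
  using t by (simp add: steps_def)

lemma vt: "0 \<le> \<bar>v\<bar> * t" using t by simp

lemma shifted_C0: "shifted \<in> C0"
proof (rule C0_I)
  show "continuous_on UNIV shifted"
    unfolding shifted_def[abs_def] by (intro continuous_on_compose2[OF cont] continuous_intros) auto
  fix x assume "R + \<bar>v\<bar> * t < \<bar>x\<bar>"
  moreover have "\<bar>v * t\<bar> = \<bar>v\<bar> * t" using t by (simp add: abs_mult)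
  ultimately have "R < \<bar>x + v * t\<bar>" by linarith
  then show "shifted x = 0" by (simp add: shifted_def supp)
qed

lemma bump_C0: "bump \<in> C0"
  unfolding bump_def[abs_def] by (rule C0_I[of _ "real k + 1"]) (auto intro!: continuous_intros)

lemma empirical_emp:
  assumes N: "1 \<le> N" and range: "\<And>y i n. 1 \<le> i \<Longrightarrow> \<bar>X y i s n - y\<bar> \<le> int n"
  shows "empirical N (particles X (\<eta> N) (steps N) s) g = emp N s"
  unfolding emp_def window_def
proof (rule empirical_particles[OF N range])
  fix x assume "int (k * N) < \<bar>x\<bar> + int (steps N)"
  then have "real_of_int (int (k * N)) < real_of_int (\<bar>x\<bar> + int (steps N))" by (simp only: of_int_less_iff)
  then have "real k * N < \<bar>real_of_int x\<bar> + steps N" by simp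
  moreover have "(R + t) * N \<le> real k * N" using k vt by (intro mult_right_mono) auto
  ultimately have "R * N < \<bar>real_of_int x\<bar>" using steps_le[of N] by (simp add: algebra_simps)
  then show "g (real_of_int x / real N) = 0" using N by (intro supp) (simp add: field_simps)
qed

lemma AE_emp: "AE s in M. \<forall>N\<ge>1. empirical N (particles X (\<eta> N) (steps N) s) g = emp N s"
  using AE_range by eventually_elim (auto intro: empirical_emp)

lemma empirical_shifted:
  assumes "1 \<le> N"
  shows "empirical N (\<eta> N s) shifted = (1 / real N) * (\<Sum>y\<in>window N. real (\<eta> N s y) * g (real_of_int y / real N + v * t))"
proof -
  have "shifted (real_of_int x / real N) = 0" if "x \<notin> window N" for x
  proof -
    have "int (k * N) < \<bar>x\<bar>" using that by (auto simp: window_def)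
    then have "real_of_int (int (k * N)) < real_of_int \<bar>x\<bar>" by (simp only: of_int_less_iff)
    then have "real k * N < \<bar>real_of_int x\<bar>" by simp
    then have "real k < \<bar>real_of_int x / real N\<bar>" using assms by (simp add: field_simps)
    moreover have "\<bar>v * t\<bar> = \<bar>v\<bar> * t" using t by (simp add: abs_mult)
    ultimately have "R < \<bar>real_of_int x / real N + v * t\<bar>" using k t by linarith
    then show ?thesis by (simp add: shifted_def supp)
  qed
  then show ?thesis by (subst empirical_eq_sum[of "window N"]) (auto simp: window_def shifted_def)
qed

lemma mass_le:
  assumes "1 \<le> N" shows "mass N s \<le> real N * empirical N (\<eta> N s) bump"
proof -
  let ?W = "{- int ((k + 1) * N)..int ((k + 1) * N)}"
  have "empirical N (\<eta> N s) bump = (1 / real N) * (\<Sum>x\<in>?W. real (\<eta> N s x) * bump (real_of_int x / real N))"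
  proof (rule empirical_eq_sum)
    fix x assume "x \<notin> ?W"
    then have "int ((k + 1) * N) < \<bar>x\<bar>" by auto
    then have "real_of_int (int ((k + 1) * N)) < real_of_int \<bar>x\<bar>" by (simp only: of_int_less_iff)
    then have "(real k + 1) * N < \<bar>real_of_int x\<bar>" by (simp add: algebra_simps)
    then have "real k + 1 < \<bar>real_of_int x / real N\<bar>" using assms by (simp add: field_simps)
    then show "bump (real_of_int x / real N) = 0" by (simp add: bump_def)
  qed simp
  then have eq: "real N * empirical N (\<eta> N s) bump = (\<Sum>x\<in>?W. real (\<eta> N s x) * bump (real_of_int x / real N))"
    using assms by simp
  have "mass N s = (\<Sum>x\<in>window N. real (\<eta> N s x) * bump (real_of_int x / real N))"
    unfolding mass_def
  proof (rule sum.cong)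
    fix x assume "x \<in> window N"
    then have "\<bar>x\<bar> \<le> int (k * N)" by (auto simp: window_def)
    then have "real_of_int \<bar>x\<bar> \<le> real_of_int (int (k * N))" by (simp only: of_int_le_iff)
    then have "\<bar>real_of_int x\<bar> \<le> real k * N" by simp
    then have "\<bar>real_of_int x / real N\<bar> \<le> real k" using assms by (simp add: field_simps)
    then have "bump (real_of_int x / real N) = 1" by (simp add: bump_def)
    then show "real (\<eta> N s x) = real (\<eta> N s x) * bump (real_of_int x / real N)" by simp
  qed simp
  also have "\<dots> \<le> (\<Sum>x\<in>?W. real (\<eta> N s x) * bump (real_of_int x / real N))"
    by (intro sum_mono2) (auto simp: window_def bump_def)
  finally show ?thesis unfolding eq .
qed

lemma mass_measurable: "1 \<le> N \<Longrightarrow> mass N \<in> borel_measurable M"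
  unfolding mass_def[abs_def] by measurable

lemma emp_measurable: "1 \<le> N \<Longrightarrow> emp N \<in> borel_measurable M"
  unfolding emp_def[abs_def]
  by (intro borel_measurable_times borel_measurable_sum borel_measurable_const
    sum_particles_measurable[where f="\<lambda>z. g (real_of_int z / real _)"])

abbreviation init :: "nat \<Rightarrow> 'a \<Rightarrow> real" where "init N s \<equiv> empirical N (\<eta> N s) shifted"

text \<open>A particle near its expected position changes g by at most \<epsilon>, any other by at
  most 2 G. The walks enter only through the number of bad particles.\<close>

lemma emp_init_diff_le:
  assumes N: "1 \<le> N" and \<epsilon>: "0 \<le> \<epsilon>" and \<delta>: "0 < \<delta>"
    and uc: "\<And>x x'. dist x' x \<le> \<delta> \<Longrightarrow> dist (g x') (g x) \<le> \<epsilon>"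
  shows "real N * \<bar>emp N s - init N s\<bar> \<le> \<epsilon> * mass N s
    + 2 * G * real (count_bad N (steps N) (window N) (\<lambda>y z. \<delta> * real N < \<bar>real_of_int z - real_of_int y - v * (real N * t)\<bar>) s)"
proof -
  let ?b = "\<lambda>y z. \<delta> * real N < \<bar>real_of_int z - real_of_int y - v * (real N * t)\<bar>"
  let ?x = "\<lambda>y i. X y i s (steps N)"
  have diff_le: "\<bar>g (real_of_int z / real N) - g (real_of_int y / real N + v * t)\<bar> \<le> \<epsilon> + 2 * G * of_bool (?b y z)" for y z
  proof (cases "?b y z")
    case True
    have "\<bar>g (real_of_int z / real N) - g (real_of_int y / real N + v * t)\<bar> \<le> G + G"
      using g_le[of "real_of_int z / real N"] g_le[of "real_of_int y / real N + v * t"] by linarith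
    then show ?thesis using True \<epsilon> by simp
  next
    case False
    have "real_of_int z - real_of_int y - v * (real N * t) = (real_of_int z / real N - (real_of_int y / real N + v * t)) * real N"
      using N by (simp add: field_simps)
    then have "\<bar>real_of_int z - real_of_int y - v * (real N * t)\<bar> = \<bar>real_of_int z / real N - (real_of_int y / real N + v * t)\<bar> * real N"
      by (simp add: abs_mult)
    then have "\<bar>real_of_int z / real N - (real_of_int y / real N + v * t)\<bar> \<le> \<delta>"
      using False N by (simp add: not_less)
    then have "dist (g (real_of_int z / real N)) (g (real_of_int y / real N + v * t)) \<le> \<epsilon>"
      by (intro uc) (simp add: dist_real_def)
    then show ?thesis using False by (simp add: dist_real_def)
  qed
  have "real N * (emp N s - init N s) = (\<Sum>y\<in>window N. \<Sum>i=1..\<eta> N s y. g (real_of_int (?x y i) / real N) - g (real_of_int y / real N + v * t))"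
    unfolding emp_def empirical_shifted[OF N] using N by (simp add: right_diff_distrib sum_subtractf)
  then have "real N * \<bar>emp N s - init N s\<bar> = \<bar>\<Sum>y\<in>window N. \<Sum>i=1..\<eta> N s y. g (real_of_int (?x y i) / real N) - g (real_of_int y / real N + v * t)\<bar>"
    by (metis abs_mult abs_of_nat)
  also have "\<dots> \<le> (\<Sum>y\<in>window N. \<Sum>i=1..\<eta> N s y. \<bar>g (real_of_int (?x y i) / real N) - g (real_of_int y / real N + v * t)\<bar>)"
    by (intro order_trans[OF sum_abs] sum_mono sum_abs)
  also have "\<dots> \<le> (\<Sum>y\<in>window N. \<Sum>i=1..\<eta> N s y. \<epsilon> + 2 * G * of_bool (?b y (?x y i)))"
    by (intro sum_mono diff_le)
  also have "\<dots> = \<epsilon> * mass N s + 2 * G * (\<Sum>y\<in>window N. \<Sum>i=1..\<eta> N s y. of_bool (?b y (?x y i)))"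
    unfolding mass_def sum.distrib sum_distrib_left sum_constant by (simp add: mult.commute)
  also have "(\<Sum>y\<in>window N. \<Sum>i=1..\<eta> N s y. of_bool (?b y (?x y i))) = real (count_bad N (steps N) (window N) ?b s)"
    unfolding count_bad_def of_nat_sum of_nat_of_bool ..
  finally show ?thesis .
qed

text \<open>The weak law enters with one fixed q; the exponential rate in N comes from the Chernoff
  bound over the particles.\<close>

lemma prob_emp_init_deviation:
  assumes \<epsilon>: "0 < \<epsilon>" and K: "0 \<le> K"
  shows "\<exists>a>0. \<forall>\<^sub>F N in sequentially.
    prob {s\<in>space M. \<epsilon> < \<bar>emp N s - init N s\<bar> \<and> mass N s \<le> K * real N} \<le> exp (- (a * real N))"
proof -
  \<comment> \<open>The budget is \<epsilon> / 2 for the good particles, \<epsilon> / 2 for up to a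
    N bad ones, and 2 q K <= a / 2, so that the Chernoff exponent 2 q K N - a N is at most - a N /
    2. The + 1 in the denominators allows G = 0 and K = 0.\<close>
  define \<epsilon>1 where "\<epsilon>1 = \<epsilon> / (2 * (K + 1))"
  define a where "a = \<epsilon> / (4 * (G + 1))"
  define q where "q = a / (4 * (K + 1))"
  have pos: "0 < \<epsilon>1" "0 < a" "0 < q" using \<epsilon> K G by (auto simp: \<epsilon>1_def a_def q_def)
  have \<epsilon>1K: "\<epsilon>1 * K \<le> \<epsilon> / 2" using \<epsilon> K by (simp add: \<epsilon>1_def field_simps)
  have Ga: "2 * G * a \<le> \<epsilon> / 2" using \<epsilon> G by (simp add: a_def field_simps)
  have qK: "2 * q * K \<le> a / 2" using pos K by (simp add: q_def field_simps)
  obtain d where d: "0 < d" "\<And>x x'. dist x' x < d \<Longrightarrow> dist (g x') (g x) < \<epsilon>1"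
    using ucont[unfolded uniformly_continuous_on_def, rule_format, OF pos(1)] by auto
  define \<delta> where "\<delta> = d / 2"
  have \<delta>: "0 < \<delta>" "\<And>x x'. dist x' x \<le> \<delta> \<Longrightarrow> dist (g x') (g x) \<le> \<epsilon>1"
    using d by (auto simp: \<delta>_def intro!: less_imp_le)
  let ?b = "\<lambda>N y z. \<delta> * real N < \<bar>real_of_int z - real_of_int y - v * (real N * t)\<bar>"
  have "\<forall>\<^sub>F N in sequentially. \<forall>y. \<bar>real_of_int y\<bar> \<le> real k * real N \<longrightarrow>
       (walk_op \<omega> ^^ steps N) (\<lambda>z. of_bool (?b N y z \<and> \<bar>z - y\<bar> \<le> int (steps N))) y \<le> q"
    using weak t \<delta>(1) pos(3) unfolding uniform_weak_lln_def steps_def by simp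
  then have "\<forall>\<^sub>F N in sequentially.
    prob {s\<in>space M. \<epsilon> < \<bar>emp N s - init N s\<bar> \<and> mass N s \<le> K * real N} \<le> exp (- (a / 2 * real N))"
    using eventually_ge_at_top[of 1]
  proof eventually_elim
    case (elim N)
    let ?c = "\<lambda>s. real (count_bad N (steps N) (window N) (?b N) s)"
    have "prob {s\<in>space M. \<epsilon> < \<bar>emp N s - init N s\<bar> \<and> mass N s \<le> K * real N}
      \<le> prob {s\<in>space M. (\<Sum>y\<in>window N. real (\<eta> N s y)) \<le> K * real N \<and> a * real N \<le> ?c s}"
    proof (rule finite_measure_mono)
      show "{s\<in>space M. \<epsilon> < \<bar>emp N s - init N s\<bar> \<and> mass N s \<le> K * real N}
         \<subseteq> {s\<in>space M. (\<Sum>y\<in>window N. real (\<eta> N s y)) \<le> K * real N \<and> a * real N \<le> ?c s}"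
      proof safe
        fix s assume s: "\<epsilon> < \<bar>emp N s - init N s\<bar>" and m: "mass N s \<le> K * real N"
        then show "(\<Sum>y\<in>window N. real (\<eta> N s y)) \<le> K * real N" by (simp add: mass_def)
        show "a * real N \<le> ?c s"
        proof (rule ccontr)
          assume "\<not> a * real N \<le> ?c s"
          then have "2 * G * ?c s \<le> 2 * G * (a * real N)" using G by (intro mult_left_mono) auto
          moreover have "\<epsilon>1 * mass N s \<le> \<epsilon>1 * (K * real N)" using m pos by (intro mult_left_mono) auto
          moreover have "real N * \<bar>emp N s - init N s\<bar> \<le> \<epsilon>1 * mass N s + 2 * G * ?c s"
            using elim pos \<delta> by (intro emp_init_diff_le) auto
          ultimately have "real N * \<bar>emp N s - init N s\<bar> \<le> (\<epsilon>1 * K + 2 * G * a) * real N"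
            by (simp add: algebra_simps)
          also have "\<dots> \<le> \<epsilon> * real N" using \<epsilon>1K Ga by (intro mult_right_mono) auto
          finally have "\<bar>emp N s - init N s\<bar> \<le> \<epsilon>" using elim by (simp add: mult.commute)
          then show False using s by simp
        qed
      qed
      show "{s\<in>space M. (\<Sum>y\<in>window N. real (\<eta> N s y)) \<le> K * real N \<and> a * real N \<le> ?c s} \<in> sets M"
      proof -
        have "(\<lambda>s. ?c s) \<in> borel_measurable M"
          unfolding count_bad_def of_nat_sum of_nat_of_bool
          by (intro borel_measurable_sum sum_particles_measurable[OF elim(2), where f="\<lambda>z. of_bool (?b N _ z)"])
        moreover have "mass N \<in> borel_measurable M" using elim(2) by (rule mass_measurable)
        ultimately show ?thesis unfolding mass_def[symmetric] by measurable
      qed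
    qed
    also have "\<dots> \<le> exp (2 * q * (K * real N) - a * real N)"
    proof (rule prob_count_bad)
      show "1 \<le> N" by (rule elim(2))
      show "finite (window N)" by (simp add: window_def)
      show "0 \<le> q" using pos by simp
      fix y assume "y \<in> window N"
      then have "\<bar>y\<bar> \<le> int (k * N)" by (auto simp: window_def)
      then have "real_of_int \<bar>y\<bar> \<le> real_of_int (int (k * N))" by (simp only: of_int_le_iff)
      then have "\<bar>real_of_int y\<bar> \<le> real k * N" by simp
      then show "(walk_op \<omega> ^^ steps N) (\<lambda>z. of_bool (?b N y z \<and> \<bar>z - y\<bar> \<le> int (steps N))) y \<le> q"
        using elim(1) by blast
    qed
    also have "\<dots> \<le> exp (- (a / 2 * real N))"
      using mult_right_mono[OF qK, of "real N"] by (simp add: algebra_simps)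
    finally show ?case .
  qed
  then show ?thesis using pos(2) by (intro exI[of _ "a / 2"]) auto
qed

text \<open>Borel-Cantelli for each of the countably many tolerances 1 / (j + 1). The mass condition
  inside the events is discharged path by path, because the average of \<open>bump\<close> converges
  to l' < K.\<close>

lemma AE_emp_tendsto:
  assumes init: "AE s in M. (\<lambda>N. init N s) \<longlonglongrightarrow> l"
    and bump: "AE s in M. (\<lambda>N. empirical N (\<eta> N s) bump) \<longlonglongrightarrow> l'"
  shows "AE s in M. (\<lambda>N. emp N s) \<longlonglongrightarrow> l"
proof -
  define K where "K = \<bar>l'\<bar> + 1"
  have K: "0 \<le> K" "l' < K" by (auto simp: K_def)
  have "AE s in M. \<forall>j. \<forall>\<^sub>F N in sequentially. \<not> (1 / real (Suc j) < \<bar>emp N s - init N s\<bar> \<and> mass N s \<le> K * real N)"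
  proof (intro AE_all_countable[THEN iffD2] allI)
    fix j
    let ?E = "\<lambda>N. {s\<in>space M. 1 / real (Suc j) < \<bar>emp N s - init N s\<bar> \<and> mass N s \<le> K * real N}"
    \<comment> \<open>Nothing is assumed about \<open>\<eta> 0\<close>; the empty set at N = 0 keeps
      all events measurable.\<close>
    let ?A = "\<lambda>N. if 1 \<le> N then ?E N else {}"
    obtain a where a: "0 < a" "\<forall>\<^sub>F N in sequentially. prob (?E N) \<le> exp (- (a * real N))"
      using prob_emp_init_deviation[of "1 / real (Suc j)", OF _ K(1)] by auto
    have "summable (\<lambda>N. exp (- a) ^ N)" using a(1) by (intro summable_geometric) auto
    moreover have "exp (- a) ^ N = exp (- (a * real N))" for N
      by (simp add: exp_of_nat_mult[symmetric] mult.commute)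
    ultimately have "summable (\<lambda>N. exp (- (a * real N)))" by simp
    moreover have "\<forall>\<^sub>F N in sequentially. norm (prob (?A N)) \<le> exp (- (a * real N))"
      using a(2) by eventually_elim auto
    ultimately have "summable (\<lambda>N. prob (?A N))" by (rule summable_comparison_test_ev[rotated])
    moreover have "?A N \<in> sets M" for N
    proof (cases "1 \<le> N")
      case True
      note [measurable] = emp_measurable[OF True] mass_measurable[OF True] empirical_measurable[OF True shifted_C0]
      show ?thesis using True by simp
    qed simp
    ultimately have "AE s in M. \<forall>\<^sub>F N in sequentially. s \<in> space M - ?A N"
      by (intro borel_cantelli_AE1) (auto simp: less_top[symmetric])
    then show "AE s in M. \<forall>\<^sub>F N in sequentially. \<not> (1 / real (Suc j) < \<bar>emp N s - init N s\<bar> \<and> mass N s \<le> K * real N)"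
    proof eventually_elim
      case (elim s)
      from elim eventually_ge_at_top[of 1] show ?case by eventually_elim auto
    qed
  qed
  then show ?thesis using init bump
  proof eventually_elim
    case (elim s)
    have "\<forall>\<^sub>F N in sequentially. empirical N (\<eta> N s) bump < K"
      using elim(3) K(2) by (rule order_tendstoD(2))
    then have mass: "\<forall>\<^sub>F N in sequentially. mass N s \<le> K * real N"
      using eventually_ge_at_top[of 1]
    proof eventually_elim
      case (elim N)
      have "mass N s \<le> real N * empirical N (\<eta> N s) bump" using elim(2) by (rule mass_le)
      also have "\<dots> \<le> real N * K" using elim(1) by (intro mult_left_mono) auto
      finally show ?case by (simp add: mult.commute)
    qed
    have "(\<lambda>N. emp N s - init N s) \<longlonglongrightarrow> 0"
    proof (rule tendstoI)
      fix e :: real assume "0 < e"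
      then obtain j where j: "1 / real (Suc j) < e" using nat_approx_posE by blast
      from elim(1)[rule_format, of j] mass show "\<forall>\<^sub>F N in sequentially. dist (emp N s - init N s) 0 < e"
        by eventually_elim (use j in auto)
    qed
    from tendsto_add[OF this elim(2)] show ?case by simp
  qed
qed

lemma emp_tendsto_in_prob:
  assumes init: "tendsto_in_prob M (\<lambda>N s. init N s) l"
    and bump: "tendsto_in_prob M (\<lambda>N s. empirical N (\<eta> N s) bump) l'"
  shows "tendsto_in_prob M (\<lambda>N s. empirical N (particles X (\<eta> N) (steps N) s) g) l"
  unfolding tendsto_in_prob_def
proof (intro allI impI)
  fix \<epsilon> :: real assume \<epsilon>: "0 < \<epsilon>"
  define K where "K = \<bar>l'\<bar> + 1"
  have K: "0 \<le> K" by (simp add: K_def)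
  obtain a where a: "0 < a" "\<forall>\<^sub>F N in sequentially.
      prob {s\<in>space M. \<epsilon> / 2 < \<bar>emp N s - init N s\<bar> \<and> mass N s \<le> K * real N} \<le> exp (- (a * real N))"
    using prob_emp_init_deviation[OF _ K, of "\<epsilon> / 2"] \<epsilon> by auto
  let ?p1 = "\<lambda>N. prob {s\<in>space M. \<epsilon> / 2 < \<bar>init N s - l\<bar>}"
  \<comment> \<open>Outside this event the average of \<open>bump\<close> is at most l' + 1 / 2 <=
    K, so the mass is at most K N.\<close>
  let ?p2 = "\<lambda>N. prob {s\<in>space M. 1 / 2 < \<bar>empirical N (\<eta> N s) bump - l'\<bar>}"
  have "(\<lambda>N. exp (- a) ^ N) \<longlonglongrightarrow> 0" using a(1) by (intro LIMSEQ_power_zero) auto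
  then have "(\<lambda>N. exp (- (a * real N))) \<longlonglongrightarrow> 0"
    by (simp add: exp_of_nat_mult[symmetric] mult.commute)
  then have lim: "(\<lambda>N. ?p1 N + ?p2 N + exp (- (a * real N))) \<longlonglongrightarrow> 0 + 0 + 0"
    by (intro tendsto_add init[unfolded tendsto_in_prob_def, rule_format] bump[unfolded tendsto_in_prob_def, rule_format])
      (use \<epsilon> in auto)
  show "(\<lambda>N. prob {s\<in>space M. \<epsilon> < \<bar>empirical N (particles X (\<eta> N) (steps N) s) g - l\<bar>}) \<longlonglongrightarrow> 0"
  proof (rule tendsto_sandwich[OF _ _ tendsto_const lim[unfolded add_0_left]])
    show "\<forall>\<^sub>F N in sequentially. prob {s\<in>space M. \<epsilon> < \<bar>empirical N (particles X (\<eta> N) (steps N) s) g - l\<bar>}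
       \<le> ?p1 N + ?p2 N + exp (- (a * real N))"
      using a(2) eventually_ge_at_top[of 1]
    proof eventually_elim
      case (elim N)
      note [measurable] = emp_measurable[OF elim(2)] mass_measurable[OF elim(2)]
        empirical_measurable[OF elim(2) shifted_C0] empirical_measurable[OF elim(2) bump_C0]
      let ?A = "{s\<in>space M. \<epsilon> / 2 < \<bar>init N s - l\<bar>}"
      let ?B = "{s\<in>space M. 1 / 2 < \<bar>empirical N (\<eta> N s) bump - l'\<bar>}"
      let ?C = "{s\<in>space M. \<epsilon> / 2 < \<bar>emp N s - init N s\<bar> \<and> mass N s \<le> K * real N}"
      \<comment> \<open>Only the event on the right has to be measurable; the inclusion is checked
        almost everywhere, where the particle sum equals \<open>emp\<close>.\<close>
      have "prob {s\<in>space M. \<epsilon> < \<bar>empirical N (particles X (\<eta> N) (steps N) s) g - l\<bar>} \<le> prob ((?A \<union> ?B) \<union> ?C)"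
      proof (rule finite_measure_mono_AE)
        show "AE s in M. s \<in> {s\<in>space M. \<epsilon> < \<bar>empirical N (particles X (\<eta> N) (steps N) s) g - l\<bar>} \<longrightarrow> s \<in> (?A \<union> ?B) \<union> ?C"
          using AE_emp
        proof eventually_elim
          case (elim s)
          have eq: "empirical N (particles X (\<eta> N) (steps N) s) g = emp N s" using elim \<open>1 \<le> N\<close> by blast
          show ?case
          proof
            assume s: "s \<in> {s\<in>space M. \<epsilon> < \<bar>empirical N (particles X (\<eta> N) (steps N) s) g - l\<bar>}"
            show "s \<in> (?A \<union> ?B) \<union> ?C"
            proof (rule ccontr)
              assume "s \<notin> (?A \<union> ?B) \<union> ?C"
              then have *: "\<bar>init N s - l\<bar> \<le> \<epsilon> / 2" "\<bar>empirical N (\<eta> N s) bump - l'\<bar> \<le> 1 / 2"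
                "\<epsilon> / 2 < \<bar>emp N s - init N s\<bar> \<Longrightarrow> \<not> mass N s \<le> K * real N"
                using s by auto
              have "empirical N (\<eta> N s) bump \<le> K" using *(2) unfolding K_def by linarith
              then have "real N * empirical N (\<eta> N s) bump \<le> real N * K" by (intro mult_left_mono) auto
              then have "mass N s \<le> K * real N" using mass_le[OF \<open>1 \<le> N\<close>, of s] by (simp add: mult.commute)
              then have "\<bar>emp N s - init N s\<bar> \<le> \<epsilon> / 2" using *(3) by (meson not_le)
              then have "\<bar>emp N s - l\<bar> \<le> \<epsilon>" using *(1) by linarith
              then show False using s eq by simp
            qed
          qed
        qed
      qed measurable
      also have "\<dots> \<le> prob ?A + prob ?B + prob ?C"
        by (intro order_trans[OF measure_Un_le] add_mono measure_Un_le order_refl) measurable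
      finally show ?case using elim(1) by linarith
    qed
  qed (auto intro: always_eventually)
qed

end


section \<open>From single environments to the averaged and the quenched statement\<close>

theorem theorem1p4:
  fixes P :: "env measure"
    and S :: "'a measure"
    and Q :: "env \<Rightarrow> 'a measure"
    and X :: "int \<Rightarrow> nat \<Rightarrow> 'a \<Rightarrow> nat \<Rightarrow> int"
    and \<eta> :: "nat \<Rightarrow> 'a \<Rightarrow> configuration"
    and c :: real
    and \<alpha>0 :: "real \<Rightarrow> real"
  assumes "prob_space P" and "sets P = sets env_space"
    and "iid_env P"
    and "c > 0" and "\<P>(\<omega> in P. \<omega> 0 \<in> {c..1 - c}) = 1"
    and "(\<integral>\<omega>. rho \<omega> 0 \<partial>P) < 1"
    and "Q \<in> measurable env_space (prob_algebra S)"
    and "\<And>\<omega>. \<omega> \<in> space env_space \<Longrightarrow> quenched_system \<omega> (Q \<omega>) X \<eta>"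
    and "\<alpha>0 \<in> borel_measurable borel" and "bounded (range \<alpha>0)"
  shows
    "((\<forall>g\<in>C0. AE s in averaged_law P Q.
          (\<lambda>N. empirical N (\<eta> N s) g) \<longlonglongrightarrow> (\<integral>y. \<alpha>0 y * g y \<partial>lborel))
      \<longrightarrow> (\<forall>g\<in>C0. \<forall>t\<ge>0. AE s in averaged_law P Q.
          (\<lambda>N. empirical N (particles X (\<eta> N) (nat \<lfloor>real N * t\<rfloor>) s) g)
            \<longlonglongrightarrow> (\<integral>y. \<alpha>0 (y - speed P * t) * g y \<partial>lborel)))
     \<and>
     ((AE \<omega> in P. \<forall>g\<in>C0. tendsto_in_prob (Q \<omega>)
          (\<lambda>N s. empirical N (\<eta> N s) g) (\<integral>y. \<alpha>0 y * g y \<partial>lborel))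
      \<longrightarrow> (AE \<omega> in P. \<forall>g\<in>C0. \<forall>t\<ge>0. tendsto_in_prob (Q \<omega>)
          (\<lambda>N s. empirical N (particles X (\<eta> N) (nat \<lfloor>real N * t\<rfloor>) s) g)
            (\<integral>y. \<alpha>0 (y - speed P * t) * g y \<partial>lborel)))"
proof -
  interpret P: prob_space P by fact
  let ?v = "speed P"
  have space_P: "space P = space env_space" using assms(2) by (rule sets_eq_imp_space_eq)
  have Q: "Q \<in> measurable P (prob_algebra S)"
    using assms(7) by (simp add: measurable_cong_sets[OF assms(2) refl])
  have sets_Q: "sets (Q \<omega>) = sets S" if "\<omega> \<in> space P" for \<omega>
    using measurable_space[OF Q that] by (simp add: space_prob_algebra)
  have quenched: "quenched (Q \<omega>) \<omega> X \<eta>" if \<omega>: "\<omega> \<in> space P" for \<omega>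
  proof -
    have "prob_space (Q \<omega>)" using measurable_space[OF Q \<omega>] by (simp add: space_prob_algebra)
    moreover have "quenched_system \<omega> (Q \<omega>) X \<eta>" using \<omega> assms(8) by (simp add: space_P)
    moreover have "0 \<le> \<omega> z \<and> \<omega> z \<le> 1" for z
      using \<omega> by (auto simp: space_P env_space_def space_PiM space_restrict_space PiE_def Pi_def)
    ultimately show ?thesis by (simp add: quenched_def quenched_axioms_def)
  qed
  have weak: "AE \<omega> in P. \<omega> \<in> space P \<and> uniform_weak_lln \<omega> ?v"
    using iid_env_uniform_weak_lln[OF assms(1-6)] AE_space by eventually_elim auto
  \<comment> \<open>Moves the translation from \<alpha>0 onto the test function, where it becomes
    \<open>shifted\<close>.\<close>
  have shift: "(\<integral>y. \<alpha>0 (y - ?v * t) * g y \<partial>lborel) = (\<integral>y. \<alpha>0 y * g (y + ?v * t) \<partial>lborel)" for g t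
    using lborel_integral_real_affine[of 1 "\<lambda>y. \<alpha>0 (y - ?v * t) * g y" "?v * t"] by (simp add: add.commute)
  \<comment> \<open>R, G and k are chosen before \<omega>, so that \<open>emp\<close>,
    \<open>shifted\<close> and \<open>bump\<close> are the same functions for all good
    environments.\<close>
  have hydro: "\<exists>R G k. \<forall>\<omega>. \<omega> \<in> space P \<and> uniform_weak_lln \<omega> ?v \<longrightarrow> hydrodynamic (Q \<omega>) \<omega> X \<eta> ?v t R G g k"
    if "g \<in> C0" "0 \<le> t" for g t
  proof -
    from that(1) obtain R G where RG: "\<And>x. R < \<bar>x\<bar> \<Longrightarrow> g x = 0" "0 \<le> G" "\<And>x. \<bar>g x\<bar> \<le> G"
      "uniformly_continuous_on UNIV g" "continuous_on UNIV g" by (rule C0_E) blast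
    show ?thesis
      by (intro exI[of _ R] exI[of _ G] exI[of _ "nat \<lceil>R + t + \<bar>?v\<bar> * t + 1\<rceil>"] allI impI
        hydrodynamic.intro hydrodynamic_axioms.intro quenched RG that(2) real_nat_ceiling_ge) auto
  qed
  show ?thesis
  proof (intro conjI impI ballI allI)
    fix g t
    assume init: "\<forall>g\<in>C0. AE s in averaged_law P Q. (\<lambda>N. empirical N (\<eta> N s) g) \<longlonglongrightarrow> (\<integral>y. \<alpha>0 y * g y \<partial>lborel)"
      and g: "g \<in> C0" and t: "(0::real) \<le> t"
    from hydro[OF g t] obtain R G k where
      hyd: "\<And>\<omega>. \<omega> \<in> space P \<and> uniform_weak_lln \<omega> ?v \<Longrightarrow> hydrodynamic (Q \<omega>) \<omega> X \<eta> ?v t R G g k" by blast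
    \<comment> \<open>Any good environment will do: it makes these functions available, and its
      measurability facts transfer to S because all \<open>Q \<omega>\<close> have the same
      measurable sets.\<close>
    obtain \<omega>0 where \<omega>0: "\<omega>0 \<in> space P \<and> uniform_weak_lln \<omega>0 ?v"
    proof (rule ccontr)
      assume no: "\<not> thesis"
      from weak have "AE \<omega> in P. False" by eventually_elim (use no that in blast)
      then show False by simp
    qed
    interpret H: hydrodynamic "Q \<omega>0" \<omega>0 X \<eta> ?v t R G g k using hyd[OF \<omega>0] .
    have sets0: "sets (Q \<omega>0) = sets S" using \<omega>0 by (simp add: sets_Q)
    have meas0: "measurable (Q \<omega>0) N = measurable S N" for N :: "'c measure"
      using sets0 by (rule measurable_cong_sets) simp
    have AE_init: "AE \<omega> in P. AE s in Q \<omega>. (\<lambda>N. empirical N (\<eta> N s) h) \<longlonglongrightarrow> (\<integral>y. \<alpha>0 y * h y \<partial>lborel)"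
      if h: "h \<in> C0" for h
    proof -
      \<comment> \<open>Starting at index 1 avoids \<open>\<eta> 0\<close>, whose measurability is
        unknown, and leaves the limit unchanged.\<close>
      let ?A = "\<lambda>s. (\<lambda>N. empirical (Suc N) (\<eta> (Suc N) s) h) \<longlonglongrightarrow> (\<integral>y. \<alpha>0 y * h y \<partial>lborel)"
      have "Measurable.pred S ?A"
        using H.empirical_measurable[OF _ h] unfolding meas0 by (intro measurable_limit) auto
      moreover have "AE s in P \<bind> Q. ?A s"
        using init h unfolding averaged_law_def by (auto elim!: eventually_mono intro: LIMSEQ_Suc)
      ultimately have "AE \<omega> in P. AE s in Q \<omega>. ?A s"
        using AE_bind[OF measurable_prob_algebraD[OF Q]] by blast
      then show ?thesis by eventually_elim (auto elim!: eventually_mono intro: LIMSEQ_imp_Suc)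
    qed
    let ?l = "\<integral>y. \<alpha>0 y * H.shifted y \<partial>lborel"
    \<comment> \<open>\<open>AE_bind\<close> is applied to a measurable event. Convergence of the
      finite sums together with the range condition is one, and it implies convergence of the
      particle sums.\<close>
    let ?A = "\<lambda>s. (\<lambda>N. H.emp (Suc N) s) \<longlonglongrightarrow> ?l \<and> (\<forall>y i. 1 \<le> i \<longrightarrow> (\<forall>n. \<bar>X y i s n - y\<bar> \<le> int n))"
    have "AE \<omega> in P. AE s in Q \<omega>. ?A s"
      using weak AE_init[OF H.shifted_C0] AE_init[OF H.bump_C0]
    proof eventually_elim
      case (elim \<omega>)
      interpret H': hydrodynamic "Q \<omega>" \<omega> X \<eta> ?v t R G g k using hyd[OF elim(1)] .
      from H'.AE_emp_tendsto[OF elim(2,3)] H'.AE_range show ?case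
        by eventually_elim (auto intro: LIMSEQ_Suc)
    qed
    moreover have "Measurable.pred S ?A"
    proof -
      have "H.emp (Suc N) \<in> borel_measurable S" for N
        using H.emp_measurable[of "Suc N"] unfolding meas0 by simp
      then have lim: "Measurable.pred S (\<lambda>s. (\<lambda>N. H.emp (Suc N) s) \<longlonglongrightarrow> ?l)"
        by (rule measurable_limit)
      have "Measurable.pred S (\<lambda>s. 1 \<le> i \<longrightarrow> (\<forall>n. \<bar>X y i s n - y\<bar> \<le> int n))" for y i
      proof (cases "1 \<le> i")
        case True
        have "(\<lambda>s. X y i s n) \<in> measurable S (count_space UNIV)" for n
          using H.X_measurable[OF True] unfolding meas0 .
        from measurable_compose[OF this, of "\<lambda>z. \<bar>z - y\<bar> \<le> int _" "count_space UNIV"]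
        have "Measurable.pred S (\<lambda>s. \<bar>X y i s n - y\<bar> \<le> int n)" for n by simp
        then have "Measurable.pred S (\<lambda>s. \<forall>n. \<bar>X y i s n - y\<bar> \<le> int n)"
          by (rule pred_intros_countable)
        then show ?thesis using True by simp
      qed simp
      then have "Measurable.pred S (\<lambda>s. \<forall>y i. 1 \<le> i \<longrightarrow> (\<forall>n. \<bar>X y i s n - y\<bar> \<le> int n))"
        by (intro pred_intros_countable)
      with lim show ?thesis by (rule pred_intros_logic)
    qed
    ultimately have "AE s in P \<bind> Q. ?A s"
      using AE_bind[OF measurable_prob_algebraD[OF Q]] by blast
    then show "AE s in averaged_law P Q. (\<lambda>N. empirical N (particles X (\<eta> N) (nat \<lfloor>real N * t\<rfloor>) s) g)
        \<longlonglongrightarrow> (\<integral>y. \<alpha>0 (y - ?v * t) * g y \<partial>lborel)"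
      unfolding averaged_law_def
    proof eventually_elim
      case (elim s)
      have "empirical (Suc N) (particles X (\<eta> (Suc N)) (H.steps (Suc N)) s) g = H.emp (Suc N) s" for N
        using elim by (intro H.empirical_emp) auto
      then have "(\<lambda>N. empirical (Suc N) (particles X (\<eta> (Suc N)) (H.steps (Suc N)) s) g) \<longlonglongrightarrow> ?l"
        using elim by simp
      then have "(\<lambda>N. empirical N (particles X (\<eta> N) (H.steps N) s) g) \<longlonglongrightarrow> ?l"
        by (rule LIMSEQ_imp_Suc)
      then show ?case unfolding shift H.steps_def H.shifted_def .
    qed
  next
    assume "AE \<omega> in P. \<forall>g\<in>C0. tendsto_in_prob (Q \<omega>) (\<lambda>N s. empirical N (\<eta> N s) g) (\<integral>y. \<alpha>0 y * g y \<partial>lborel)"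
    \<comment> \<open>The exceptional environments of \<open>weak\<close> depend on neither g nor t,
      so both can be fixed after \<omega>.\<close>
    with weak show "AE \<omega> in P. \<forall>g\<in>C0. \<forall>t\<ge>0. tendsto_in_prob (Q \<omega>)
        (\<lambda>N s. empirical N (particles X (\<eta> N) (nat \<lfloor>real N * t\<rfloor>) s) g) (\<integral>y. \<alpha>0 (y - ?v * t) * g y \<partial>lborel)"
    proof eventually_elim
      case (elim \<omega>)
      show ?case
      proof (intro ballI allI impI)
        fix g t assume g: "g \<in> C0" and t: "(0::real) \<le> t"
        from hydro[OF g t] elim(1) obtain R G k where "hydrodynamic (Q \<omega>) \<omega> X \<eta> ?v t R G g k" by blast
        then interpret H: hydrodynamic "Q \<omega>" \<omega> X \<eta> ?v t R G g k .
        have "tendsto_in_prob (Q \<omega>) (\<lambda>N s. empirical N (particles X (\<eta> N) (H.steps N) s) g) (\<integral>y. \<alpha>0 y * H.shifted y \<partial>lborel)"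
          using elim(2) H.shifted_C0 H.bump_C0 by (intro H.emp_tendsto_in_prob) auto
        then show "tendsto_in_prob (Q \<omega>) (\<lambda>N s. empirical N (particles X (\<eta> N) (nat \<lfloor>real N * t\<rfloor>) s) g)
            (\<integral>y. \<alpha>0 (y - ?v * t) * g y \<partial>lborel)"
          unfolding shift H.steps_def H.shifted_def .
      qed
    qed
  qed
qed

end
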